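(* Let $\{x_k\}\subset X$ satisfy $$x_k\to\bar x,\qquad \varepsilon_k:=\operatorname{dist}\bigl(0,\nabla\phi_k(x_k)+N_X(x_k)\bigr)\to0.$$ Let $\bar y$ be an accumulation point of $\{y_k^*(x_k)\}$. Suppose that the parameter sequences satisfy $\rho_k,\sigma_k,\delta_k>0$, $\rho_k\to\infty$, $\sigma_k\to0$, $\delta_k\to0$ and $\limsup_{k\to\infty}\sigma_k/\delta_k<\infty$, that $\mathcal S$ is inner semicontinuous at $\bar x$, and that $f$ is twice continuously differentiable in a neighborhood of $(\bar x,\bar y)$. Assume further that upper-level MFCQ holds at $\bar x$ and that lower-level LICQ and the uniform parametric error bound hold at $(\bar x,\bar y)$. Then $\bar y\in\mathcal S_p(\bar x)$ and $\bar x$ is a C-stationary point of the pessimistic bilevel problem $\min_{G(x)\le0}\max_{y\in\mathcal S(x)}F(x,y)$.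
   Context: $X\subseteq\mathbb R^n$ and $Y\subseteq\mathbb R^m$ are nonempty, closed and convex, and $F,f:\mathbb R^n\times\mathbb R^m\to\mathbb R$. For $x\in X$ let $\mathcal S(x):=\arg\min_{y\in Y}f(x,y)$. For a closed convex set $C$, $N_C(\cdot)$ is the normal cone of convex analysis (empty outside $C$). Standing assumptions. (A1) $F$ is continuously differentiable and $\nabla F$ is Lipschitz continuous on $X\times Y$. For every $x\in X$, $F(x,\cdot)$ is concave on $Y$ and $-F(x,\cdot)$ is coercive on $Y$, i.e. $\lim_{\|y\|\to\infty,\,y\in Y}F(x,y)=-\infty$. (A2) $f$ is continuously differentiable and $\nabla f$ is Lipschitz continuous on $X\times Y$. For every $x\in X$, $f(x,\cdot)$ is convex on $Y$ and $\mathcal S(x)\neq\emptyset$. For every bounded set $D_x\subseteq X$ there is a bounded set $D_y\subseteq Y$ with $\mathcal S(x)\cap D_y\neq\emptyset$ for every $x\in D_x$. (Representation) $X=\{x\in\mathbb R^n:G(x)\le0\}$ and $Y=\{y\in\mathbb R^m:g(y)\le0\}$, where $G:\mathbb R^n\to\mathbb R^q$ is continuously differentiable with convex components and $g:\mathbb R^m\to\mathbb R^p$ is twice continuously differentiable with convex components. Let $\mathcal S_p(x):=\arg\max_{y\in\mathcal S(x)}F(x,y)$. $\mathcal S$ is inner semicontinuous at $\bar x\in X$ if for every $\bar y\in\mathcal S(\bar x)$ and every $\{x_k\}\subset X$ with $x_k\to\bar x$ there are $y_k\in\mathcal S(x_k)$ with $y_k\to\bar y$. Smooth approximation. For $\rho,\sigma,\delta>0$,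 $$\psi_{\rho,\sigma,\delta}(x,y,z):=F(x,y)-\rho\bigl(f(x,y)-f(x,z)\bigr)+\tfrac{\sigma}{2}\|z\|^2-\sigma\langle y,z\rangle-\tfrac{\delta}{2}\|y\|^2,\quad \phi_{\rho,\sigma,\delta}(x):=\min_{z\in Y}\max_{y\in Y}\psi_{\rho,\sigma,\delta}(x,y,z).$$ For each $x\in X$ this minimax problem has a unique saddle point $(y_{\rho,\sigma,\delta}^*(x),z_{\rho,\sigma,\delta}^*(x))\in Y\times Y$, and $\phi_{\rho,\sigma,\delta}$ is differentiable with $\nabla\phi_{\rho,\sigma,\delta}(x)=\nabla_xF(x,y^* )-\rho\nabla_xf(x,y^* )+\rho\nabla_xf(x,z^* )$ at $(y^*,z^* )=(y_{\rho,\sigma,\delta}^*(x),z_{\rho,\sigma,\delta}^*(x))$. A subscript $k$ ($\phi_k,y_k^*,z_k^*$) means $(\rho,\sigma,\delta)=(\rho_k,\sigma_k,\delta_k)$. Multipliers and qualifications. For vector-valued maps, $\nabla$ denotes the Jacobian (so $\nabla g(y)\in\mathbb R^{p\times m}$, $\nabla G(x)\in\mathbb R^{q\times n}$); for scalar functions it is the gradient column vector. $\mathcal L(x,y,\mu):=\nabla_yf(x,y)+\nabla g(y)^\top\mu\in\mathbb R^m$, with Jacobians $\nabla_x\mathcal L\in\mathbb R^{m\times n}$, $\nabla_y\mathcal L\in\mathbb R^{m\times m}$. $\Lambda(x,y):=\{\mu\in\mathbb R^p:\mathcal L(x,y,\mu)=0,\ \mu\ge0,\ g(y)\le0,\ \mu^\top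 g(y)=0\}$. - Upper-level MFCQ at $\bar x$: $\pi\ge0$, $\pi^\top G(\bar x)=0$, $\nabla G(\bar x)^\top\pi=0$ imply $\pi=0$. - Lower-level LICQ at $(\bar x,y)$, $y\in\mathcal S(\bar x)$: the vectors $\{\nabla g_i(y):g_i(y)=0\}$ are linearly independent. - Uniform parametric error bound at $(\bar x,\bar y)$, $\bar y\in\mathcal S(\bar x)$: there are neighborhoods $U$ of $\bar x$, $V$ of $\bar y$ and $\kappa>0$ with $\operatorname{dist}(y,\mathcal S(x))\le\kappa\operatorname{dist}(0,\nabla_yf(x,y)+N_Y(y))$ for all $x\in X\cap U$, $y\in Y\cap V$. C-stationarity. A feasible $\bar x$ (near whose reference pair $f$ is twice continuously differentiable) is C-stationary if there exist $\bar y\in\mathcal S_p(\bar x)$, $\bar\mu\in\Lambda(\bar x,\bar y)$, $\pi\in\mathbb R^q$, $\omega\in\mathbb R^p$, $\gamma\in\mathbb R^m$ such that $$\nabla_xF(\bar x,\bar y)+\nabla_x\mathcal L(\bar x,\bar y,\bar\mu)^\top\gamma+\nabla G(\bar x)^\top\pi=0,\qquad \nabla_yF(\bar x,\bar y)+\nabla_y\mathcal L(\bar x,\bar y,\bar\mu)^\top\gamma+\nabla g(\bar y)^\top\omega=0,$$ $\pi\ge0$, $\pi^\top G(\bar x)=0$, $\omega_i=0$ for $i\in\mathcal I_1$, $\nabla g_i(\bar y)^\top\gamma=0$ for $i\in\mathcal I_3$, and $\omega_i\nabla g_i(\bar y)^\top\gamma\ge0$ for $i\in\mathcal I_2$, where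 $\mathcal I_1=\{i:\bar\mu_i=0,g_i(\bar y)<0\}$, $\mathcal I_2=\{i:\bar\mu_i=0,g_i(\bar y)=0\}$, $\mathcal I_3=\{i:\bar\mu_i>0,g_i(\bar y)=0\}$. *)

theory Defs
  imports "HOL-Analysis.Analysis"
begin

definition C1_on :: "'a::real_normed_vector set \<Rightarrow> ('a \<Rightarrow> 'b::real_normed_vector) \<Rightarrow> bool" where
  "C1_on A h \<longleftrightarrow>
     (\<exists>h'. (\<forall>x\<in>A. (h has_derivative blinfun_apply (h' x)) (at x)) \<and> continuous_on A h')"

definition C2_on :: "'a::real_normed_vector set \<Rightarrow> ('a \<Rightarrow> 'b::real_normed_vector) \<Rightarrow> bool" where
  "C2_on A h \<longleftrightarrow>
     (\<exists>h'. (\<forall>x\<in>A. (h has_derivative blinfun_apply (h' x)) (at x)) \<and> C1_on A h')"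

definition C2_near :: "'a::real_normed_vector \<Rightarrow> ('a \<Rightarrow> 'b::real_normed_vector) \<Rightarrow> bool" where
  "C2_near x h \<longleftrightarrow> (\<exists>W. open W \<and> x \<in> W \<and> C2_on W h)"

text \<open>The filter argument is used as in the library's jacobian. For the net
  \<open>at x\<close> the gradient is unique. For \<open>at x within X\<close> with \<open>X\<close> convex and
  \<open>x \<in> X\<close> it is unique up to vectors orthogonal to the affine hull of \<open>X\<close>; those
  belong to the lineality space of the normal cone to \<open>X\<close> at \<open>x\<close>, so the set
  gradient + normal cone does not depend on the choice.\<close>

definition gradient :: "('a::real_inner \<Rightarrow> real) \<Rightarrow> 'a filter \<Rightarrow> 'a" where
  "gradient h net = (SOME D. (h has_derivative (\<lambda>v. D \<bullet> v)) net)"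

definition normal_cone :: "'a::real_inner set \<Rightarrow> 'a \<Rightarrow> 'a set" where
  "normal_cone C x = (if x \<in> C then {v. \<forall>c\<in>C. v \<bullet> (c - x) \<le> 0} else {})"

definition lower_sol :: "('a \<times> 'b \<Rightarrow> real) \<Rightarrow> 'b set \<Rightarrow> 'a \<Rightarrow> 'b set" where
  "lower_sol f Y x = {y. is_arg_min (\<lambda>y. f (x, y)) (\<lambda>y. y \<in> Y) y}"

definition pess_sol ::
  "('a \<times> 'b \<Rightarrow> real) \<Rightarrow> ('a \<times> 'b \<Rightarrow> real) \<Rightarrow> 'b set \<Rightarrow> 'a \<Rightarrow> 'b set" where
  "pess_sol F f Y x = {y. is_arg_max (\<lambda>y. F (x, y)) (\<lambda>y. y \<in> lower_sol f Y x) y}"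

definition inner_semicontinuous_at ::
  "'a::topological_space set \<Rightarrow> ('a \<Rightarrow> 'b::topological_space set) \<Rightarrow> 'a \<Rightarrow> bool" where
  "inner_semicontinuous_at X S xb \<longleftrightarrow>
     (\<forall>yb\<in>S xb. \<forall>u. (\<forall>k. u k \<in> X) \<and> u \<longlonglongrightarrow> xb \<longrightarrow>
        (\<exists>v::nat \<Rightarrow> 'b. (\<forall>k. v k \<in> S (u k)) \<and> v \<longlonglongrightarrow> yb))"

definition psi ::
  "('a \<times> 'b::real_inner \<Rightarrow> real) \<Rightarrow> ('a \<times> 'b \<Rightarrow> real) \<Rightarrow> real \<Rightarrow> real \<Rightarrow> real \<Rightarrow>
   'a \<Rightarrow> 'b \<Rightarrow> 'b \<Rightarrow> real" where
  "psi F f \<rho> \<sigma> \<delta> x y z =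
     F (x, y) - \<rho> * (f (x, y) - f (x, z)) + \<sigma> / 2 * (norm z)\<^sup>2 - \<sigma> * (y \<bullet> z) - \<delta> / 2 * (norm y)\<^sup>2"

text \<open>For \<open>x\<close> in the upper-level feasible set, convexity of \<open>f (x, _)\<close> and concavity of
  \<open>F (x, _)\<close> make the inner supremum and the outer infimum finite and attained. For other
  \<open>x\<close> the value may be meaningless.\<close>

definition phi ::
  "('a \<times> 'b::real_inner \<Rightarrow> real) \<Rightarrow> ('a \<times> 'b \<Rightarrow> real) \<Rightarrow> 'b set \<Rightarrow> real \<Rightarrow> real \<Rightarrow> real \<Rightarrow>
   'a \<Rightarrow> real" where
  "phi F f Y \<rho> \<sigma> \<delta> x = (INF z\<in>Y. SUP y\<in>Y. psi F f \<rho> \<sigma> \<delta> x y z)"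

definition saddle_point :: "'b set \<Rightarrow> 'c set \<Rightarrow> ('b \<Rightarrow> 'c \<Rightarrow> real) \<Rightarrow> 'b \<times> 'c \<Rightarrow> bool" where
  "saddle_point Y Z p w \<longleftrightarrow> fst w \<in> Y \<and> snd w \<in> Z \<and>
     (\<forall>y\<in>Y. p y (snd w) \<le> p (fst w) (snd w)) \<and> (\<forall>z\<in>Z. p (fst w) (snd w) \<le> p (fst w) z)"

definition ystar ::
  "('a \<times> 'b::real_inner \<Rightarrow> real) \<Rightarrow> ('a \<times> 'b \<Rightarrow> real) \<Rightarrow> 'b set \<Rightarrow> real \<Rightarrow> real \<Rightarrow> real \<Rightarrow>
   'a \<Rightarrow> 'b" where
  "ystar F f Y \<rho> \<sigma> \<delta> x = fst (THE w. saddle_point Y Y (psi F f \<rho> \<sigma> \<delta> x) w)"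

definition lagr ::
  "('a \<times> (real ^ 'm) \<Rightarrow> real) \<Rightarrow> (real ^ 'm \<Rightarrow> real ^ 'p) \<Rightarrow>
   'a \<Rightarrow> real ^ 'm \<Rightarrow> real ^ 'p \<Rightarrow> real ^ 'm" where
  "lagr f g x y \<mu> =
     gradient (\<lambda>v. f (x, v)) (at y) + transpose (jacobian g (at y)) *v \<mu>"

definition multipliers ::
  "('a \<times> (real ^ 'm) \<Rightarrow> real) \<Rightarrow> (real ^ 'm \<Rightarrow> real ^ 'p) \<Rightarrow>
   'a \<Rightarrow> real ^ 'm \<Rightarrow> (real ^ 'p) set" where
  "multipliers f g x y = {\<mu>. lagr f g x y \<mu> = 0 \<and> 0 \<le> \<mu> \<and> g y \<le> 0 \<and> \<mu> \<bullet> g y = 0}"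

definition upper_MFCQ :: "(real ^ 'n \<Rightarrow> real ^ 'q) \<Rightarrow> real ^ 'n \<Rightarrow> bool" where
  "upper_MFCQ G x \<longleftrightarrow>
     (\<forall>\<pi>. 0 \<le> \<pi> \<and> \<pi> \<bullet> G x = 0 \<and> transpose (jacobian G (at x)) *v \<pi> = 0 \<longrightarrow> \<pi> = 0)"

text \<open>Injectivity is required because linear independence is meant for the indexed family:
  two active constraints with the same gradient violate it.\<close>

definition lower_LICQ :: "(real ^ 'm \<Rightarrow> real ^ 'p) \<Rightarrow> real ^ 'm \<Rightarrow> bool" where
  "lower_LICQ g y \<longleftrightarrow>
     inj_on (\<lambda>i. gradient (\<lambda>v. g v $ i) (at y)) {i. g y $ i = 0} \<and>
     independent ((\<lambda>i. gradient (\<lambda>v. g v $ i) (at y)) ` {i. g y $ i = 0})"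

text \<open>The library convention \<open>infdist y {} = 0\<close> plays no role here as long as the lower-level
  solution sets are nonempty on \<open>X\<close>.\<close>

definition uniform_error_bound ::
  "('a::topological_space \<times> 'b::real_inner \<Rightarrow> real) \<Rightarrow> 'a set \<Rightarrow> 'b set \<Rightarrow> 'a \<Rightarrow> 'b \<Rightarrow> bool" where
  "uniform_error_bound f X Y xb yb \<longleftrightarrow>
     (\<exists>U V \<kappa>. open U \<and> xb \<in> U \<and> open V \<and> yb \<in> V \<and> 0 < \<kappa> \<and>
        (\<forall>x\<in>X \<inter> U. \<forall>y\<in>Y \<inter> V.
           infdist y (lower_sol f Y x) \<le>
             \<kappa> * infdist 0 ((\<lambda>v. gradient (\<lambda>u. f (x, u)) (at y) + v) ` normal_cone Y y)))"

definition C_stationary ::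
  "((real ^ 'n) \<times> (real ^ 'm) \<Rightarrow> real) \<Rightarrow> ((real ^ 'n) \<times> (real ^ 'm) \<Rightarrow> real) \<Rightarrow>
   (real ^ 'n \<Rightarrow> real ^ 'q) \<Rightarrow> (real ^ 'm \<Rightarrow> real ^ 'p) \<Rightarrow> real ^ 'n \<Rightarrow> bool" where
  "C_stationary F f G g xb \<longleftrightarrow>
     G xb \<le> 0 \<and>
     (\<exists>yb \<mu> \<pi> \<omega> \<gamma>.
        yb \<in> pess_sol F f {y. g y \<le> 0} xb \<and>
        C2_near (xb, yb) f \<and>
        \<mu> \<in> multipliers f g xb yb \<and>
        gradient (\<lambda>x. F (x, yb)) (at xb)
          + transpose (jacobian (\<lambda>x. lagr f g x yb \<mu>) (at xb)) *v \<gamma>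
          + transpose (jacobian G (at xb)) *v \<pi> = 0 \<and>
        gradient (\<lambda>y. F (xb, y)) (at yb)
          + transpose (jacobian (\<lambda>y. lagr f g xb y \<mu>) (at yb)) *v \<gamma>
          + transpose (jacobian g (at yb)) *v \<omega> = 0 \<and>
        0 \<le> \<pi> \<and> \<pi> \<bullet> G xb = 0 \<and>
        (\<forall>i. \<mu> $ i = 0 \<and> g yb $ i < 0 \<longrightarrow> \<omega> $ i = 0) \<and>
        (\<forall>i. \<mu> $ i > 0 \<and> g yb $ i = 0 \<longrightarrow> gradient (\<lambda>y. g y $ i) (at yb) \<bullet> \<gamma> = 0) \<and>
        (\<forall>i. \<mu> $ i = 0 \<and> g yb $ i = 0 \<longrightarrow> \<omega> $ i * (gradient (\<lambda>y. g y $ i) (at yb) \<bullet> \<gamma>) \<ge> 0))"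

end

theory Submission
  imports Defs
begin

text \<open>
  The saddle point \<open>(y\<^sub>k, z\<^sub>k)\<close> at \<open>x\<^sub>k\<close> solves a strongly monotone Lipschitz variational inequality, so it
  exists, is unique and depends Lipschitz continuously on \<open>x\<^sub>k\<close>; an envelope argument then
  differentiates \<open>\<phi>\<^sub>k\<close>. As \<open>z\<^sub>k\<close> minimises \<open>\<rho>\<^sub>k f(x\<^sub>k, z) + \<sigma>\<^sub>k/2 \<bar>z - y\<^sub>k\<bar>\<^sup>2\<close>, it is at least as close
  to \<open>y\<^sub>k\<close> as every point of \<open>S(x\<^sub>k)\<close>, and the error bound makes \<open>\<rho>\<^sub>k (z\<^sub>k - y\<^sub>k)\<close> bounded; \<open>\<gamma>\<close> is one of
  its accumulation points. Let \<open>\<eta>\<^sub>k\<close> and \<open>\<nu>\<^sub>k\<close> be the multipliers of \<open>g\<close> at \<open>y\<^sub>k\<close> and \<open>z\<^sub>k\<close>. Subtracting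
  the two optimality conditions and using LICQ bounds \<open>\<nu>\<^sub>k - \<eta>\<^sub>k\<close>, whose limit is \<open>\<omega>\<close>, while
  \<open>\<nu>\<^sub>k / \<rho>\<^sub>k\<close> and \<open>\<eta>\<^sub>k / \<rho>\<^sub>k\<close> have the common limit \<open>\<mu>\<close>. The sign condition is the limit of
  \<open>(\<nu>\<^sub>k - \<eta>\<^sub>k)\<^sub>i \<rho>\<^sub>k (g\<^sub>i(z\<^sub>k) - g\<^sub>i(y\<^sub>k)) \<ge> 0\<close>, which is complementarity.
\<close>

section \<open>Gradients and second derivatives\<close>

text \<open>The multipliers \<open>\<eta>\<close> and \<open>\<nu>\<close> may grow at the order of
  \<open>\<rho>\<close>, so neither need have a limit. Only \<open>\<nu> / \<rho>\<close> and
  \<open>\<nu> - \<eta>\<close> stay bounded, and the difference has no sign; this is why the lower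
  level is handled on a linear subspace under LICQ, while MFCQ suffices on the nonnegative cone of
  the upper level. The second derivative of \<open>f\<close> enters through increments
  \<open>\<rho> *\<^sub>R (Df (x, z) - Df (x, y))\<close> between two moving points, so
  differentiability at the limit alone is too weak and strict differentiability is used. It puts
  \<open>\<gamma>\<close> in the first slot, whereas the Jacobian of the Lagrangian has it in the
  second; symmetry reconciles them. Since \<open>phi\<close> is meaningful on \<open>X\<close> only,
  its gradient is taken relative to \<open>X\<close>, modulo vectors that the normal cone absorbs.
  That the limit is a pessimistic solution is shown without multipliers: dividing the optimality of
  \<open>y\<close> by \<open>\<rho>\<close> gives lower-level optimality, and comparing
  \<open>y\<close> with the lower-level solutions supplied by inner semicontinuity gives maximality
  of \<open>F\<close>.\<close>

lemma gradient_eqI: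
  assumes "(h has_derivative (\<lambda>v. D \<bullet> v)) (at x)"
  shows "gradient h (at x) = D"
proof -
  have "(h has_derivative (\<lambda>v. gradient h (at x) \<bullet> v)) (at x)"
    unfolding gradient_def using assms by (rule someI)
  then have "(\<lambda>v. gradient h (at x) \<bullet> v) = (\<lambda>v. D \<bullet> v)"
    using assms has_derivative_unique by blast
  then show ?thesis
    by (metis vector_eq_rdot)
qed

text \<open>The Riesz representative of a functional, written out in the basis so that linearity in
  \<open>A\<close>, and with it continuity of gradients, can be read off.\<close>

definition riesz :: "('a::euclidean_space \<Rightarrow>\<^sub>L real) \<Rightarrow> 'a" where
  "riesz A = (\<Sum>b\<in>Basis. A b *\<^sub>R b)"

lemma riesz_inner: "riesz A \<bullet> v = blinfun_apply A v"
proof -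
  have "blinfun_apply A v = blinfun_apply A (\<Sum>b\<in>Basis. (v \<bullet> b) *\<^sub>R b)"
    by (simp add: euclidean_representation)
  then show ?thesis
    by (simp add: riesz_def inner_sum_left blinfun.sum_right blinfun.scaleR_right inner_commute[of v] mult.commute)
qed

lemma bounded_linear_riesz: "bounded_linear riesz"
  unfolding riesz_def
  by (intro bounded_linear_sum bounded_linear_compose[OF bounded_linear_scaleR_left] blinfun.bounded_linear_left)

lemma gradient_eq_riesz:
  assumes "(h has_derivative blinfun_apply A) (at x)"
  shows "gradient h (at x) = riesz A"
  using assms by (intro gradient_eqI) (simp add: riesz_inner)

lemma C1_on_gradient:
  fixes h :: "'a::euclidean_space \<Rightarrow> real"
  assumes "C1_on UNIV h"
  shows "(h has_derivative (\<lambda>v. gradient h (at w) \<bullet> v)) (at w)"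
    and "continuous_on UNIV (\<lambda>w. gradient h (at w))"
proof -
  obtain h' where h': "\<And>w. (h has_derivative blinfun_apply (h' w)) (at w)" and c: "continuous_on UNIV h'"
    using assms unfolding C1_on_def by auto
  have eq: "gradient h (at w) = riesz (h' w)" for w
    using h' by (rule gradient_eq_riesz)
  show "(h has_derivative (\<lambda>v. gradient h (at w) \<bullet> v)) (at w)"
    unfolding eq riesz_inner by (rule h')
  show "continuous_on UNIV (\<lambda>w. gradient h (at w))"
    unfolding eq using c by (rule bounded_linear.continuous_on[OF bounded_linear_riesz])
qed

lemma gradient_fst:
  fixes h :: "'a::euclidean_space \<times> 'b::euclidean_space \<Rightarrow> real"
  assumes "(h has_derivative (\<lambda>v. D \<bullet> v)) (at (x, y))"
  shows "gradient (\<lambda>x. h (x, y)) (at x) = fst D"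
proof (rule gradient_eqI)
  have "((\<lambda>x. h (x, y)) has_derivative (\<lambda>u. D \<bullet> (u, 0))) (at x)"
    by (rule has_derivative_compose[of "\<lambda>x. (x, y)" "\<lambda>u. (u, 0)" x UNIV h "\<lambda>v. D \<bullet> v"])
      (auto intro!: derivative_eq_intros assms)
  then show "((\<lambda>x. h (x, y)) has_derivative (\<lambda>v. fst D \<bullet> v)) (at x)"
    by (cases D) (simp add: inner_Pair)
qed

lemma gradient_snd:
  fixes h :: "'a::euclidean_space \<times> 'b::euclidean_space \<Rightarrow> real"
  assumes "(h has_derivative (\<lambda>v. D \<bullet> v)) (at (x, y))"
  shows "gradient (\<lambda>y. h (x, y)) (at y) = snd D"
proof (rule gradient_eqI)
  have "((\<lambda>y. h (x, y)) has_derivative (\<lambda>u. D \<bullet> (0, u))) (at y)"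
    by (rule has_derivative_compose[of "\<lambda>y. (x, y)" "\<lambda>u. (0, u)" y UNIV h "\<lambda>v. D \<bullet> v"])
      (auto intro!: derivative_eq_intros assms)
  then show "((\<lambda>y. h (x, y)) has_derivative (\<lambda>v. snd D \<bullet> v)) (at y)"
    by (cases D) (simp add: inner_Pair)
qed

text \<open>Jacobians in the stationarity conditions occur transposed and applied to a multiplier;
  testing the product against \<open>u\<close> replaces the matrix by the derivative itself.\<close>

lemma transpose_jacobian_inner:
  fixes h :: "real ^ 'm \<Rightarrow> real ^ 'p"
  assumes "(h has_derivative h') (at y)"
  shows "(transpose (jacobian h (at y)) *v \<mu>) \<bullet> u = \<mu> \<bullet> h' u"
proof -
  have "(h has_derivative (\<lambda>v. jacobian h (at y) *v v)) (at y)"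
    using assms jacobian_works differentiableI by blast
  then have "h' = (\<lambda>v. jacobian h (at y) *v v)"
    using assms has_derivative_unique by blast
  then show ?thesis
    by (simp add: dot_lmul_matrix flip: vector_transpose_matrix)
qed

text \<open>A C1 map is strictly differentiable: near \<open>w\<close> the map
  \<open>h - h' w\<close> has an arbitrarily small Lipschitz constant, so the scaled error is at
  most that constant times \<open>norm (c k *\<^sub>R (a k - b k))\<close>, which is bounded. Both
  points may move, unlike in a plain difference quotient at \<open>w\<close>.\<close>

lemma strict_derivative_limit:
  fixes h :: "'a::real_normed_vector \<Rightarrow> 'b::real_normed_vector"
  assumes W: "open W" "w \<in> W"
    and der: "\<And>x. x \<in> W \<Longrightarrow> (h has_derivative blinfun_apply (h' x)) (at x)"
    and cont: "continuous_on W h'"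
    and lim: "a \<longlonglongrightarrow> w" "b \<longlonglongrightarrow> w" "(\<lambda>k::nat. c k *\<^sub>R (a k - b k)) \<longlonglongrightarrow> v"
  shows "(\<lambda>k. c k *\<^sub>R (h (a k) - h (b k))) \<longlonglongrightarrow> h' w v"
proof -
  define r where "r k = c k *\<^sub>R (a k - b k)" for k
  obtain M where M: "M > 0" "\<And>k. norm (r k) \<le> M"
    using lim(3) convergent_imp_Bseq[of r] unfolding r_def convergent_def Bseq_def by auto
  have "(\<lambda>k. c k *\<^sub>R (h (a k) - h (b k)) - h' w (r k)) \<longlonglongrightarrow> 0"
  proof (rule LIMSEQ_I)
    fix e :: real assume "e > 0"
    \<comment> \<open>With \<open>r\<close> bounded by \<open>M\<close>, the Lipschitz constant
      \<open>e / (2 * M)\<close> leaves an error of at most \<open>e / 2\<close>.\<close>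
    define e' where "e' = e / (2 * M)"
    have "e' > 0" using M \<open>e > 0\<close> by (simp add: e'_def)
    obtain d1 where d1: "d1 > 0" "ball w d1 \<subseteq> W"
      using W open_contains_ball by blast
    obtain d2 where d2: "d2 > 0" "\<And>x. x \<in> W \<Longrightarrow> dist x w < d2 \<Longrightarrow> dist (h' x) (h' w) < e'"
      using cont W(2) \<open>e' > 0\<close> unfolding continuous_on_iff by blast
    define B where "B = ball w (min d1 d2)"
    have bound: "norm ((h x - h' w x) - (h y - h' w y)) \<le> e' * norm (x - y)" if "x \<in> B" "y \<in> B" for x y
    proof (rule differentiable_bound[OF _ _ _ that])
      show "convex B" by (simp add: B_def)
      fix z assume z: "z \<in> B"
      then have zW: "z \<in> W" "dist z w < d2" using d1 by (auto simp: B_def dist_commute)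
      show "((\<lambda>x. h x - h' w x) has_derivative (\<lambda>u. (h' z - h' w) u)) (at z within B)"
        using der[OF zW(1)]
        by (auto intro!: derivative_eq_intros has_derivative_at_withinI[OF der[OF zW(1)]] simp: blinfun.diff_left)
      show "onorm (\<lambda>u. (h' z - h' w) u) \<le> e'"
        using d2(2)[OF zW] by (simp add: dist_norm norm_blinfun.rep_eq)
    qed
    have "\<forall>\<^sub>F k in sequentially. a k \<in> B" "\<forall>\<^sub>F k in sequentially. b k \<in> B"
      using lim(1,2) d1(1) d2(1) by (auto simp: B_def intro!: topological_tendstoD simp del: mem_ball)
    then have "\<forall>\<^sub>F k in sequentially. norm (c k *\<^sub>R (h (a k) - h (b k)) - h' w (r k) - 0) < e"
    proof eventually_elim
      case (elim k)
      have "norm (c k *\<^sub>R (h (a k) - h (b k)) - h' w (r k))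
          = norm (c k *\<^sub>R ((h (a k) - h' w (a k)) - (h (b k) - h' w (b k))))"
        by (simp add: r_def blinfun.scaleR_right blinfun.diff_right algebra_simps)
      also have "\<dots> \<le> \<bar>c k\<bar> * (e' * norm (a k - b k))"
        using bound[OF elim] by (simp add: mult_left_mono)
      also have "\<dots> = e' * norm (r k)" by (simp add: r_def)
      also have "\<dots> \<le> e' * M" using M(2) \<open>e' > 0\<close> by (simp add: mult_left_mono)
      also have "\<dots> < e" using M \<open>e > 0\<close> by (simp add: e'_def)
      finally show ?case by simp
    qed
    then show "\<exists>no. \<forall>n\<ge>no. norm (c n *\<^sub>R (h (a n) - h (b n)) - h' w (r n) - 0) < e"
      by (simp add: eventually_sequentially)
  qed
  moreover have "(\<lambda>k. h' w (r k)) \<longlonglongrightarrow> h' w v"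
    using lim(3) unfolding r_def by (intro tendsto_intros)
  ultimately show ?thesis
    using tendsto_add by fastforce
qed

text \<open>The second-order difference \<open>\<Delta>\<close> is symmetric in its two directions.
  The mean value theorem along \<open>u\<close> rewrites it as a difference quotient of
  \<open>h'\<close> in direction \<open>v\<close> whose base point still moves with
  \<open>n\<close>; strict differentiability of \<open>h'\<close> identifies the limit.\<close>

lemma second_derivative_symmetric:
  fixes h :: "'a::real_normed_vector \<Rightarrow> real"
  assumes W: "open W" "w \<in> W"
    and h': "\<And>x. x \<in> W \<Longrightarrow> (h has_derivative blinfun_apply (h' x)) (at x)"
    and h'': "\<And>x. x \<in> W \<Longrightarrow> (h' has_derivative blinfun_apply (h'' x)) (at x)"
    and cont: "continuous_on W h''"
  shows "h'' w u v = h'' w v u"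
proof -
  define t where "t n = inverse (real (Suc n))" for n
  have t: "t \<longlonglongrightarrow> 0" "\<And>n. t n > 0"
    unfolding t_def using LIMSEQ_inverse_real_of_nat by auto
  define \<Delta> where "\<Delta> n u v = (h (w + t n *\<^sub>R u + t n *\<^sub>R v) - h (w + t n *\<^sub>R u) - h (w + t n *\<^sub>R v) + h w) / (t n)\<^sup>2" for n u v
  obtain e where e: "e > 0" "ball w e \<subseteq> W"
    using W open_contains_ball by blast
  have lim: "(\<lambda>n. \<Delta> n u v) \<longlonglongrightarrow> h'' w v u" for u v
  proof -
    have "(\<lambda>n. t n * (norm u + norm v)) \<longlonglongrightarrow> 0 * (norm u + norm v)"
      by (intro tendsto_intros t)
    then have ev: "\<forall>\<^sub>F n in sequentially. t n * (norm u + norm v) < e"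
      using e(1) order_tendstoD(2) by fastforce
    \<comment> \<open>Guarding the equation by the smallness condition makes \<open>\<xi>\<close>
      exist for every \<open>n\<close>, so that it can be chosen as a sequence; outside the guard
      any value does.\<close>
    have "\<exists>\<xi>\<in>{0..1}. t n * (norm u + norm v) < e \<longrightarrow>
       \<Delta> n u v = ((1 / t n) *\<^sub>R (h' (w + (\<xi> * t n) *\<^sub>R u + t n *\<^sub>R v) - h' (w + (\<xi> * t n) *\<^sub>R u))) u" for n
    proof (cases "t n * (norm u + norm v) < e")
      case True
      have in_W: "w + (s * t n) *\<^sub>R u + t n *\<^sub>R v \<in> W" "w + (s * t n) *\<^sub>R u \<in> W" if "s \<in> {0..1}" for s
      proof -
        have st: "s * t n \<le> t n" "0 \<le> s * t n" using that t(2)[of n] by auto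
        have nv: "0 \<le> t n * norm v" using t(2)[of n] by simp
        have "s * t n * norm u \<le> t n * norm u" using st by (simp add: mult_right_mono)
        moreover have "norm ((s * t n) *\<^sub>R u + t n *\<^sub>R v) \<le> s * t n * norm u + t n * norm v"
          using st t(2)[of n] norm_triangle_ineq[of "(s * t n) *\<^sub>R u" "t n *\<^sub>R v"] that by simp
        moreover have "norm ((s * t n) *\<^sub>R u) = s * t n * norm u"
          using st(2) by (simp only: norm_scaleR abs_of_nonneg)
        ultimately have "norm ((s * t n) *\<^sub>R u + t n *\<^sub>R v) < e" "norm ((s * t n) *\<^sub>R u) < e"
          using True nv unfolding distrib_left by linarith+
        then have "dist w (w + ((s * t n) *\<^sub>R u + t n *\<^sub>R v)) < e" "dist w (w + (s * t n) *\<^sub>R u) < e"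
          by (simp_all only: dist_add_cancel[of w 0, simplified] dist_0_norm)
        then show "w + (s * t n) *\<^sub>R u + t n *\<^sub>R v \<in> W" "w + (s * t n) *\<^sub>R u \<in> W"
          using e(2) unfolding add.assoc by auto
      qed
      \<comment> \<open>The increment in direction \<open>v\<close> as a function of the position
        along \<open>u\<close>; its end values differ by the numerator of
        \<open>\<Delta>\<close>.\<close>
      define \<phi> where "\<phi> s = h (w + (s * t n) *\<^sub>R u + t n *\<^sub>R v) - h (w + (s * t n) *\<^sub>R u)" for s
      have d: "(\<phi> has_derivative (\<lambda>r. h' (w + (s * t n) *\<^sub>R u + t n *\<^sub>R v) ((r * t n) *\<^sub>R u) - h' (w + (s * t n) *\<^sub>R u) ((r * t n) *\<^sub>R u)))
          (at s within {0..1})" if "s \<in> {0..1}" for s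
        unfolding \<phi>_def
      proof (rule has_derivative_diff)
        have *: "((\<lambda>s. w + (s * t n) *\<^sub>R u + z) has_derivative (\<lambda>r. (r * t n) *\<^sub>R u)) (at s within {0..1})" for z
          by (auto intro!: derivative_eq_intros)
        show "((\<lambda>s. h (w + (s * t n) *\<^sub>R u + t n *\<^sub>R v)) has_derivative
            (\<lambda>r. h' (w + (s * t n) *\<^sub>R u + t n *\<^sub>R v) ((r * t n) *\<^sub>R u))) (at s within {0..1})"
          by (rule has_derivative_compose[OF * h'[OF in_W(1)[OF that]]])
        show "((\<lambda>s. h (w + (s * t n) *\<^sub>R u)) has_derivative
            (\<lambda>r. h' (w + (s * t n) *\<^sub>R u) ((r * t n) *\<^sub>R u))) (at s within {0..1})"
          using has_derivative_compose[OF *[of 0], of h "h' (w + (s * t n) *\<^sub>R u)"] h'[OF in_W(2)[OF that]] by simp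
      qed
      obtain \<xi> where \<xi>: "\<xi> \<in> {0..1}"
        "\<phi> 1 - \<phi> 0 = h' (w + (\<xi> * t n) *\<^sub>R u + t n *\<^sub>R v) (((1 - 0) * t n) *\<^sub>R u) - h' (w + (\<xi> * t n) *\<^sub>R u) (((1-0) * t n) *\<^sub>R u)"
        using mvt_very_simple[of 0 1 \<phi>, OF _ d] by (metis atLeastAtMost_iff zero_le_one)
      have "\<Delta> n u v = (\<phi> 1 - \<phi> 0) / (t n)\<^sup>2"
        by (simp add: \<Delta>_def \<phi>_def)
      also have "\<dots> = ((1 / t n) *\<^sub>R (h' (w + (\<xi> * t n) *\<^sub>R u + t n *\<^sub>R v) - h' (w + (\<xi> * t n) *\<^sub>R u))) u"
        unfolding \<xi>(2) using t(2)[of n]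
        by (simp add: blinfun.scaleR_left blinfun.scaleR_right blinfun.diff_left power2_eq_square divide_simps right_diff_distrib mult.commute)
      finally show ?thesis using \<xi>(1) by blast
    qed (auto intro!: bexI[of _ 0])
    then obtain \<xi> where \<xi>: "\<And>n. \<xi> n \<in> {0..1}" "\<And>n. t n * (norm u + norm v) < e \<Longrightarrow>
       \<Delta> n u v = ((1 / t n) *\<^sub>R (h' (w + (\<xi> n * t n) *\<^sub>R u + t n *\<^sub>R v) - h' (w + (\<xi> n * t n) *\<^sub>R u))) u"
      by metis
    have \<xi>t: "(\<lambda>n. \<xi> n * t n) \<longlonglongrightarrow> 0"
    proof (rule Lim_null_comparison[OF _ t(1)])
      show "\<forall>\<^sub>F n in sequentially. norm (\<xi> n * t n) \<le> t n"
        using \<xi>(1) t(2) by (intro always_eventually) (auto simp: less_imp_le mult_left_le_one_le)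
    qed
    have "(\<lambda>n. w + (\<xi> n * t n) *\<^sub>R u + t n *\<^sub>R v) \<longlonglongrightarrow> w + 0 *\<^sub>R u + 0 *\<^sub>R v"
         "(\<lambda>n. w + (\<xi> n * t n) *\<^sub>R u) \<longlonglongrightarrow> w + 0 *\<^sub>R u"
      by (intro tendsto_intros \<xi>t t)+
    then have "(\<lambda>n. (1 / t n) *\<^sub>R (h' (w + (\<xi> n * t n) *\<^sub>R u + t n *\<^sub>R v) - h' (w + (\<xi> n * t n) *\<^sub>R u))) \<longlonglongrightarrow> h'' w v"
      using t(2)[THEN less_imp_neq] by (intro strict_derivative_limit[OF W h'' cont]) auto
    then have "(\<lambda>n. ((1 / t n) *\<^sub>R (h' (w + (\<xi> n * t n) *\<^sub>R u + t n *\<^sub>R v) - h' (w + (\<xi> n * t n) *\<^sub>R u))) u) \<longlonglongrightarrow> h'' w v u"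
      by (intro tendsto_intros)
    then show ?thesis
      by (rule Lim_transform_eventually) (use ev in eventually_elim, simp add: \<xi>(2))
  qed
  have "\<Delta> n u v = \<Delta> n v u" for n
    by (simp add: \<Delta>_def algebra_simps)
  then show ?thesis
    using LIMSEQ_unique[OF lim[of v u]] lim[of u v] by simp
qed

section \<open>Strongly monotone variational inequalities\<close>

text \<open>The whole segment from \<open>y\<close> to \<open>z\<close> lies in \<open>S\<close>, so
  a derivative relative to \<open>S\<close> still yields a one-sided derivative along it; no
  interior point of \<open>S\<close> is involved.\<close>

lemma directional_derivative_limit:
  fixes h :: "'a::real_normed_vector \<Rightarrow> real"
  assumes "convex S" "y \<in> S" "z \<in> S" and h: "(h has_derivative h') (at y within S)"
  shows "((\<lambda>t. (h (y + t *\<^sub>R (z - y)) - h y) / t) \<longlongrightarrow> h' (z - y)) (at_right 0)"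
    and "\<forall>\<^sub>F t in at_right 0. 0 < t \<and> t \<le> 1 \<and> y + t *\<^sub>R (z - y) \<in> S"
proof -
  have img: "y + t *\<^sub>R (z - y) \<in> S" if "t \<in> {0..1}" for t
  proof -
    have "(1 - t) *\<^sub>R y + t *\<^sub>R z \<in> S"
      using assms(1-3) that by (intro convexD) auto
    then show ?thesis by (simp add: algebra_simps)
  qed
  have "((\<lambda>t. h (y + t *\<^sub>R (z - y))) has_derivative (\<lambda>t. h' (t *\<^sub>R (z - y)))) (at 0 within {0..1})"
  proof (rule has_derivative_in_compose[where f = "\<lambda>t. y + t *\<^sub>R (z - y)" and f' = "\<lambda>t. t *\<^sub>R (z - y)" and g = h and g' = h'])
    show "(h has_derivative h') (at (y + 0 *\<^sub>R (z - y)) within (\<lambda>t. y + t *\<^sub>R (z - y)) ` {0..1})"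
      using has_derivative_subset[OF h, of "(\<lambda>t. y + t *\<^sub>R (z - y)) ` {0..1}"] img
      by (simp add: image_subset_iff)
  qed (auto intro!: derivative_eq_intros)
  moreover have "h' (t *\<^sub>R (z - y)) = h' (z - y) * t" for t
    using linear_scale[OF has_derivative_linear[OF h]] by simp
  ultimately have "((\<lambda>t. h (y + t *\<^sub>R (z - y))) has_field_derivative h' (z - y)) (at 0 within {0..1})"
    by (simp add: has_field_derivative_def)
  then show "((\<lambda>t. (h (y + t *\<^sub>R (z - y)) - h y) / t) \<longlongrightarrow> h' (z - y)) (at_right 0)"
    by (simp add: has_field_derivative_iff at_within_Icc_at_right)
  show "\<forall>\<^sub>F t in at_right 0. 0 < t \<and> t \<le> 1 \<and> y + t *\<^sub>R (z - y) \<in> S"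
    unfolding eventually_at_right_field using img by (intro exI[of _ 1]) auto
qed

lemma convex_on_tangent_le:
  fixes h :: "'a::real_normed_vector \<Rightarrow> real"
  assumes h: "convex_on S h" "(h has_derivative h') (at y within S)" and S: "y \<in> S" "z \<in> S"
  shows "h y + h' (z - y) \<le> h z"
proof -
  note lim = directional_derivative_limit[OF convex_on_imp_convex[OF h(1)] S h(2)]
  have "h' (z - y) \<le> h z - h y"
  proof (rule tendsto_upperbound[OF lim(1)])
    show "\<forall>\<^sub>F t in at_right 0. (h (y + t *\<^sub>R (z - y)) - h y) / t \<le> h z - h y"
      using lim(2)
    proof eventually_elim
      case (elim t)
      have "h ((1 - t) *\<^sub>R y + t *\<^sub>R z) \<le> (1 - t) * h y + t * h z"
        using convex_onD[OF h(1)] elim S by simp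
      then have "h (y + t *\<^sub>R (z - y)) - h y \<le> (h z - h y) * t"
        by (simp add: algebra_simps)
      then show ?case
        using elim by (simp add: pos_divide_le_eq)
    qed
  qed simp
  then show ?thesis by simp
qed

lemma minimum_directional_derivative_nonneg:
  fixes h :: "'a::real_normed_vector \<Rightarrow> real"
  assumes "convex S" and S: "y \<in> S" "z \<in> S" and h: "(h has_derivative h') (at y within S)"
    and min: "\<And>u. u \<in> S \<Longrightarrow> h y \<le> h u"
  shows "0 \<le> h' (z - y)"
proof -
  note lim = directional_derivative_limit[OF assms(1) S h]
  show ?thesis
    by (rule tendsto_lowerbound[OF lim(1)]) (use lim(2) in eventually_elim, simp_all add: min)
qed

text \<open>Two gradients relative to \<open>S\<close> agree on all feasible directions
  \<open>c - x\<close>, and membership in gradient plus normal cone is tested on those directions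
  only. The arbitrary choice made by \<open>gradient\<close> thus cannot be seen in the stationarity
  residual.\<close>

lemma gradient_plus_normal_cone:
  fixes h :: "'a::euclidean_space \<Rightarrow> real"
  assumes "convex S" "x \<in> S" and h: "(h has_derivative (\<lambda>v. D \<bullet> v)) (at x within S)"
  shows "(\<lambda>v. gradient h (at x within S) + v) ` normal_cone S x = (\<lambda>v. D + v) ` normal_cone S x"
proof -
  define D' where "D' = gradient h (at x within S)"
  have h': "(h has_derivative (\<lambda>v. D' \<bullet> v)) (at x within S)"
    unfolding D'_def gradient_def using h by (rule someI)
  have eq: "D \<bullet> (c - x) = D' \<bullet> (c - x)" if "c \<in> S" for c
    using directional_derivative_limit(1)[OF assms(1,2) that h]
      directional_derivative_limit(1)[OF assms(1,2) that h']
    by (intro tendsto_unique[rotated]) auto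
  have "v \<in> (\<lambda>v. A + v) ` normal_cone S x \<longleftrightarrow> (\<forall>c\<in>S. v \<bullet> (c - x) \<le> A \<bullet> (c - x))" for v A
  proof -
    have "v \<in> (\<lambda>v. A + v) ` normal_cone S x \<longleftrightarrow> v - A \<in> normal_cone S x"
      by (force simp: image_iff algebra_simps)
    then show ?thesis using assms(2) by (auto simp: normal_cone_def inner_diff_left)
  qed
  then show ?thesis
    unfolding D'_def[symmetric] by (auto simp: eq set_eq_iff)
qed

text \<open>Solutions are the fixed points of the projected step \<open>P\<close>, and
  \<open>P\<close> is a contraction: expanding the square, strong monotonicity and the Lipschitz
  bound multiply squared distances by at most
  \<open>1 - 2 * \<tau> * \<alpha> + \<tau>\<^sup>2 * M\<^sup>2\<close>.\<close>

lemma strongly_monotone_VI: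
  fixes T :: "'a::euclidean_space \<Rightarrow> 'a"
  assumes W: "convex W" "closed W" "W \<noteq> {}"
    and lip: "L-lipschitz_on W T" and \<alpha>: "\<alpha> > 0"
    and mono: "\<And>w w'. w \<in> W \<Longrightarrow> w' \<in> W \<Longrightarrow> \<alpha> * (norm (w - w'))\<^sup>2 \<le> (T w - T w') \<bullet> (w - w')"
  obtains w where "w \<in> W" "\<And>w'. w' \<in> W \<Longrightarrow> 0 \<le> T w \<bullet> (w' - w)"
proof -
  \<comment> \<open>Enlarging \<open>L\<close> to at least \<open>\<alpha>\<close> makes
    \<open>M\<close> positive and keeps \<open>1 - (\<alpha> / M)\<^sup>2\<close> nonnegative under
    the root.\<close>
  define M where "M = max L \<alpha>"
  have M: "M > 0" "\<alpha> \<le> M" using \<alpha> by (auto simp: M_def)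
  have lipM: "norm (T w - T w') \<le> M * norm (w - w')" if "w \<in> W" "w' \<in> W" for w w'
    using lipschitz_on_normD[OF lipschitz_on_mono[OF lip order_refl, of M]] that by (simp add: M_def)
  \<comment> \<open>The step size that minimises the contraction factor; the minimum is
    \<open>c\<^sup>2\<close>.\<close>
  define \<tau> where "\<tau> = \<alpha> / M\<^sup>2"
  define c where "c = sqrt (1 - (\<alpha> / M)\<^sup>2)"
  have "(\<alpha> / M)\<^sup>2 \<le> 1" using M \<alpha> by (simp add: power_le_one)
  then have c: "0 \<le> c" "c < 1" "c\<^sup>2 = 1 - (\<alpha> / M)\<^sup>2"
    using \<alpha> M by (simp_all add: c_def)
  define P where "P w = closest_point W (w - \<tau> *\<^sub>R T w)" for w
  have "\<exists>!w\<in>W. P w = w"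
  proof (rule Banach_fix[OF _ W(3) c(1,2)])
    show "complete W" using W(2) by (simp add: complete_eq_closed)
    show "P ` W \<subseteq> W" using closest_point_in_set[OF W(2,3)] by (auto simp: P_def)
    fix u v assume uv: "u \<in> W" "v \<in> W"
    have "(norm ((u - \<tau> *\<^sub>R T u) - (v - \<tau> *\<^sub>R T v)))\<^sup>2 = (norm ((u - v) - \<tau> *\<^sub>R (T u - T v)))\<^sup>2"
      by (simp add: algebra_simps)
    also have "\<dots> = (norm (u - v))\<^sup>2 - 2 * \<tau> * ((T u - T v) \<bullet> (u - v)) + \<tau>\<^sup>2 * (norm (T u - T v))\<^sup>2"
      unfolding power2_norm_eq_inner by (simp add: inner_commute power2_eq_square algebra_simps)
    also have "\<dots> \<le> (norm (u - v))\<^sup>2 - 2 * \<tau> * (\<alpha> * (norm (u - v))\<^sup>2) + \<tau>\<^sup>2 * (M * norm (u - v))\<^sup>2"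
      using mono[OF uv] lipM[OF uv] M \<alpha>
      by (intro add_mono diff_mono mult_left_mono power_mono) (auto simp: \<tau>_def)
    also have "\<dots> = (c * norm (u - v))\<^sup>2"
    proof -
      have "\<tau> * M\<^sup>2 = \<alpha>" using M by (simp add: \<tau>_def)
      then have 1: "\<tau>\<^sup>2 * (M\<^sup>2 * r) = \<tau> * \<alpha> * r" for r
        by (metis mult.assoc mult.commute power2_eq_square)
      have 2: "(\<alpha> / M)\<^sup>2 = \<tau> * \<alpha>" by (simp add: \<tau>_def power2_eq_square)
      show ?thesis
        unfolding power_mult_distrib c(3) 1 2 by (simp only: algebra_simps)
    qed
    finally have "norm ((u - \<tau> *\<^sub>R T u) - (v - \<tau> *\<^sub>R T v)) \<le> c * norm (u - v)"
      by (rule power2_le_imp_le) (simp add: c(1))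
    moreover have "dist (P u) (P v) \<le> norm ((u - \<tau> *\<^sub>R T u) - (v - \<tau> *\<^sub>R T v))"
      using closest_point_lipschitz[OF W] by (simp add: P_def dist_norm)
    ultimately show "dist (P u) (P v) \<le> c * dist u v"
      by (simp add: dist_norm)
  qed
  then obtain w where w: "w \<in> W" "P w = w" by blast
  have "0 \<le> T w \<bullet> (w' - w)" if "w' \<in> W" for w'
  proof -
    have "(w - \<tau> *\<^sub>R T w - w) \<bullet> (w' - w) \<le> 0"
      using closest_point_dot[OF W(1,2) that, of "w - \<tau> *\<^sub>R T w"] w(2) by (simp add: P_def)
    then have "0 \<le> \<tau> * (T w \<bullet> (w' - w))" by simp
    moreover have "\<tau> > 0" using M \<alpha> by (simp add: \<tau>_def)
    ultimately show ?thesis by (simp add: zero_le_mult_iff)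
  qed
  with w(1) that show ?thesis by blast
qed

section \<open>The regularised minimax problem\<close>

text \<open>No later estimate depends on the value of the constant, so it is hidden and the closure
  rules below can be applied by plain backward chaining.\<close>

definition lipschitzian_on :: "'a::metric_space set \<Rightarrow> ('a \<Rightarrow> 'b::metric_space) \<Rightarrow> bool" where
  "lipschitzian_on A h \<longleftrightarrow> (\<exists>C. C-lipschitz_on A h)"

lemma lipschitzian_on_add:
  fixes h h' :: "'a::metric_space \<Rightarrow> 'b::real_normed_vector"
  shows "lipschitzian_on A h \<Longrightarrow> lipschitzian_on A h' \<Longrightarrow> lipschitzian_on A (\<lambda>a. h a + h' a)"
  unfolding lipschitzian_on_def using lipschitz_on_add by blast

lemma lipschitzian_on_diff:
  fixes h h' :: "'a::metric_space \<Rightarrow> 'b::real_normed_vector"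
  shows "lipschitzian_on A h \<Longrightarrow> lipschitzian_on A h' \<Longrightarrow> lipschitzian_on A (\<lambda>a. h a - h' a)"
  unfolding lipschitzian_on_def using lipschitz_on_diff by blast

lemma lipschitzian_on_scaleR:
  fixes h :: "'a::metric_space \<Rightarrow> 'b::real_normed_vector"
  shows "lipschitzian_on A h \<Longrightarrow> lipschitzian_on A (\<lambda>a. r *\<^sub>R h a)"
  unfolding lipschitzian_on_def using lipschitz_on_cmult by blast

lemma lipschitzian_on_Pair:
  "lipschitzian_on A h \<Longrightarrow> lipschitzian_on A h' \<Longrightarrow> lipschitzian_on A (\<lambda>a. (h a, h' a))"
  unfolding lipschitzian_on_def using lipschitz_on_Pair by blast

lemma lipschitzian_on_linear:
  assumes "bounded_linear B" shows "lipschitzian_on A B"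
  unfolding lipschitzian_on_def using bounded_linear.lipschitz_boundE[OF assms] by blast

lemma lipschitzian_on_compose:
  assumes "lipschitzian_on A h" "lipschitzian_on A' h'" "h ` A \<subseteq> A'"
  shows "lipschitzian_on A (\<lambda>a. h' (h a))"
  using assms lipschitz_on_compose2 lipschitz_on_subset unfolding lipschitzian_on_def by (metis (no_types))

lemma lipschitzian_onE:
  fixes h :: "'a::real_normed_vector \<Rightarrow> 'b::real_normed_vector"
  assumes "lipschitzian_on A h"
  obtains C where "C \<ge> 0" "\<And>u v. u \<in> A \<Longrightarrow> v \<in> A \<Longrightarrow> norm (h u - h v) \<le> C * norm (u - v)"
  using assms lipschitz_on_normD lipschitz_on_nonneg unfolding lipschitzian_on_def by metis

text \<open>Completing the square. It bounds a strongly concave function from above by its tangent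
  data at one point, which makes the inner supremum of \<open>phi\<close> finite.\<close>

lemma quadratic_lower_bound:
  fixes q d :: "'a::real_inner"
  assumes "\<delta> > 0"
  shows "- ((norm q)\<^sup>2 / (2 * \<delta>)) \<le> q \<bullet> d + \<delta> / 2 * (norm d)\<^sup>2"
proof -
  have "0 \<le> (norm (q + \<delta> *\<^sub>R d))\<^sup>2" by simp
  also have "\<dots> = (norm q)\<^sup>2 + (2 * \<delta>) * (q \<bullet> d + \<delta> / 2 * (norm d)\<^sup>2)"
    unfolding power2_norm_eq_inner
    by (simp add: inner_commute[of d q] algebra_simps)
  finally have "- (norm q)\<^sup>2 \<le> (q \<bullet> d + \<delta> / 2 * (norm d)\<^sup>2) * (2 * \<delta>)" by (simp add: mult.commute)
  then have "- (norm q)\<^sup>2 / (2 * \<delta>) \<le> q \<bullet> d + \<delta> / 2 * (norm d)\<^sup>2"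
    using assms by (subst pos_divide_le_eq) auto
  then show ?thesis by simp
qed

section \<open>Saddle points for fixed parameters\<close>

locale penalised_minimax =
  fixes X :: "'a::euclidean_space set" and Y :: "'b::euclidean_space set"
    and F f :: "'a \<times> 'b \<Rightarrow> real" and DF Df :: "'a \<times> 'b \<Rightarrow> 'a \<times> 'b" and \<rho> \<sigma> \<delta> :: real
  assumes X: "convex X" and Y: "convex Y" "closed Y" "Y \<noteq> {}"
    and F_derivative: "\<And>w. (F has_derivative (\<lambda>v. DF w \<bullet> v)) (at w)"
    and f_derivative: "\<And>w. (f has_derivative (\<lambda>v. Df w \<bullet> v)) (at w)"
    and F_lipschitz: "lipschitzian_on (X \<times> Y) DF"
    and f_lipschitz: "lipschitzian_on (X \<times> Y) Df"
    and F_concave: "\<And>x. x \<in> X \<Longrightarrow> concave_on Y (\<lambda>y. F (x, y))"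
    and f_convex: "\<And>x. x \<in> X \<Longrightarrow> convex_on Y (\<lambda>y. f (x, y))"
    and params: "\<rho> > 0" "\<sigma> > 0" "\<delta> > 0"
begin

abbreviation "P \<equiv> psi F f \<rho> \<sigma> \<delta>"

text \<open>The saddle operator of \<open>P\<close>: minus its gradient in \<open>y\<close>, paired
  with its gradient in \<open>z\<close>. With this sign, maximising in \<open>y\<close> and
  minimising in \<open>z\<close> become one variational inequality.\<close>

definition T :: "'a \<Rightarrow> 'b \<times> 'b \<Rightarrow> 'b \<times> 'b" where
  "T x w = (\<rho> *\<^sub>R snd (Df (x, fst w)) - snd (DF (x, fst w)) + \<sigma> *\<^sub>R snd w + \<delta> *\<^sub>R fst w,
            \<rho> *\<^sub>R snd (Df (x, snd w)) + \<sigma> *\<^sub>R snd w - \<sigma> *\<^sub>R fst w)"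

lemma snd_derivative:
  assumes "(h has_derivative (\<lambda>v. D \<bullet> v)) (at (x, y))"
  shows "((\<lambda>y. h (x, y)) has_derivative (\<lambda>v. snd D \<bullet> v)) (at y within S)"
proof -
  have "((\<lambda>y. h (x, y)) has_derivative (\<lambda>u. D \<bullet> (0, u))) (at y within S)"
    by (rule has_derivative_compose[of "\<lambda>y. (x, y)" "\<lambda>u. (0, u)" y S h "\<lambda>v. D \<bullet> v"])
      (auto intro!: derivative_eq_intros assms)
  then show ?thesis by (cases D) (simp add: inner_Pair)
qed

lemma f_tangent:
  assumes "x \<in> X" "y \<in> Y" "z \<in> Y"
  shows "f (x, y) + snd (Df (x, y)) \<bullet> (z - y) \<le> f (x, z)"
  using convex_on_tangent_le[OF f_convex snd_derivative[OF f_derivative]] assms by blast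

lemma F_tangent:
  assumes "x \<in> X" "y \<in> Y" "z \<in> Y"
  shows "F (x, z) \<le> F (x, y) + snd (DF (x, y)) \<bullet> (z - y)"
proof -
  have "convex_on Y (\<lambda>y. - F (x, y))"
    using F_concave[OF assms(1)] by (simp add: concave_on_def)
  moreover have "((\<lambda>y. - F (x, y)) has_derivative (\<lambda>v. - (snd (DF (x, y)) \<bullet> v))) (at y within Y)"
    by (intro has_derivative_minus snd_derivative F_derivative)
  ultimately show ?thesis
    using convex_on_tangent_le[of Y "\<lambda>y. - F (x, y)"] assms by fastforce
qed

text \<open>\<open>F\<close> and the penalty term lie below their tangents in \<open>y\<close>, the
  coupling is linear, and the quadratic term contributes exactly its own second-order
  remainder.\<close>

lemma psi_le_tangent:
  assumes "x \<in> X" "y \<in> Y" "y' \<in> Y"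
  shows "P x y' z \<le> P x y z - fst (T x (y, z)) \<bullet> (y' - y) - \<delta> / 2 * (norm (y' - y))\<^sup>2"
proof -
  have "\<rho> * (f (x, y) + snd (Df (x, y)) \<bullet> (y' - y)) \<le> \<rho> * f (x, y')"
    using f_tangent[OF assms] params by (simp add: mult_left_mono)
  then show ?thesis
    using F_tangent[OF assms] unfolding psi_def T_def power2_norm_eq_inner
    by (simp add: inner_commute algebra_simps)
qed

lemma psi_ge_tangent:
  assumes "x \<in> X" "z \<in> Y" "z' \<in> Y"
  shows "P x y z' \<ge> P x y z + snd (T x (y, z)) \<bullet> (z' - z) + \<sigma> / 2 * (norm (z' - z))\<^sup>2"
proof -
  have "\<rho> * (f (x, z) + snd (Df (x, z)) \<bullet> (z' - z)) \<le> \<rho> * f (x, z')"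
    using f_tangent[OF assms] params by (simp add: mult_left_mono)
  then show ?thesis
    unfolding psi_def T_def power2_norm_eq_inner
    by (simp add: inner_commute algebra_simps)
qed

text \<open>Adding the tangent inequalities with the two points exchanged gives monotonicity in
  \<open>y\<close> for fixed \<open>z\<close> and in \<open>z\<close> for fixed \<open>y\<close>.
  The coupling enters the two components of \<open>T\<close> with opposite signs, so its cross terms
  cancel and the partial moduli \<open>\<delta>\<close> and \<open>\<sigma>\<close> survive.\<close>

lemma T_strongly_monotone:
  assumes "x \<in> X" "w \<in> Y \<times> Y" "w' \<in> Y \<times> Y"
  shows "min \<sigma> \<delta> * (norm (w - w'))\<^sup>2 \<le> (T x w - T x w') \<bullet> (w - w')"
proof -
  obtain y z y' z' where w: "w = (y, z)" "w' = (y', z')" "y \<in> Y" "z \<in> Y" "y' \<in> Y" "z' \<in> Y"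
    using assms by auto
  have 1: "fst (T x (y, z)) \<bullet> (y' - y) + fst (T x (y', z)) \<bullet> (y - y') + \<delta> * (norm (y - y'))\<^sup>2 \<le> 0"
    using psi_le_tangent[OF assms(1) w(3,5), of z] psi_le_tangent[OF assms(1) w(5,3), of z]
    by (simp add: norm_minus_commute)
  have 2: "snd (T x (y, z)) \<bullet> (z' - z) + snd (T x (y, z')) \<bullet> (z - z') + \<sigma> * (norm (z - z'))\<^sup>2 \<le> 0"
    using psi_ge_tangent[OF assms(1) w(4,6), of y] psi_ge_tangent[OF assms(1) w(6,4), of y]
    by (simp add: norm_minus_commute)
  have "min \<sigma> \<delta> * (norm (w - w'))\<^sup>2 = min \<sigma> \<delta> * (norm (y - y'))\<^sup>2 + min \<sigma> \<delta> * (norm (z - z'))\<^sup>2"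
    by (simp add: w norm_Pair algebra_simps)
  also have "\<dots> \<le> \<delta> * (norm (y - y'))\<^sup>2 + \<sigma> * (norm (z - z'))\<^sup>2"
    by (intro add_mono mult_right_mono) auto
  also have "\<dots> \<le> - (fst (T x (y, z)) \<bullet> (y' - y) + fst (T x (y', z)) \<bullet> (y - y')
      + snd (T x (y, z)) \<bullet> (z' - z) + snd (T x (y, z')) \<bullet> (z - z'))"
    using 1 2 by linarith
  also have "\<dots> = (T x w - T x w') \<bullet> (w - w')"
    unfolding w T_def by (simp add: inner_Pair inner_commute algebra_simps)
  finally show ?thesis .
qed

text \<open>Joint in \<open>x\<close> and the pair: for fixed \<open>x\<close> it feeds the
  existence result, and in \<open>x\<close> it controls how far the saddle point moves.\<close>

lemma T_lipschitz: "lipschitzian_on (X \<times> Y \<times> Y) (\<lambda>u. T (fst u) (snd u))"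
proof -
  have lin: "lipschitzian_on A (\<lambda>u::'a \<times> 'b \<times> 'b. fst u)" "lipschitzian_on A (\<lambda>u::'a \<times> 'b \<times> 'b. fst (snd u))"
    "lipschitzian_on A (\<lambda>u::'a \<times> 'b \<times> 'b. snd (snd u))" for A
    by (intro lipschitzian_on_linear bounded_linear_intros)+
  have snd: "lipschitzian_on (X \<times> Y \<times> Y) (\<lambda>u. snd (D (fst u, h u)))"
    if D: "lipschitzian_on (X \<times> Y) D" and h: "lipschitzian_on (X \<times> Y \<times> Y) h" "h ` (X \<times> Y \<times> Y) \<subseteq> Y"
    for D :: "'a \<times> 'b \<Rightarrow> 'a \<times> 'b" and h
  proof -
    have "lipschitzian_on (X \<times> Y \<times> Y) (\<lambda>u. D (fst u, h u))"
      by (rule lipschitzian_on_compose[OF lipschitzian_on_Pair[OF lin(1) h(1)] D]) (use h(2) in auto)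
    then show ?thesis
      by (rule lipschitzian_on_compose[where h' = snd and A' = UNIV])
        (auto intro: lipschitzian_on_linear bounded_linear_snd)
  qed
  show ?thesis
    unfolding T_def
    by (intro lipschitzian_on_Pair lipschitzian_on_add lipschitzian_on_diff lipschitzian_on_scaleR
        lin snd F_lipschitz f_lipschitz) auto
qed

text \<open>Concavity in \<open>y\<close> and convexity in \<open>z\<close> make first-order
  conditions sufficient. Changing one component of \<open>w'\<close> at a time separates the
  inequality on the product into the two partial ones.\<close>

lemma saddle_VI_iff:
  assumes x: "x \<in> X" and w: "w \<in> Y \<times> Y"
  shows "saddle_point Y Y (P x) w \<longleftrightarrow> (\<forall>w'\<in>Y \<times> Y. 0 \<le> T x w \<bullet> (w' - w))"
proof -
  obtain y z where yz: "w = (y, z)" "y \<in> Y" "z \<in> Y" using w by auto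
  show ?thesis
  proof
    assume s: "saddle_point Y Y (P x) w"
    have y: "0 \<le> fst (T x w) \<bullet> (y' - y)" if "y' \<in> Y" for y'
    proof (rule minimum_directional_derivative_nonneg[OF Y(1) yz(2) that, where h = "\<lambda>y. - P x y z"])
      show "((\<lambda>y. - P x y z) has_derivative (\<lambda>v. fst (T x w) \<bullet> v)) (at y within Y)"
        unfolding psi_def T_def yz(1) power2_norm_eq_inner
        by (auto intro!: derivative_eq_intros snd_derivative F_derivative f_derivative
            simp: inner_commute algebra_simps)
    qed (use s in \<open>auto simp: saddle_point_def yz\<close>)
    have z: "0 \<le> snd (T x w) \<bullet> (z' - z)" if "z' \<in> Y" for z'
    proof (rule minimum_directional_derivative_nonneg[OF Y(1) yz(3) that, where h = "\<lambda>z. P x y z"])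
      show "((\<lambda>z. P x y z) has_derivative (\<lambda>v. snd (T x w) \<bullet> v)) (at z within Y)"
        unfolding psi_def T_def yz(1) power2_norm_eq_inner
        by (auto intro!: derivative_eq_intros snd_derivative F_derivative f_derivative
            simp: inner_commute algebra_simps)
    qed (use s in \<open>auto simp: saddle_point_def yz\<close>)
    show "\<forall>w'\<in>Y \<times> Y. 0 \<le> T x w \<bullet> (w' - w)"
      using y z by (auto simp: inner_prod_def yz(1))
  next
    assume vi: "\<forall>w'\<in>Y \<times> Y. 0 \<le> T x w \<bullet> (w' - w)"
    have "0 \<le> fst (T x w) \<bullet> (y' - y)" "0 \<le> snd (T x w) \<bullet> (y' - z)" if "y' \<in> Y" for y'
      using vi[rule_format, of "(y', z)"] vi[rule_format, of "(y, y')"] yz that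
      by (auto simp: inner_prod_def)
    then have "P x y' z \<le> P x y z" "P x y z \<le> P x y y'" if "y' \<in> Y" for y'
      using psi_le_tangent[OF x yz(2) that, of z] psi_ge_tangent[OF x yz(3) that, of y] params that
      unfolding yz(1) by (smt (verit, best) mult_nonneg_nonneg zero_le_power2 divide_nonneg_nonneg)+
    then show "saddle_point Y Y (P x) w"
      using yz by (simp add: saddle_point_def)
  qed
qed

text \<open>Each solution is inserted as a test point into the other's inequality. Only the change
  of the operator at the single point \<open>w'\<close> remains on the right, so
  \<open>x = x'\<close> gives uniqueness and the general case gives continuous dependence.\<close>

lemma VI_stable:
  assumes x: "x \<in> X" "x' \<in> X" and w: "w \<in> Y \<times> Y" "w' \<in> Y \<times> Y"
    and VI: "\<forall>v\<in>Y \<times> Y. 0 \<le> T x w \<bullet> (v - w)" "\<forall>v\<in>Y \<times> Y. 0 \<le> T x' w' \<bullet> (v - w')"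
  shows "min \<sigma> \<delta> * norm (w - w') \<le> norm (T x' w' - T x w')"
proof (cases "w = w'")
  case False
  have "min \<sigma> \<delta> * norm (w - w') * norm (w - w') \<le> (T x w - T x w') \<bullet> (w - w')"
    using T_strongly_monotone[OF x(1) w] by (simp add: power2_eq_square)
  also have "\<dots> \<le> (T x' w' - T x w') \<bullet> (w - w')"
    using VI w by (smt (verit, best) inner_diff_left inner_diff_right)
  also have "\<dots> \<le> norm (T x' w' - T x w') * norm (w - w')"
    by (rule norm_cauchy_schwarz)
  finally show ?thesis
    using False by simp
qed simp

lemma ex1_saddle_point:
  assumes "x \<in> X"
  shows "\<exists>!w. saddle_point Y Y (P x) w"
proof -
  have W: "convex (Y \<times> Y)" "closed (Y \<times> Y)" "Y \<times> Y \<noteq> {}"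
    using Y by (auto intro: convex_Times closed_Times)
  have "lipschitzian_on (Y \<times> Y) (\<lambda>w. (x, w))"
  proof (rule lipschitzian_on_Pair)
    show "lipschitzian_on (Y \<times> Y) (\<lambda>_. x)"
      unfolding lipschitzian_on_def using lipschitz_on_constant by blast
  qed (rule lipschitzian_on_linear[OF bounded_linear_ident])
  then have "lipschitzian_on (Y \<times> Y) (T x)"
    using lipschitzian_on_compose[OF _ T_lipschitz, of "Y \<times> Y" "\<lambda>w. (x, w)"] assms
    by auto
  then obtain L where "L-lipschitz_on (Y \<times> Y) (T x)" by (auto simp: lipschitzian_on_def)
  then obtain w where w: "w \<in> Y \<times> Y" "\<And>v. v \<in> Y \<times> Y \<Longrightarrow> 0 \<le> T x w \<bullet> (v - w)"
    using strongly_monotone_VI[OF W, of L "T x" "min \<sigma> \<delta>"] T_strongly_monotone[OF assms] params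
    by (metis min_less_iff_conj)
  show ?thesis
  proof (rule ex1I)
    show "saddle_point Y Y (P x) w" using w saddle_VI_iff[OF assms] by simp
    fix w' assume s: "saddle_point Y Y (P x) w'"
    then have w': "w' \<in> Y \<times> Y" by (cases w') (auto simp: saddle_point_def)
    have "min \<sigma> \<delta> * norm (w' - w) \<le> 0"
      using VI_stable[OF assms assms w' w(1)] s w saddle_VI_iff[OF assms w'] by simp
    then show "w' = w"
      using params by (auto simp: mult_le_0_iff min_le_iff_disj)
  qed
qed

definition saddle :: "'a \<Rightarrow> 'b \<times> 'b" where
  "saddle x = (THE w. saddle_point Y Y (P x) w)"

lemma saddle:
  assumes "x \<in> X"
  shows "saddle_point Y Y (P x) (saddle x)" and "saddle x \<in> Y \<times> Y"
    and "\<And>w'. w' \<in> Y \<times> Y \<Longrightarrow> 0 \<le> T x (saddle x) \<bullet> (w' - saddle x)"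
proof -
  show s: "saddle_point Y Y (P x) (saddle x)"
    unfolding saddle_def by (rule theI'[OF ex1_saddle_point[OF assms]])
  show *: "saddle x \<in> Y \<times> Y"
    using s by (cases "saddle x") (auto simp: saddle_point_def)
  show "\<And>w'. w' \<in> Y \<times> Y \<Longrightarrow> 0 \<le> T x (saddle x) \<bullet> (w' - saddle x)"
    using s saddle_VI_iff[OF assms *] by blast
qed

lemma saddle_lipschitz:
  obtains C where "C \<ge> 0" "\<And>x x'. x \<in> X \<Longrightarrow> x' \<in> X \<Longrightarrow> norm (saddle x' - saddle x) \<le> C * norm (x' - x)"
proof -
  obtain C where C: "C \<ge> 0" "\<And>u v. u \<in> X \<times> Y \<times> Y \<Longrightarrow> v \<in> X \<times> Y \<times> Y \<Longrightarrow>
      norm (T (fst u) (snd u) - T (fst v) (snd v)) \<le> C * norm (u - v)"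
    using T_lipschitz by (rule lipschitzian_onE) blast
  have m: "min \<sigma> \<delta> > 0" using params by simp
  have "norm (saddle x' - saddle x) \<le> (C / min \<sigma> \<delta>) * norm (x' - x)" if "x \<in> X" "x' \<in> X" for x x'
  proof -
    have "min \<sigma> \<delta> * norm (saddle x' - saddle x) \<le> norm (T x (saddle x) - T x' (saddle x))"
      using VI_stable[OF that(2,1) saddle(2)[OF that(2)] saddle(2)[OF that(1)]] saddle(3) that by blast
    also have "\<dots> \<le> C * norm (x' - x)"
      using C(2)[of "(x, saddle x)" "(x', saddle x)"] saddle(2)[OF that(1)] that
      by (simp add: norm_Pair norm_minus_commute)
    finally show ?thesis
      using m by (simp add: pos_le_divide_eq mult.commute)
  qed
  then show ?thesis using that[of "C / min \<sigma> \<delta>"] C m by simp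
qed

section \<open>Differentiability of the value function\<close>

lemma phi_eq_saddle_value:
  assumes "x \<in> X"
  shows "phi F f Y \<rho> \<sigma> \<delta> x = P x (fst (saddle x)) (snd (saddle x))"
proof -
  obtain y z where yz: "saddle x = (y, z)" by fastforce
  have s: "y \<in> Y" "z \<in> Y" "\<And>y'. y' \<in> Y \<Longrightarrow> P x y' z \<le> P x y z" "\<And>z'. z' \<in> Y \<Longrightarrow> P x y z \<le> P x y z'"
    using saddle(1)[OF assms] unfolding yz by (auto simp: saddle_point_def)
  \<comment> \<open>Without an upper bound the real-valued supremum would be an unspecified number;
    strong concavity in \<open>y\<close> supplies one for every \<open>z'\<close>, not only at the
    saddle point.\<close>
  have bdd: "bdd_above ((\<lambda>y'. P x y' z') ` Y)" for z'
  proof (rule bdd_aboveI2)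
    fix y' assume "y' \<in> Y"
    let ?q = "fst (T x (y, z'))" and ?d = "y' - y"
    have "P x y' z' \<le> P x y z' - ?q \<bullet> ?d - \<delta> / 2 * (norm ?d)\<^sup>2"
      using psi_le_tangent[OF assms s(1) \<open>y' \<in> Y\<close>] .
    also have "\<dots> \<le> P x y z' + (norm ?q)\<^sup>2 / (2 * \<delta>)"
      using quadratic_lower_bound[OF params(3), of ?q ?d] by linarith
    finally show "P x y' z' \<le> P x y z' + (norm ?q)\<^sup>2 / (2 * \<delta>)" .
  qed
  have sup: "(SUP y'\<in>Y. P x y' z) = P x y z"
    using s by (intro cSup_eq_maximum) auto
  have ge: "P x y z \<le> (SUP y'\<in>Y. P x y' z')" if "z' \<in> Y" for z'
    using s(4)[OF that] cSUP_upper[OF s(1) bdd[of z']] by linarith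
  show ?thesis
    unfolding phi_def yz fst_conv snd_conv
    by (rule cInf_eq_minimum) (use s(2) sup ge in force)+
qed

text \<open>The gradient is frozen at \<open>(x, y, z)\<close> while the increment is taken at
  another pair \<open>(y', z')\<close>. The envelope argument compares such mixed pairs, and the
  movement of the pair enters the error only multiplied by \<open>norm (x' - x)\<close>.\<close>

lemma psi_x_increment:
  obtains C where "C \<ge> 0"
    and "\<And>x x' y z y' z'. x \<in> X \<Longrightarrow> x' \<in> X \<Longrightarrow> y \<in> Y \<Longrightarrow> z \<in> Y \<Longrightarrow> y' \<in> Y \<Longrightarrow> z' \<in> Y \<Longrightarrow>
      \<bar>P x' y' z' - P x y' z' - (fst (DF (x, y)) - \<rho> *\<^sub>R fst (Df (x, y)) + \<rho> *\<^sub>R fst (Df (x, z))) \<bullet> (x' - x)\<bar>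
        \<le> C * (norm (x' - x) + norm (y' - y) + norm (z' - z)) * norm (x' - x)"
proof -
  have inc: "\<exists>C\<ge>0. \<forall>x\<in>X. \<forall>x'\<in>X. \<forall>y\<in>Y. \<forall>y'\<in>Y.
      \<bar>h (x', y') - h (x, y') - fst (D (x, y)) \<bullet> (x' - x)\<bar> \<le> C * (norm (x' - x) + norm (y' - y)) * norm (x' - x)"
    if der: "\<And>w. (h has_derivative (\<lambda>v. D w \<bullet> v)) (at w)" and lip: "lipschitzian_on (X \<times> Y) D"
    for h :: "'a \<times> 'b \<Rightarrow> real" and D
  proof -
    obtain C where C: "C \<ge> 0" "\<And>u v. u \<in> X \<times> Y \<Longrightarrow> v \<in> X \<times> Y \<Longrightarrow> norm (D u - D v) \<le> C * norm (u - v)"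
      using lip by (rule lipschitzian_onE) blast
    have "\<bar>h (x', y') - h (x, y') - fst (D (x, y)) \<bullet> (x' - x)\<bar> \<le> C * (norm (x' - x) + norm (y' - y)) * norm (x' - x)"
      if xy: "x \<in> X" "x' \<in> X" "y \<in> Y" "y' \<in> Y" for x x' y y'
    proof -
      define B where "B = C * (norm (x' - x) + norm (y' - y))"
      define q where "q u = h (u, y') - fst (D (x, y)) \<bullet> u" for u
      have "norm (q x' - q x) \<le> B * norm (x' - x)"
      proof (rule differentiable_bound[where S = "closed_segment x x'"])
        fix u assume u: "u \<in> closed_segment x x'"
        then have uX: "u \<in> X" using X xy closed_segment_subset by blast
        have "((\<lambda>u. h (u, y')) has_derivative (\<lambda>v. D (u, y') \<bullet> (v, 0))) (at u within closed_segment x x')"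
          by (rule has_derivative_compose[of "\<lambda>x. (x, y')" "\<lambda>u. (u, 0)" u _ h "\<lambda>v. D (u, y') \<bullet> v"])
            (auto intro!: derivative_eq_intros der)
        then show "(q has_derivative (\<lambda>v. (fst (D (u, y')) - fst (D (x, y))) \<bullet> v)) (at u within closed_segment x x')"
          unfolding q_def by (auto intro!: derivative_eq_intros simp: inner_prod_def inner_diff_left)
        have "norm (fst (D (u, y') - D (x, y))) \<le> norm (D (u, y') - D (x, y))"
          using norm_fst_le[of "fst (D (u, y') - D (x, y))" "snd (D (u, y') - D (x, y))"]
          unfolding prod.collapse .
        also have "\<dots> \<le> C * norm ((u, y') - (x, y))"
          using uX xy by (intro C(2)) auto
        also have "\<dots> \<le> B"
          unfolding B_def
        proof (rule mult_left_mono[OF _ C(1)])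
          have "norm ((u, y') - (x, y)) \<le> norm (u - x) + norm (y' - y)"
            using norm_Pair_le[of "u - x" "y' - y"] by simp
          also have "norm (u - x) \<le> norm (x' - x)"
            using u segment_bound(1)[of u x x'] by (simp add: norm_minus_commute)
          finally show "norm ((u, y') - (x, y)) \<le> norm (x' - x) + norm (y' - y)" by simp
        qed
        finally have *: "norm (fst (D (u, y')) - fst (D (x, y))) \<le> B" by simp
        show "onorm (\<lambda>v. (fst (D (u, y')) - fst (D (x, y))) \<bullet> v) \<le> B"
          by (rule onorm_le) (metis * Cauchy_Schwarz_ineq2 mult_right_mono norm_ge_zero order_trans real_norm_def)
      qed auto
      then show ?thesis
        by (simp add: q_def B_def inner_diff_right algebra_simps)
    qed
    then show ?thesis using C(1) by blast
  qed
  obtain A where A: "A \<ge> 0" "\<forall>x\<in>X. \<forall>x'\<in>X. \<forall>y\<in>Y. \<forall>y'\<in>Y.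
      \<bar>F (x', y') - F (x, y') - fst (DF (x, y)) \<bullet> (x' - x)\<bar> \<le> A * (norm (x' - x) + norm (y' - y)) * norm (x' - x)"
    using inc[OF F_derivative F_lipschitz] by blast
  obtain B where B: "B \<ge> 0" "\<forall>x\<in>X. \<forall>x'\<in>X. \<forall>y\<in>Y. \<forall>y'\<in>Y.
      \<bar>f (x', y') - f (x, y') - fst (Df (x, y)) \<bullet> (x' - x)\<bar> \<le> B * (norm (x' - x) + norm (y' - y)) * norm (x' - x)"
    using inc[OF f_derivative f_lipschitz] by blast
  show ?thesis
  proof (rule that[of "A + 2 * \<rho> * B"])
    show "A + 2 * \<rho> * B \<ge> 0" using A B params by simp
    fix x x' y z y' z'
    assume m: "x \<in> X" "x' \<in> X" "y \<in> Y" "z \<in> Y" "y' \<in> Y" "z' \<in> Y"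
    let ?n = "norm (x' - x) + norm (y' - y) + norm (z' - z)"
    define a where "a = F (x', y') - F (x, y') - fst (DF (x, y)) \<bullet> (x' - x)"
    define b where "b = f (x', y') - f (x, y') - fst (Df (x, y)) \<bullet> (x' - x)"
    define c where "c = f (x', z') - f (x, z') - fst (Df (x, z)) \<bullet> (x' - x)"
    have "\<bar>a\<bar> \<le> A * (norm (x' - x) + norm (y' - y)) * norm (x' - x)"
      using A m by (simp add: a_def)
    also have "\<dots> \<le> A * ?n * norm (x' - x)"
      using A by (intro mult_right_mono mult_left_mono) auto
    finally have a: "\<bar>a\<bar> \<le> A * ?n * norm (x' - x)" .
    have "\<bar>b\<bar> \<le> B * (norm (x' - x) + norm (y' - y)) * norm (x' - x)"
      using B m by (simp add: b_def)
    also have "\<dots> \<le> B * ?n * norm (x' - x)"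
      using B by (intro mult_right_mono mult_left_mono) auto
    finally have b: "\<bar>b\<bar> \<le> B * ?n * norm (x' - x)" .
    have "\<bar>c\<bar> \<le> B * (norm (x' - x) + norm (z' - z)) * norm (x' - x)"
      using B m by (simp add: c_def)
    also have "\<dots> \<le> B * ?n * norm (x' - x)"
      using B by (intro mult_right_mono mult_left_mono) auto
    finally have c: "\<bar>c\<bar> \<le> B * ?n * norm (x' - x)" .
    have "P x' y' z' - P x y' z' - (fst (DF (x, y)) - \<rho> *\<^sub>R fst (Df (x, y)) + \<rho> *\<^sub>R fst (Df (x, z))) \<bullet> (x' - x)
        = a - \<rho> * b + \<rho> * c"
      by (simp add: psi_def a_def b_def c_def inner_diff_left inner_add_left algebra_simps)
    also have "\<bar>\<dots>\<bar> \<le> \<bar>a\<bar> + \<rho> * \<bar>b\<bar> + \<rho> * \<bar>c\<bar>"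
    proof -
      have "\<bar>\<rho> * b\<bar> = \<rho> * \<bar>b\<bar>" "\<bar>\<rho> * c\<bar> = \<rho> * \<bar>c\<bar>"
        using params by (simp_all add: abs_mult)
      then show ?thesis by linarith
    qed
    also have "\<dots> \<le> A * ?n * norm (x' - x) + \<rho> * (B * ?n * norm (x' - x)) + \<rho> * (B * ?n * norm (x' - x))"
      using a b c params by (intro add_mono mult_left_mono) auto
    also have "\<dots> = (A + 2 * \<rho> * B) * ?n * norm (x' - x)"
      by (simp add: algebra_simps)
    finally show "\<bar>P x' y' z' - P x y' z' - (fst (DF (x, y)) - \<rho> *\<^sub>R fst (Df (x, y)) + \<rho> *\<^sub>R fst (Df (x, z))) \<bullet> (x' - x)\<bar>
        \<le> (A + 2 * \<rho> * B) * ?n * norm (x' - x)" .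
  qed
qed

text \<open>Danskin's argument for a saddle value: exchanging one component of the saddle pair at a
  time squeezes the increment of \<open>phi\<close> between increments of \<open>P\<close> in
  \<open>x\<close> alone, at \<open>(y, z')\<close> and at \<open>(y', z)\<close>. Both equal
  \<open>D \<bullet> (x' - x)\<close> up to a quadratic error because the saddle point moves
  Lipschitz continuously.\<close>

lemma phi_derivative:
  assumes x: "x \<in> X"
  defines "D \<equiv> fst (DF (x, fst (saddle x))) - \<rho> *\<^sub>R fst (Df (x, fst (saddle x))) + \<rho> *\<^sub>R fst (Df (x, snd (saddle x)))"
  shows "(phi F f Y \<rho> \<sigma> \<delta> has_derivative (\<lambda>v. D \<bullet> v)) (at x within X)"
proof -
  obtain K where K: "K \<ge> 0" "\<And>x x'. x \<in> X \<Longrightarrow> x' \<in> X \<Longrightarrow> norm (saddle x' - saddle x) \<le> K * norm (x' - x)"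
    using saddle_lipschitz by blast
  obtain C where C: "C \<ge> 0"
    "\<And>x x' y z y' z'. x \<in> X \<Longrightarrow> x' \<in> X \<Longrightarrow> y \<in> Y \<Longrightarrow> z \<in> Y \<Longrightarrow> y' \<in> Y \<Longrightarrow> z' \<in> Y \<Longrightarrow>
      \<bar>P x' y' z' - P x y' z' - (fst (DF (x, y)) - \<rho> *\<^sub>R fst (Df (x, y)) + \<rho> *\<^sub>R fst (Df (x, z))) \<bullet> (x' - x)\<bar>
        \<le> C * (norm (x' - x) + norm (y' - y) + norm (z' - z)) * norm (x' - x)"
    using psi_x_increment by blast
  obtain y z where yz: "saddle x = (y, z)" by fastforce
  have s: "y \<in> Y" "z \<in> Y" "\<And>y'. y' \<in> Y \<Longrightarrow> P x y' z \<le> P x y z" "\<And>z'. z' \<in> Y \<Longrightarrow> P x y z \<le> P x y z'"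
    using saddle(1)[OF x] unfolding yz by (auto simp: saddle_point_def)
  let ?\<phi> = "phi F f Y \<rho> \<sigma> \<delta>"
  have est: "norm (?\<phi> x' - ?\<phi> x - D \<bullet> (x' - x)) \<le> C * (1 + K) * (norm (x' - x))\<^sup>2" if x': "x' \<in> X" for x'
  proof -
    obtain y' z' where yz': "saddle x' = (y', z')" by fastforce
    have s': "y' \<in> Y" "z' \<in> Y" "\<And>v. v \<in> Y \<Longrightarrow> P x' v z' \<le> P x' y' z'" "\<And>v. v \<in> Y \<Longrightarrow> P x' y' z' \<le> P x' y' v"
      using saddle(1)[OF x'] unfolding yz' by (auto simp: saddle_point_def)
    have "norm (y' - y) \<le> K * norm (x' - x)" "norm (z' - z) \<le> K * norm (x' - x)"
      using K(2)[OF x x'] norm_fst_le[of "y' - y" "z' - z"] norm_snd_le[of "z' - z" "y' - y"]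
      unfolding yz yz' by (simp_all only: diff_Pair fst_conv snd_conv)
    then have "C * (norm (x' - x) + norm (y' - y) + norm (z - z)) * norm (x' - x) \<le> C * (norm (x' - x) + K * norm (x' - x)) * norm (x' - x)"
      "C * (norm (x' - x) + norm (y - y) + norm (z' - z)) * norm (x' - x) \<le> C * (norm (x' - x) + K * norm (x' - x)) * norm (x' - x)"
      using C(1) by (auto intro!: mult_right_mono mult_left_mono)
    moreover have "C * (norm (x' - x) + K * norm (x' - x)) * norm (x' - x) = C * (1 + K) * (norm (x' - x))\<^sup>2"
      by (simp add: power2_eq_square algebra_simps)
    ultimately have
      "\<bar>P x' y' z - P x y' z - D \<bullet> (x' - x)\<bar> \<le> C * (1 + K) * (norm (x' - x))\<^sup>2"
      "\<bar>P x' y z' - P x y z' - D \<bullet> (x' - x)\<bar> \<le> C * (1 + K) * (norm (x' - x))\<^sup>2"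
      using C(2)[OF x x' s(1,2) s'(1) s(2)] C(2)[OF x x' s(1,2) s(1) s'(2)]
      unfolding D_def yz fst_conv snd_conv by linarith+
    moreover have "?\<phi> x' - ?\<phi> x = P x' y' z' - P x y z"
      by (simp add: phi_eq_saddle_value x x' yz yz')
    moreover have "P x' y' z' - P x y z \<le> P x' y' z - P x y' z"
      using s(3)[OF s'(1)] s'(4)[OF s(2)] by linarith
    moreover have "P x' y z' - P x y z' \<le> P x' y' z' - P x y z"
      using s(4)[OF s'(2)] s'(3)[OF s(1)] by linarith
    ultimately show ?thesis unfolding real_norm_def by linarith
  qed
  have "((\<lambda>x'. norm (x' - x)) \<longlongrightarrow> norm (x - x)) (at x within X)"
    by (intro tendsto_intros)
  then have lim: "((\<lambda>x'. C * (1 + K) * norm (x' - x)) \<longlongrightarrow> 0) (at x within X)"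
    by (auto intro: tendsto_mult_right_zero)
  show ?thesis
  proof (rule has_derivativeI_sandwich[of 1 _ _ _ _ "\<lambda>x'. C * (1 + K) * norm (x' - x)"])
    show "((\<lambda>x'. C * (1 + K) * norm (x' - x)) \<longlongrightarrow> 0) (at x within X)" by (rule lim)
    fix x' assume x': "x' \<in> X" "x' \<noteq> x"
    then have "norm (x' - x) > 0" by simp
    then show "norm (?\<phi> x' - ?\<phi> x - D \<bullet> (x' - x)) / norm (x' - x) \<le> C * (1 + K) * norm (x' - x)"
      using est[OF x'(1)] by (simp only: pos_divide_le_eq power2_eq_square mult.assoc)
  qed (auto intro: bounded_linear_inner_right)
qed

lemma saddle_optimality:
  assumes x: "x \<in> X" and y: "y = ystar F f Y \<rho> \<sigma> \<delta> x"
    and z: "z = snd (THE w. saddle_point Y Y (P x) w)"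
  shows "y \<in> Y" "z \<in> Y" "\<And>s. s \<in> Y \<Longrightarrow> P x s z \<le> P x y z" "\<And>s. s \<in> Y \<Longrightarrow> P x y z \<le> P x y s"
    and "snd (DF (x, y)) - \<rho> *\<^sub>R snd (Df (x, y)) - (\<sigma> *\<^sub>R z + \<delta> *\<^sub>R y) \<in> normal_cone Y y"
    and "- (\<rho> *\<^sub>R snd (Df (x, z))) - \<sigma> *\<^sub>R (z - y) \<in> normal_cone Y z"
    and "(phi F f Y \<rho> \<sigma> \<delta> has_derivative
      (\<lambda>v. (fst (DF (x, y)) - \<rho> *\<^sub>R fst (Df (x, y)) + \<rho> *\<^sub>R fst (Df (x, z))) \<bullet> v)) (at x within X)"
proof -
  have yz: "saddle x = (y, z)"
    by (simp add: y z saddle_def ystar_def)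
  show in_Y: "y \<in> Y" "z \<in> Y" using saddle(2)[OF x] by (auto simp: yz)
  have "0 \<le> fst (T x (y, z)) \<bullet> (s - y)" "0 \<le> snd (T x (y, z)) \<bullet> (s - z)" if "s \<in> Y" for s
    using saddle(3)[OF x, of "(s, z)"] saddle(3)[OF x, of "(y, s)"] in_Y that
    by (auto simp: yz inner_prod_def)
  then have "- fst (T x (y, z)) \<in> normal_cone Y y" "- snd (T x (y, z)) \<in> normal_cone Y z"
    using in_Y by (auto simp: normal_cone_def)
  then show "snd (DF (x, y)) - \<rho> *\<^sub>R snd (Df (x, y)) - (\<sigma> *\<^sub>R z + \<delta> *\<^sub>R y) \<in> normal_cone Y y"
    "- (\<rho> *\<^sub>R snd (Df (x, z))) - \<sigma> *\<^sub>R (z - y) \<in> normal_cone Y z"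
    by (simp_all add: T_def algebra_simps)
  show "P x s z \<le> P x y z" "P x y z \<le> P x y s" if "s \<in> Y" for s
    using saddle(1)[OF x] that by (auto simp: yz saddle_point_def)
  show "(phi F f Y \<rho> \<sigma> \<delta> has_derivative
      (\<lambda>v. (fst (DF (x, y)) - \<rho> *\<^sub>R fst (Df (x, y)) + \<rho> *\<^sub>R fst (Df (x, z))) \<bullet> v)) (at x within X)"
    using phi_derivative[OF x] unfolding yz fst_conv snd_conv .
qed

lemma saddle_no_farther_than_lower_sol:
  assumes "y \<in> Y" "z \<in> Y" "\<And>s. s \<in> Y \<Longrightarrow> P x y z \<le> P x y s" and s: "s \<in> lower_sol f Y x"
  shows "norm (z - y) \<le> norm (s - y)"
proof -
  have sY: "s \<in> Y" "f (x, s) \<le> f (x, z)"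
    using s assms(2) by (auto simp: lower_sol_def is_arg_min_def not_less)
  have "\<rho> * f (x, s) \<le> \<rho> * f (x, z)" using sY params by simp
  moreover have "P x y z \<le> P x y s" using assms(3) sY by blast
  ultimately have "\<sigma> * ((norm z)\<^sup>2 - 2 * (y \<bullet> z)) \<le> \<sigma> * ((norm s)\<^sup>2 - 2 * (y \<bullet> s))"
    by (simp add: psi_def algebra_simps)
  then have "(norm z)\<^sup>2 - 2 * (y \<bullet> z) \<le> (norm s)\<^sup>2 - 2 * (y \<bullet> s)"
    using params by simp
  then have "(norm (z - y))\<^sup>2 \<le> (norm (s - y))\<^sup>2"
    unfolding power2_norm_eq_inner by (simp add: inner_diff_left inner_diff_right inner_commute)
  then show ?thesis by (rule power2_le_imp_le) simp
qed

end

section \<open>Normal cones of sublevel sets\<close>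

text \<open>A constraint qualification says that the adjoint derivative kills no nonzero multiplier
  in \<open>K\<close>. Compactness of the unit multipliers turns this into a uniform bound, which
  scaling extends to the whole cone.\<close>

lemma linear_lower_bound_on_cone:
  fixes B :: "'a::euclidean_space \<Rightarrow> 'b::euclidean_space"
  assumes B: "linear B" and K: "closed K" "conic K" and inj: "\<And>p. p \<in> K \<Longrightarrow> B p = 0 \<Longrightarrow> p = 0"
  obtains c where "c > 0" "\<And>p. p \<in> K \<Longrightarrow> c * norm p \<le> norm (B p)"
proof (cases "K \<inter> sphere 0 1 = {}")
  case True
  have "p = 0" if "p \<in> K" for p
  proof (rule ccontr)
    assume "p \<noteq> 0"
    moreover have "inverse (norm p) *\<^sub>R p \<in> K" using K(2) that by (simp add: conic_def)
    ultimately show False using True by (auto simp: disjoint_iff dest: bspec)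
  qed
  then show ?thesis using that[of 1] by fastforce
next
  case False
  have "compact (K \<inter> sphere 0 1)"
    using K(1) by (intro closed_Int_compact) auto
  moreover have "continuous_on (K \<inter> sphere 0 1) (\<lambda>p. norm (B p))"
    using B by (intro continuous_on_norm linear_continuous_on) (simp add: linear_conv_bounded_linear)
  ultimately obtain q where q: "q \<in> K" "norm q = 1" "\<And>p. p \<in> K \<Longrightarrow> norm p = 1 \<Longrightarrow> norm (B q) \<le> norm (B p)"
    using continuous_attains_inf[of "K \<inter> sphere 0 1" "\<lambda>p. norm (B p)"] False
    by (metis IntD1 IntD2 IntI mem_sphere_0)
  show ?thesis
  proof (rule that[of "norm (B q)"])
    show "norm (B q) > 0" using inj[OF q(1)] q(2) by fastforce
    fix p assume p: "p \<in> K"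
    show "norm (B q) * norm p \<le> norm (B p)"
    proof (cases "p = 0")
      case False
      have "norm (B q) \<le> norm (B (inverse (norm p) *\<^sub>R p))"
        using K(2) p False by (intro q(3)) (auto simp: conic_def)
      also have "\<dots> = norm (B p) / norm p"
        using False by (simp add: linear_scale[OF B] divide_inverse mult.commute)
      finally show ?thesis using False by (simp add: pos_le_divide_eq)
    qed (use linear_0[OF B] in simp)
  qed
qed

text \<open>The lower bound keeps preimages of a convergent sequence bounded, hence they accumulate.
  Linear images of closed cones need not be closed in general, and the separation below needs a
  closed set.\<close>

lemma closed_linear_image_cone:
  fixes B :: "'a::euclidean_space \<Rightarrow> 'b::euclidean_space"
  assumes B: "linear B" and K: "closed K" "conic K" and inj: "\<And>p. p \<in> K \<Longrightarrow> B p = 0 \<Longrightarrow> p = 0"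
  shows "closed (B ` K)"
proof -
  obtain c where c: "c > 0" "\<And>p. p \<in> K \<Longrightarrow> c * norm p \<le> norm (B p)"
    using linear_lower_bound_on_cone[OF assms] by blast
  have "l \<in> B ` K" if q: "\<And>n. q n \<in> B ` K" "q \<longlonglongrightarrow> l" for q l
  proof -
    obtain p where p: "\<And>n. p n \<in> K" "\<And>n. q n = B (p n)"
      using q(1) unfolding image_iff by metis
    obtain M where M: "\<And>n. norm (q n) \<le> M"
      using convergent_imp_Bseq[of q] q(2) unfolding convergent_def Bseq_def by auto
    have "norm (p n) \<le> M / c" for n
      using c(1) c(2)[OF p(1)[of n]] M[of n] p(2)[of n] by (simp add: pos_le_divide_eq mult.commute)
    then have "bounded (range p)" by (auto intro!: boundedI)
    then obtain r l' where r: "strict_mono r" "(p \<circ> r) \<longlonglongrightarrow> l'"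
      using bounded_imp_convergent_subsequence by blast
    have "l' \<in> K"
      using closed_sequentially[OF K(1) _ r(2)] p(1) by simp
    have "(\<lambda>n. B ((p \<circ> r) n)) \<longlonglongrightarrow> B l'"
      by (rule bounded_linear.tendsto[OF linear_conv_bounded_linear[THEN iffD1, OF B] r(2)])
    moreover have "(\<lambda>n. B ((p \<circ> r) n)) \<longlonglongrightarrow> l"
      using LIMSEQ_subseq_LIMSEQ[OF q(2) r(1)] by (simp add: p(2) o_def)
    ultimately have "l = B l'" using LIMSEQ_unique by blast
    then show ?thesis using \<open>l' \<in> K\<close> by blast
  qed
  then show ?thesis unfolding closed_sequential_limits by blast
qed

lemma complementary_component:
  fixes p w :: "real ^ 'p"
  assumes "0 \<le> p" "w \<le> 0"
  shows "p \<bullet> w = 0 \<longleftrightarrow> (\<forall>i. p $ i * w $ i = 0)"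
proof -
  have "p \<bullet> w = 0 \<longleftrightarrow> (\<Sum>i\<in>UNIV. - (p $ i * w $ i)) = 0"
    by (simp add: inner_vec_def sum_negf)
  also have "\<dots> \<longleftrightarrow> (\<forall>i. p $ i * w $ i = 0)"
    using assms by (subst sum_nonneg_eq_0_iff) (auto simp: less_eq_vec_def mult_nonneg_nonpos)
  finally show ?thesis .
qed

text \<open>A Farkas argument. If \<open>v\<close> were outside the closed cone of active gradients,
  a separating direction \<open>d\<close> would satisfy \<open>d \<bullet> v > 0\<close> and not
  increase any active constraint to first order. A small multiple of a strictly decreasing direction
  \<open>d0\<close> makes it truly feasible without losing the sign, which contradicts normality of
  \<open>v\<close>.\<close>

lemma normal_cone_sublevel:
  fixes h :: "'a::euclidean_space \<Rightarrow> real ^ 'p"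
  assumes h: "(h has_derivative h') (at x)" and x: "h x \<le> 0"
    and CQ: "\<And>p. 0 \<le> p \<Longrightarrow> p \<bullet> h x = 0 \<Longrightarrow> adjoint h' p = 0 \<Longrightarrow> p = 0"
    and v: "v \<in> normal_cone {x. h x \<le> 0} x"
  obtains p where "0 \<le> p" "p \<bullet> h x = 0" "v = adjoint h' p"
proof -
  have lin: "linear h'" using h by (rule has_derivative_linear)
  have linA: "linear (adjoint h')" using lin by (rule adjoint_linear)
  define K where "K = {p. 0 \<le> p \<and> p \<bullet> h x = 0}"
  have "closed {p::real^'p. 0 \<le> p}"
    unfolding less_eq_vec_def by (intro closed_Collect_all closed_Collect_le continuous_intros)
  then have K: "closed K"
    unfolding K_def by (intro closed_Collect_conj closed_Collect_eq continuous_intros)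
  have K': "conic K" "convex K"
    unfolding K_def conic_def convex_def by (auto simp: less_eq_vec_def inner_add_left)
  have inj: "p = 0" if "p \<in> K" "adjoint h' p = 0" for p
    using CQ that by (simp add: K_def)
  have axis_K: "axis i 1 \<in> K" if "h x $ i = 0" for i
    using that by (simp add: K_def less_eq_vec_def inner_axis') (simp add: axis_def)
  have comp: "h' d $ i = d \<bullet> adjoint h' (axis i 1)" for d i
    by (simp add: adjoint_works[OF lin] inner_axis)
  \<comment> \<open>The dual form of the qualification: the image of the simplex \<open>K1\<close>
    of active multipliers is compact, convex and avoids \<open>0\<close>, and minus the normal of a
    separating hyperplane decreases every active constraint.\<close>
  obtain d0 where d0: "\<And>i. h x $ i = 0 \<Longrightarrow> h' d0 $ i < 0"
  proof -
    define K1 where "K1 = K \<inter> {p. (\<Sum>i\<in>UNIV. p $ i) = 1}"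
    have "norm p \<le> 1" if "p \<in> K1" for p
      using norm_le_l1_cart[of p] that by (auto simp: K1_def K_def less_eq_vec_def)
    then have "bounded K1" by (auto intro: boundedI)
    moreover have "closed K1"
      unfolding K1_def by (intro closed_Int K closed_Collect_eq continuous_intros)
    ultimately have "compact K1" by (simp add: compact_eq_bounded_closed)
    then have "closed (adjoint h' ` K1)"
      using linA by (intro compact_imp_closed compact_continuous_image linear_continuous_on)
        (auto simp: linear_conv_bounded_linear)
    moreover have "convex {p::real^'p. (\<Sum>i\<in>UNIV. p $ i) = 1}"
      unfolding convex_def by (simp add: sum.distrib flip: sum_distrib_left)
    then have "convex (adjoint h' ` K1)"
      unfolding K1_def by (intro convex_linear_image linA convex_Int K')
    moreover have "0 \<notin> adjoint h' ` K1"
      using inj by (force simp: K1_def)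
    ultimately obtain a b where ab: "0 < b" "\<And>z. z \<in> adjoint h' ` K1 \<Longrightarrow> a \<bullet> z > b"
      using separating_hyperplane_closed_0 by metis
    have "h' (- a) $ i < 0" if "h x $ i = 0" for i
    proof -
      have "axis i 1 \<in> K1"
        using axis_K[OF that] by (simp add: K1_def axis_def)
      then show ?thesis using ab unfolding comp by fastforce
    qed
    then show ?thesis using that by blast
  qed
  have "v \<in> adjoint h' ` K"
  proof (rule ccontr)
    assume "v \<notin> adjoint h' ` K"
    moreover have "closed (adjoint h' ` K)" "convex (adjoint h' ` K)"
      by (rule closed_linear_image_cone[OF linA K K'(1)], fact inj) (intro convex_linear_image linA K')
    ultimately obtain a b where ab: "a \<bullet> v < b" "\<And>z. z \<in> adjoint h' ` K \<Longrightarrow> a \<bullet> z > b"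
      using separating_hyperplane_closed_point by metis
    have b: "b < 0"
    proof -
      have "0 \<in> K" by (simp add: K_def)
      then show ?thesis using ab(2)[of 0] linear_0[OF linA] by force
    qed
    \<comment> \<open>A negative value could be scaled along the cone to exactly \<open>b\<close>,
      against the strict inequality in \<open>ab\<close>.\<close>
    have nonneg: "a \<bullet> z \<ge> 0" if z: "z \<in> adjoint h' ` K" for z
    proof (rule ccontr)
      assume neg: "\<not> a \<bullet> z \<ge> 0"
      obtain p where p: "p \<in> K" "z = adjoint h' p" using z by blast
      have "(b / (a \<bullet> z)) *\<^sub>R p \<in> K"
        using K'(1) p(1) neg b by (simp add: conic_def divide_nonpos_neg)
      then have "a \<bullet> ((b / (a \<bullet> z)) *\<^sub>R z) > b"
        using ab(2) by (auto simp: p(2) linear_scale[OF linA, symmetric])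
      then show False using neg by simp
    qed
    define d where "d = - a"
    have dv: "d \<bullet> v > 0" using ab(1) b by (simp add: d_def)
    have d: "h' d $ i \<le> 0" if "h x $ i = 0" for i
      using nonneg axis_K[OF that] unfolding comp d_def by auto
    \<comment> \<open>Chosen so that \<open>d0\<close> changes \<open>d \<bullet> v\<close> by at
      most half of it; the added \<open>1\<close> keeps the denominator positive.\<close>
    define \<epsilon> where "\<epsilon> = (d \<bullet> v) / (2 * (\<bar>d0 \<bullet> v\<bar> + 1))"
    define e where "e = d + \<epsilon> *\<^sub>R d0"
    have \<epsilon>: "\<epsilon> > 0" using dv by (simp add: \<epsilon>_def)
    have "\<epsilon> * \<bar>d0 \<bullet> v\<bar> \<le> \<epsilon> * (\<bar>d0 \<bullet> v\<bar> + 1)" using \<epsilon> by simp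
    also have "\<dots> = (d \<bullet> v) / 2" by (simp add: \<epsilon>_def field_simps)
    also have "\<dots> < d \<bullet> v" using dv by simp
    finally have "\<epsilon> * \<bar>d0 \<bullet> v\<bar> < d \<bullet> v" .
    moreover have "- (\<epsilon> * (d0 \<bullet> v)) \<le> \<epsilon> * \<bar>d0 \<bullet> v\<bar>"
      using \<epsilon> by (metis abs_ge_minus_self abs_mult abs_of_pos)
    ultimately have ev: "e \<bullet> v > 0" by (simp add: e_def inner_add_left)
    have e: "h' e $ i < 0" if "h x $ i = 0" for i
      using d[OF that] d0[OF that] \<epsilon>
      by (simp add: e_def linear_add[OF lin] linear_scale[OF lin] add_nonpos_neg mult_pos_neg)
    have comp_i: "\<forall>\<^sub>F t in at_right 0. h (x + t *\<^sub>R e) $ i \<le> 0" for i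
    proof (cases "h x $ i = 0")
      case True
      have "((\<lambda>x. h x $ i) has_derivative (\<lambda>u. h' u $ i)) (at x)"
        by (rule bounded_linear.has_derivative[OF bounded_linear_vec_nth h])
      from directional_derivative_limit(1)[OF convex_UNIV _ _ this, of "x + e"]
      have "((\<lambda>t. h (x + t *\<^sub>R e) $ i / t) \<longlongrightarrow> h' e $ i) (at_right 0)"
        by (simp add: True)
      then have "\<forall>\<^sub>F t in at_right 0. h (x + t *\<^sub>R e) $ i / t < 0"
        using e[OF True] by (rule order_tendstoD)
      moreover have "\<forall>\<^sub>F t in at_right (0::real). t > 0"
        by (simp add: eventually_at_right_less)
      ultimately show ?thesis
        by eventually_elim (simp add: divide_less_0_iff)
    next
      case False
      then have "h x $ i < 0" using x by (metis less_eq_vec_def order_le_less zero_index)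
      moreover have "((\<lambda>t. h (x + t *\<^sub>R e) $ i) \<longlongrightarrow> h x $ i) (at_right 0)"
      proof (intro tendsto_intros)
        have "((\<lambda>t. x + t *\<^sub>R e) \<longlongrightarrow> x + 0 *\<^sub>R e) (at_right 0)" by (intro tendsto_intros)
        then show "((\<lambda>t. h (x + t *\<^sub>R e)) \<longlongrightarrow> h x) (at_right 0)"
          using isCont_tendsto_compose[OF has_derivative_continuous[OF h], of "\<lambda>t. x + t *\<^sub>R e" "at_right 0"] by simp
      qed
      ultimately have "\<forall>\<^sub>F t in at_right 0. h (x + t *\<^sub>R e) $ i < 0" by (metis order_tendstoD(2))
      then show ?thesis by eventually_elim simp
    qed
    have "\<forall>\<^sub>F t in at_right 0. \<forall>i. h (x + t *\<^sub>R e) $ i \<le> 0"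
      by (intro eventually_all_finite comp_i)
    moreover have "\<forall>\<^sub>F t in at_right (0::real). t > 0"
      by (simp add: eventually_at_right_less)
    ultimately have "\<forall>\<^sub>F t in at_right (0::real). t > 0 \<and> h (x + t *\<^sub>R e) \<le> 0"
      by eventually_elim (simp add: less_eq_vec_def)
    then obtain t where t: "t > 0" "h (x + t *\<^sub>R e) \<le> 0"
      using eventually_happens'[OF trivial_limit_at_right_real] by blast
    then have "v \<bullet> (x + t *\<^sub>R e - x) \<le> 0"
      using v x by (auto simp: normal_cone_def split: if_splits)
    then have "t * (e \<bullet> v) \<le> 0" by (simp add: inner_commute)
    then show False using t(1) ev by (simp add: mult_le_0_iff)
  qed
  then show ?thesis using that by (auto simp: K_def)
qed

lemma adjoint_blinfun_diff:
  fixes A B :: "'a::euclidean_space \<Rightarrow>\<^sub>L 'b::euclidean_space"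
  shows "adjoint (blinfun_apply (A - B)) p = adjoint A p - adjoint B p"
proof -
  have lin: "linear (blinfun_apply C)" for C :: "'a \<Rightarrow>\<^sub>L 'b"
    by (simp add: bounded_linear.linear blinfun.bounded_linear_right)
  have "u \<bullet> adjoint (blinfun_apply (A - B)) p = u \<bullet> (adjoint A p - adjoint B p)" for u
    by (simp add: adjoint_works[OF lin] inner_diff_right inner_diff_left blinfun.diff_left)
  then show ?thesis by (metis vector_eq_ldot)
qed

lemma norm_adjoint_blinfun_le:
  fixes A :: "'a::euclidean_space \<Rightarrow>\<^sub>L 'b::euclidean_space"
  shows "norm (adjoint A p) \<le> norm A * norm p"
proof (cases "adjoint A p = 0")
  case False
  have lin: "linear (blinfun_apply A)"
    by (simp add: bounded_linear.linear blinfun.bounded_linear_right)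
  have "norm (adjoint A p) * norm (adjoint A p) = A (adjoint A p) \<bullet> p"
    by (simp add: adjoint_works[OF lin] flip: power2_norm_eq_inner power2_eq_square)
      (simp add: power2_norm_eq_inner adjoint_works[OF lin])
  also have "\<dots> \<le> norm (A (adjoint A p)) * norm p" by (rule norm_cauchy_schwarz)
  also have "\<dots> \<le> (norm A * norm (adjoint A p)) * norm p"
    by (intro mult_right_mono norm_blinfun) auto
  finally show ?thesis using False by (simp add: mult.commute mult.left_commute)
qed simp

text \<open>The cone \<open>K\<close> may be larger than the multiplier cone, so that differences of
  multipliers can be estimated too. Constraints inactive at \<open>a\<close> stay inactive nearby,
  hence multipliers at \<open>u k\<close> lie in \<open>K\<close>. The lower bound at
  \<open>a\<close> survives with half the constant once \<open>h'\<close> has moved by less than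
  \<open>c / 2\<close>, and it then serves as the qualification at \<open>u k\<close>.\<close>

lemma normal_cone_multipliers_near:
  fixes h :: "'a::euclidean_space \<Rightarrow> real ^ 'p"
  assumes h: "\<And>x. (h has_derivative blinfun_apply (h' x)) (at x)" and cont: "continuous_on UNIV h'"
    and K: "closed K" "conic K" "\<And>p. 0 \<le> p \<Longrightarrow> p \<bullet> h a = 0 \<Longrightarrow> p \<in> K"
    and inj: "\<And>p. p \<in> K \<Longrightarrow> adjoint (h' a) p = 0 \<Longrightarrow> p = 0"
    and u: "u \<longlonglongrightarrow> a" "\<And>k. h (u k) \<le> 0"
  obtains c where "c > 0" "\<forall>\<^sub>F k in sequentially. (\<forall>p\<in>K. c * norm p \<le> norm (adjoint (h' (u k)) p)) \<and>
      (\<forall>v\<in>normal_cone {x. h x \<le> 0} (u k). \<exists>p\<in>K. 0 \<le> p \<and> p \<bullet> h (u k) = 0 \<and> p \<bullet> h a = 0 \<and> v = adjoint (h' (u k)) p)"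
proof -
  have lin: "linear (blinfun_apply A)" for A :: "'a \<Rightarrow>\<^sub>L (real ^ 'p)"
    by (simp add: bounded_linear.linear blinfun.bounded_linear_right)
  obtain c where c: "c > 0" "\<And>p. p \<in> K \<Longrightarrow> c * norm p \<le> norm (adjoint (h' a) p)"
    using linear_lower_bound_on_cone[OF adjoint_linear[OF lin] K(1,2) inj] by blast
  have "(\<lambda>k. h' (u k)) \<longlonglongrightarrow> h' a"
    using cont u(1) by (metis UNIV_I continuous_on_eq_continuous_at isCont_tendsto_compose open_UNIV)
  then have close: "\<forall>\<^sub>F k in sequentially. dist (h' (u k)) (h' a) < c / 2"
    using c(1) by (intro tendstoD) auto
  have conth: "(\<lambda>k. h (u k)) \<longlonglongrightarrow> h a"
    using has_derivative_continuous[OF h] u(1) by (metis isCont_tendsto_compose)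
  then have ha: "h a \<le> 0"
    unfolding less_eq_vec_def using u(2)
    by (auto simp: less_eq_vec_def intro!: LIMSEQ_le_const2[OF tendsto_vec_nth])
  have "\<forall>\<^sub>F k in sequentially. h a $ i < 0 \<longrightarrow> h (u k) $ i < 0" for i
    using order_tendstoD(2)[OF tendsto_vec_nth[OF conth], of i 0] by (cases "h a $ i < 0") auto
  then have inact: "\<forall>\<^sub>F k in sequentially. \<forall>i. h a $ i < 0 \<longrightarrow> h (u k) $ i < 0"
    by (rule eventually_all_finite)
  show ?thesis
  proof (rule that[of "c / 2"])
    show "\<forall>\<^sub>F k in sequentially. (\<forall>p\<in>K. c / 2 * norm p \<le> norm (adjoint (h' (u k)) p)) \<and>
      (\<forall>v\<in>normal_cone {x. h x \<le> 0} (u k). \<exists>p\<in>K. 0 \<le> p \<and> p \<bullet> h (u k) = 0 \<and> p \<bullet> h a = 0 \<and> v = adjoint (h' (u k)) p)"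
      using close inact
    proof eventually_elim
      case (elim k)
      have lower: "c / 2 * norm p \<le> norm (adjoint (h' (u k)) p)" if "p \<in> K" for p
      proof -
        have "norm (adjoint (h' a) p) - norm (adjoint (h' (u k)) p) \<le> norm (adjoint (h' a) p - adjoint (h' (u k)) p)"
          by (rule norm_triangle_ineq2)
        also have "\<dots> = norm (adjoint (blinfun_apply (h' a - h' (u k))) p)"
          by (simp only: adjoint_blinfun_diff)
        also have "\<dots> \<le> norm (h' a - h' (u k)) * norm p" by (rule norm_adjoint_blinfun_le)
        also have "\<dots> \<le> c / 2 * norm p"
          using elim(1) by (intro mult_right_mono) (auto simp: dist_norm norm_minus_commute)
        finally show ?thesis using c(2)[OF that] by linarith
      qed
      have in_K: "p \<bullet> h a = 0 \<and> p \<in> K" if p: "0 \<le> p" "p \<bullet> h (u k) = 0" for p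
      proof -
        have "p $ i * h a $ i = 0" for i
        proof (cases "h a $ i < 0")
          case True
          then have "p $ i = 0"
            using p complementary_component[OF p(1) u(2)] elim(2) by force
          then show ?thesis by simp
        next
          case False
          then have "h a $ i = 0" using ha by (metis less_eq_vec_def order_le_less zero_index)
          then show ?thesis by simp
        qed
        then show ?thesis using K(3) p complementary_component[OF p(1) ha] by blast
      qed
      have "\<exists>p\<in>K. 0 \<le> p \<and> p \<bullet> h (u k) = 0 \<and> p \<bullet> h a = 0 \<and> v = adjoint (h' (u k)) p"
        if v: "v \<in> normal_cone {x. h x \<le> 0} (u k)" for v
      proof -
        have "p = 0" if "0 \<le> p" "p \<bullet> h (u k) = 0" "adjoint (h' (u k)) p = 0" for p
          using lower[of p] in_K[of p] that c(1) by (simp add: mult_le_0_iff)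
        then obtain p where "0 \<le> p" "p \<bullet> h (u k) = 0" "v = adjoint (h' (u k)) p"
          using normal_cone_sublevel[OF h u(2) _ v] by blast
        then show ?thesis using in_K by blast
      qed
      then show ?case using lower by blast
    qed
  qed (use c in simp)
qed

section \<open>Passage to the limit\<close>

lemma jacobian_transpose_eq_adjoint:
  fixes h :: "real ^ 'm \<Rightarrow> real ^ 'p"
  assumes "(h has_derivative h') (at y)"
  shows "transpose (jacobian h (at y)) *v \<mu> = adjoint h' \<mu>"
proof -
  have "u \<bullet> (transpose (jacobian h (at y)) *v \<mu>) = u \<bullet> adjoint h' \<mu>" for u
    using transpose_jacobian_inner[OF assms, of \<mu> u]
    by (simp add: adjoint_works[OF has_derivative_linear[OF assms]] inner_commute)
  then show ?thesis by (metis vector_eq_ldot)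
qed

lemma adjoint_blinfun_works:
  fixes A :: "'a::euclidean_space \<Rightarrow>\<^sub>L 'b::euclidean_space"
  shows "adjoint A p \<bullet> u = p \<bullet> A u"
  using adjoint_works[of "blinfun_apply A" u p]
  by (simp add: bounded_linear.linear blinfun.bounded_linear_right inner_commute)

lemma gradient_component_inner:
  fixes h :: "'a::euclidean_space \<Rightarrow> real ^ 'p"
  assumes "(h has_derivative blinfun_apply A) (at y)"
  shows "gradient (\<lambda>y. h y $ i) (at y) = adjoint A (axis i 1)"
proof (rule gradient_eqI)
  have "((\<lambda>y. h y $ i) has_derivative (\<lambda>v. A v $ i)) (at y)"
    by (rule bounded_linear.has_derivative[OF bounded_linear_vec_nth assms])
  then show "((\<lambda>y. h y $ i) has_derivative (\<lambda>v. adjoint A (axis i 1) \<bullet> v)) (at y)"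
    by (simp add: adjoint_blinfun_works inner_axis')
qed

text \<open>\<open>independent\<close> speaks of a set of vectors, while multipliers are indexed by
  constraints; injectivity on the active indices allows passing between the two by
  \<open>inv_into\<close>.\<close>

lemma LICQ_injective:
  fixes h :: "real ^ 'm \<Rightarrow> real ^ 'p"
  assumes h: "(h has_derivative blinfun_apply A) (at y)" and LICQ: "lower_LICQ h y"
    and p: "\<And>i. h y $ i \<noteq> 0 \<Longrightarrow> p $ i = 0" "adjoint A p = 0"
  shows "p = 0"
proof -
  define I where "I = {i. h y $ i = 0}"
  define a where "a i = adjoint A (axis i 1)" for i
  have inj: "inj_on a I" and ind: "independent (a ` I)"
    using LICQ unfolding lower_LICQ_def gradient_component_inner[OF h] I_def a_def by auto
  have lin: "linear (adjoint (blinfun_apply A))"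
    by (intro adjoint_linear) (simp add: bounded_linear.linear blinfun.bounded_linear_right)
  have "p = (\<Sum>i\<in>UNIV. p $ i *\<^sub>R axis i 1)"
    using basis_expansion[of p] by (simp add: scalar_mult_eq_scaleR)
  then have "adjoint A p = (\<Sum>i\<in>UNIV. p $ i *\<^sub>R a i)"
    by (metis (no_types, lifting) a_def lin linear_scale linear_sum sum.cong)
  also have "\<dots> = (\<Sum>i\<in>I. p $ i *\<^sub>R a i)"
    using p(1) by (intro sum.mono_neutral_right) (auto simp: I_def)
  also have "\<dots> = (\<Sum>i\<in>I. p $ (inv_into I a (a i)) *\<^sub>R a i)"
    using inj by (intro sum.cong) auto
  also have "\<dots> = (\<Sum>v\<in>a ` I. p $ (inv_into I a v) *\<^sub>R v)"
    by (simp add: sum.reindex[OF inj])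
  finally have 0: "(\<Sum>v\<in>a ` I. p $ (inv_into I a v) *\<^sub>R v) = 0"
    using p(2) by simp
  have "p $ i = 0" for i
  proof (cases "i \<in> I")
    case True
    then show ?thesis
      using independentD[OF ind _ order_refl 0, of "a i"] inj by simp
  qed (use p(1) in \<open>auto simp: I_def\<close>)
  then show ?thesis by (simp add: vec_eq_iff)
qed

text \<open>Composition with a functional reduces the vector-valued case to the scalar one;
  \<open>T\<close> is that composition, as a bounded linear map on derivatives.\<close>

lemma second_derivative_symmetric_functional:
  fixes h :: "'a::real_normed_vector \<Rightarrow> 'b::real_normed_vector"
  assumes W: "open W" "w \<in> W"
    and h': "\<And>x. x \<in> W \<Longrightarrow> (h has_derivative blinfun_apply (h' x)) (at x)"
    and h'': "\<And>x. x \<in> W \<Longrightarrow> (h' has_derivative blinfun_apply (h'' x)) (at x)"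
    and cont: "continuous_on W h''" and L: "bounded_linear (L :: 'b \<Rightarrow> real)"
  shows "L (h'' w u v) = L (h'' w v u)"
proof -
  define T :: "('a \<Rightarrow>\<^sub>L 'b) \<Rightarrow>\<^sub>L ('a \<Rightarrow>\<^sub>L real)" where "T = Blinfun (\<lambda>A. Blinfun L o\<^sub>L A)"
  have T: "T A v = L (A v)" for A v
    unfolding T_def using L
    by (simp add: bounded_linear_Blinfun_apply bounded_bilinear.bounded_linear_right[OF bounded_bilinear_blinfun_compose])
  have "(T o\<^sub>L h'' w) u v = (T o\<^sub>L h'' w) v u"
  proof (rule second_derivative_symmetric[OF W, where h = "\<lambda>x. L (h x)" and h' = "\<lambda>x. T (h' x)"])
    show "((\<lambda>x. L (h x)) has_derivative blinfun_apply (T (h' x))) (at x)" if "x \<in> W" for x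
      using bounded_linear.has_derivative[OF L h'[OF that]] by (simp add: T[abs_def])
    show "((\<lambda>x. T (h' x)) has_derivative blinfun_apply (T o\<^sub>L h'' x)) (at x)" if "x \<in> W" for x
      using bounded_linear.has_derivative[OF blinfun.bounded_linear_right h''[OF that]]
      by (simp add: blinfun_compose.rep_eq o_def)
    show "continuous_on W (\<lambda>x. T o\<^sub>L h'' x)"
      using cont by (intro continuous_intros)
  qed
  then show ?thesis by (simp add: T)
qed

lemma Bseq_of_lower_bound:
  fixes p :: "nat \<Rightarrow> 'a::real_normed_vector" and w :: "nat \<Rightarrow> 'b::real_normed_vector"
  assumes "c > 0" "\<forall>\<^sub>F k in sequentially. c * norm (p k) \<le> norm (w k)" "Bseq w"
  shows "Bseq p"
proof -
  obtain M where M: "\<And>k. norm (w k) \<le> M" using assms(3) unfolding Bseq_def by auto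
  have "\<forall>\<^sub>F k in sequentially. norm (p k) \<le> M / c"
    using assms(2)
  proof eventually_elim
    case (elim k)
    then show ?case using M[of k] assms(1) by (simp add: pos_le_divide_eq mult.commute)
  qed
  then show ?thesis by (rule BfunI)
qed

lemma Bseq_Pair:
  fixes a :: "nat \<Rightarrow> 'a::real_normed_vector" and b :: "nat \<Rightarrow> 'b::real_normed_vector"
  assumes "Bseq a" "Bseq b"
  shows "Bseq (\<lambda>k. (a k, b k))"
proof -
  obtain A B where "\<And>k. norm (a k) \<le> A" "\<And>k. norm (b k) \<le> B"
    using assms unfolding Bseq_def by metis
  then have "norm (a k, b k) \<le> A + B" for k
    using norm_Pair_le[of "a k" "b k"] by (meson add_mono order_trans)
  then show ?thesis by (intro BseqI')
qed

lemma eventually_choice: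
  assumes "\<forall>\<^sub>F k in A. \<exists>p. Q k p"
  obtains h where "\<forall>\<^sub>F k in A. Q k (h k)"
proof
  show "\<forall>\<^sub>F k in A. Q k (SOME p. Q k p)"
    using assms by eventually_elim (rule someI_ex)
qed

lemma infdist_lessE:
  assumes "infdist x A < e" "A \<noteq> {}"
  obtains a where "a \<in> A" "dist x a < e"
  using assms cINF_less_iff[of A "\<lambda>a. dist x a" e] by (auto simp: infdist_notempty)

lemma tendsto_scaleR_zero_Bseq:
  fixes c :: "nat \<Rightarrow> real" and u :: "nat \<Rightarrow> 'a::real_normed_vector"
  assumes "c \<longlonglongrightarrow> 0" "Bseq u"
  shows "(\<lambda>k. c k *\<^sub>R u k) \<longlonglongrightarrow> 0"
proof -
  obtain M where M: "\<And>k. norm (u k) \<le> M" using assms(2) unfolding Bseq_def by auto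
  have "(\<lambda>k. \<bar>c k\<bar> * M) \<longlonglongrightarrow> 0" using assms(1) by (auto intro: tendsto_mult_left_zero tendsto_rabs_zero)
  then show ?thesis
    by (rule Lim_null_comparison[rotated]) (auto intro!: always_eventually mult_left_mono M)
qed

section \<open>Limits of the optimality systems\<close>

locale smooth_bilevel =
  fixes F f :: "(real ^ 'n) \<times> (real ^ 'm) \<Rightarrow> real"
    and G :: "real ^ 'n \<Rightarrow> real ^ 'q" and g :: "real ^ 'm \<Rightarrow> real ^ 'p"
    and DF Df :: "(real ^ 'n) \<times> (real ^ 'm) \<Rightarrow> (real ^ 'n) \<times> (real ^ 'm)"
    and W and f' and f'' and g' and g'' and G' and xb and yb
  assumes F_derivative: "\<And>w. (F has_derivative (\<lambda>v. DF w \<bullet> v)) (at w)"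
    and DF_continuous: "continuous_on UNIV DF"
    and f_derivative: "\<And>w. (f has_derivative (\<lambda>v. Df w \<bullet> v)) (at w)"
    and Df_continuous: "continuous_on UNIV Df"
    and W: "open W" "(xb, yb) \<in> W"
    and f': "\<And>w. w \<in> W \<Longrightarrow> (f has_derivative blinfun_apply (f' w)) (at w)"
    and f'': "\<And>w. w \<in> W \<Longrightarrow> (f' has_derivative blinfun_apply (f'' w)) (at w)"
    and f''_continuous: "continuous_on W f''"
    and g': "\<And>y. (g has_derivative blinfun_apply (g' y)) (at y)"
    and g'': "\<And>y. (g' has_derivative blinfun_apply (g'' y)) (at y)"
    and g''_continuous: "continuous_on UNIV g''"
    and G': "\<And>x. (G has_derivative blinfun_apply (G' x)) (at x)"
    and G'_continuous: "continuous_on UNIV G'"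
begin

lemma Df_eq_f':
  assumes "w \<in> W" shows "Df w \<bullet> v = f' w v"
  using has_derivative_unique[OF f_derivative f'[OF assms]] by metis

lemma g'_continuous: "continuous_on UNIV g'"
  by (rule has_derivative_continuous_on) (rule has_derivative_at_withinI[OF g''])

text \<open>The stationarity equations are tested against vectors, with \<open>\<gamma>\<close> in
  the first slot of each second derivative, as strict differentiation produces them. Symmetry moves
  \<open>\<gamma>\<close> to the slot in which the Jacobians of the Lagrangian carry it; for
  \<open>g\<close> it is applied through the functional given by \<open>\<mu>\<close>.\<close>

lemma C_stationaryI:
  assumes yb: "yb \<in> pess_sol F f {y. g y \<le> 0} xb" and xb: "G xb \<le> 0" "g yb \<le> 0"
    and \<mu>: "0 \<le> \<mu>" "\<mu> \<bullet> g yb = 0" "\<And>v. snd (Df (xb, yb)) \<bullet> v + \<mu> \<bullet> g' yb v = 0"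
    and eq_x: "\<And>u. fst (DF (xb, yb)) \<bullet> u + f'' (xb, yb) (0, \<gamma>) (u, 0) + \<pi> \<bullet> G' xb u = 0"
    and eq_y: "\<And>v. snd (DF (xb, yb)) \<bullet> v + f'' (xb, yb) (0, \<gamma>) (0, v) + \<mu> \<bullet> g'' yb \<gamma> v + \<omega> \<bullet> g' yb v = 0"
    and \<pi>: "0 \<le> \<pi>" "\<pi> \<bullet> G xb = 0"
    and I1: "\<And>i. g yb $ i < 0 \<Longrightarrow> \<omega> $ i = 0"
    and I3: "\<And>i. \<mu> $ i > 0 \<Longrightarrow> g' yb \<gamma> $ i = 0"
    and I2: "\<And>i. \<omega> $ i * (g' yb \<gamma> $ i) \<ge> 0"
  shows "C_stationary F f G g xb"
proof -
  have lagr: "lagr f g x y \<mu> = snd (Df (x, y)) + adjoint (g' y) \<mu>" for x y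
    unfolding lagr_def gradient_snd[OF f_derivative] jacobian_transpose_eq_adjoint[OF g'] ..
  \<comment> \<open>\<open>Df\<close> is defined everywhere; its derivative at the reference pair
    comes from its agreement with the representative of \<open>f'\<close> on the open set
    \<open>W\<close>.\<close>
  have D2f: "(Df has_derivative (\<lambda>v. riesz (f'' (xb, yb) v))) (at (xb, yb))"
  proof (rule has_derivative_transform_within_open[OF _ W])
    show "((\<lambda>w. riesz (f' w)) has_derivative (\<lambda>v. riesz (f'' (xb, yb) v))) (at (xb, yb))"
      by (rule bounded_linear.has_derivative[OF bounded_linear_riesz f''[OF W(2)]])
    show "riesz (f' w) = Df w" if "w \<in> W" for w
      using Df_eq_f'[OF that] by (metis riesz_inner vector_eq_rdot)
  qed
  have snd_riesz: "\<gamma> \<bullet> snd (riesz (f'' (xb, yb) v)) = f'' (xb, yb) (0, \<gamma>) v" for v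
  proof -
    have "\<gamma> \<bullet> snd (riesz (f'' (xb, yb) v)) = riesz (f'' (xb, yb) v) \<bullet> (0, \<gamma>)"
      by (simp add: inner_prod_def inner_commute)
    then show ?thesis
      using second_derivative_symmetric[OF W f' f'' f''_continuous] by (simp add: riesz_inner)
  qed
  have "((\<lambda>x. Df (x, yb)) has_derivative (\<lambda>u. riesz (f'' (xb, yb) (u, 0)))) (at xb)"
    by (rule has_derivative_compose[of "\<lambda>x. (x, yb)" "\<lambda>u. (u, 0)" xb UNIV Df "\<lambda>v. riesz (f'' (xb, yb) v)"])
      (auto intro!: derivative_eq_intros D2f)
  then have jac_x: "((\<lambda>x. lagr f g x yb \<mu>) has_derivative (\<lambda>u. snd (riesz (f'' (xb, yb) (u, 0))))) (at xb)"
    unfolding lagr by (auto intro!: derivative_eq_intros)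
  have "((\<lambda>y. Df (xb, y)) has_derivative (\<lambda>u. riesz (f'' (xb, yb) (0, u)))) (at yb)"
    by (rule has_derivative_compose[of "\<lambda>y. (xb, y)" "\<lambda>u. (0, u)" yb UNIV Df "\<lambda>v. riesz (f'' (xb, yb) v)"])
      (auto intro!: derivative_eq_intros D2f)
  then have 1: "((\<lambda>y. snd (Df (xb, y))) has_derivative (\<lambda>v. snd (riesz (f'' (xb, yb) (0, v))))) (at yb)"
    by (rule has_derivative_snd)
  \<comment> \<open>In basis coordinates the adjoint becomes a sum of inner products, which can be
    differentiated in \<open>y\<close> term by term.\<close>
  have adj: "adjoint (blinfun_apply A) \<mu> = (\<Sum>b\<in>Basis. (\<mu> \<bullet> A b) *\<^sub>R b)" for A :: "(real ^ 'm) \<Rightarrow>\<^sub>L (real ^ 'p)"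
    using euclidean_representation[of "adjoint (blinfun_apply A) \<mu>"] by (simp add: adjoint_blinfun_works)
  have "((\<lambda>y. adjoint (g' y) \<mu>) has_derivative (\<lambda>v. adjoint (g'' yb v) \<mu>)) (at yb)"
    unfolding adj
    by (intro has_derivative_sum has_derivative_scaleR_left has_derivative_inner_right
        bounded_linear.has_derivative[OF blinfun.bounded_linear_left g''])
  with 1 have jac_y: "((\<lambda>y. lagr f g xb y \<mu>) has_derivative
      (\<lambda>v. snd (riesz (f'' (xb, yb) (0, v))) + adjoint (g'' yb v) \<mu>)) (at yb)"
    unfolding lagr by (rule has_derivative_add)
  have g''_sym: "\<mu> \<bullet> g'' yb v \<gamma> = \<mu> \<bullet> g'' yb \<gamma> v" for v
    using second_derivative_symmetric_functional[OF open_UNIV UNIV_I g' g'' g''_continuous bounded_linear_inner_right] .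
  have "gradient (\<lambda>x. F (x, yb)) (at xb)
          + transpose (jacobian (\<lambda>x. lagr f g x yb \<mu>) (at xb)) *v \<gamma>
          + transpose (jacobian G (at xb)) *v \<pi> = 0" (is "?E = 0")
  proof -
    have "?E \<bullet> u = 0" for u
      using eq_x[of u] unfolding inner_add_left gradient_fst[OF F_derivative]
        transpose_jacobian_inner[OF jac_x] transpose_jacobian_inner[OF G'] snd_riesz .
    then show ?thesis by (metis inner_eq_zero_iff)
  qed
  moreover have "gradient (\<lambda>y. F (xb, y)) (at yb)
          + transpose (jacobian (\<lambda>y. lagr f g xb y \<mu>) (at yb)) *v \<gamma>
          + transpose (jacobian g (at yb)) *v \<omega> = 0" (is "?E' = 0")
  proof -
    have "?E' \<bullet> v = 0" for v
      using eq_y[of v] g''_sym[of v] adjoint_blinfun_works[of "g'' yb v" \<mu> \<gamma>]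
      unfolding inner_add_left inner_add_right gradient_snd[OF F_derivative]
        transpose_jacobian_inner[OF jac_y] transpose_jacobian_inner[OF g'] snd_riesz
      by (simp add: inner_commute[of \<gamma>])
    then show ?thesis by (metis inner_eq_zero_iff)
  qed
  moreover have "\<mu> \<in> multipliers f g xb yb"
  proof -
    have "lagr f g xb yb \<mu> \<bullet> v = 0" for v
      using \<mu>(3)[of v] by (simp add: lagr inner_add_left adjoint_blinfun_works)
    then have "lagr f g xb yb \<mu> = 0" by (metis inner_eq_zero_iff)
    then show ?thesis using \<mu> xb by (simp add: multipliers_def)
  qed
  moreover have "C2_near (xb, yb) f"
    unfolding C2_near_def C2_on_def C1_on_def using W f' f'' f''_continuous by blast
  moreover have "gradient (\<lambda>y. g y $ i) (at yb) \<bullet> \<gamma> = g' yb \<gamma> $ i" for i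
    by (simp add: gradient_component_inner[OF g'] adjoint_blinfun_works inner_axis')
  ultimately show ?thesis
    unfolding C_stationary_def using yb xb \<pi> I1 I2 I3
    by (intro conjI exI[of _ yb] exI[of _ \<mu>] exI[of _ \<pi>] exI[of _ \<omega>] exI[of _ \<gamma>]) auto
qed

text \<open>Both points have the same first component, so the scaled difference is
  \<open>(0, \<rho> k *\<^sub>R (z k - y k))\<close> and only the direction
  \<open>(0, \<gamma>)\<close> appears.\<close>

lemma Df_increment_limit:
  assumes lim: "x \<longlonglongrightarrow> xb" "y \<longlonglongrightarrow> yb" "z \<longlonglongrightarrow> yb"
    and \<gamma>: "(\<lambda>k. \<rho> k *\<^sub>R (z k - y k)) \<longlonglongrightarrow> \<gamma>"
  shows "(\<lambda>k. \<rho> k *\<^sub>R (Df (x k, z k) - Df (x k, y k))) \<longlonglongrightarrow> riesz (f'' (xb, yb) (0, \<gamma>))"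
proof -
  have xy: "(\<lambda>k. (x k, y k)) \<longlonglongrightarrow> (xb, yb)" "(\<lambda>k. (x k, z k)) \<longlonglongrightarrow> (xb, yb)"
    by (intro tendsto_Pair lim)+
  have "(\<lambda>k. (0, \<rho> k *\<^sub>R (z k - y k))) \<longlonglongrightarrow> (0, \<gamma>)"
    by (intro tendsto_Pair tendsto_const \<gamma>)
  then have "(\<lambda>k. \<rho> k *\<^sub>R ((x k, z k) - (x k, y k))) \<longlonglongrightarrow> (0, \<gamma>)"
    by simp
  from strict_derivative_limit[OF W f'' f''_continuous xy(2,1) this]
  have "(\<lambda>k. \<rho> k *\<^sub>R (f' (x k, z k) - f' (x k, y k))) \<longlonglongrightarrow> f'' (xb, yb) (0, \<gamma>)"
    by simp
  then have "(\<lambda>k. riesz (\<rho> k *\<^sub>R (f' (x k, z k) - f' (x k, y k)))) \<longlonglongrightarrow> riesz (f'' (xb, yb) (0, \<gamma>))"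
    by (rule bounded_linear.tendsto[OF bounded_linear_riesz])
  then show ?thesis
  proof (rule Lim_transform_eventually)
    have "\<forall>\<^sub>F k in sequentially. (x k, y k) \<in> W" "\<forall>\<^sub>F k in sequentially. (x k, z k) \<in> W"
      using topological_tendstoD[OF xy(1) W] topological_tendstoD[OF xy(2) W] .
    then show "\<forall>\<^sub>F k in sequentially. riesz (\<rho> k *\<^sub>R (f' (x k, z k) - f' (x k, y k)))
        = \<rho> k *\<^sub>R (Df (x k, z k) - Df (x k, y k))"
    proof eventually_elim
      case (elim k)
      have "riesz (\<rho> k *\<^sub>R (f' (x k, z k) - f' (x k, y k))) \<bullet> v
          = (\<rho> k *\<^sub>R (Df (x k, z k) - Df (x k, y k))) \<bullet> v" for v
        unfolding riesz_inner blinfun.scaleR_left blinfun.diff_left inner_scaleR_left inner_diff_left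
          Df_eq_f'[OF elim(1)] Df_eq_f'[OF elim(2)] by simp
      then show ?case by (metis vector_eq_rdot)
    qed
  qed
qed

text \<open>Subtracting the two optimality conditions leaves \<open>\<nu>\<close> against the
  difference \<open>B - A\<close>. Multiplying that difference by \<open>r\<close> and dividing
  \<open>\<nu>\<close> by \<open>r\<close> makes both factors bounded along the sequence, although
  \<open>\<nu>\<close> itself need not be.\<close>

lemma multiplier_difference:
  fixes A B :: "(real ^ 'm) \<Rightarrow>\<^sub>L (real ^ 'p)"
  assumes \<eta>: "a - r *\<^sub>R d - p = adjoint A \<eta>" and \<nu>: "- (r *\<^sub>R d') - q = adjoint B \<nu>" and r: "r \<noteq> 0"
  shows "adjoint A (\<nu> - \<eta>) = - (a + r *\<^sub>R (d' - d) + adjoint (blinfun_apply (r *\<^sub>R (B - A))) ((1 / r) *\<^sub>R \<nu>) + q - p)"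
    (is "?l = ?r")
proof -
  have "?l \<bullet> u = ?r \<bullet> u" for u
  proof -
    have "(a - r *\<^sub>R d - p) \<bullet> u = \<eta> \<bullet> A u" "(- (r *\<^sub>R d') - q) \<bullet> u = \<nu> \<bullet> B u"
      unfolding \<eta> \<nu> by (simp_all add: adjoint_blinfun_works)
    moreover have "adjoint (blinfun_apply (r *\<^sub>R (B - A))) ((1 / r) *\<^sub>R \<nu>) \<bullet> u = \<nu> \<bullet> B u - \<nu> \<bullet> A u"
      using r by (simp add: adjoint_blinfun_works blinfun.scaleR_left blinfun.diff_left inner_diff_right
          flip: diff_divide_distrib)
    ultimately show ?thesis
      by (simp add: adjoint_blinfun_works inner_diff_left inner_add_left inner_diff_right algebra_simps)
  qed
  then show ?thesis by (metis vector_eq_rdot)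
qed

lemma tendsto_data:
  assumes "x \<longlonglongrightarrow> xb" "y \<longlonglongrightarrow> yb"
  shows "(\<lambda>k. DF (x k, y k)) \<longlonglongrightarrow> DF (xb, yb)" "(\<lambda>k. Df (x k, y k)) \<longlonglongrightarrow> Df (xb, yb)"
    "(\<lambda>k. g (y k)) \<longlonglongrightarrow> g yb" "(\<lambda>k. G (x k)) \<longlonglongrightarrow> G xb"
    "(\<lambda>k. g' (y k)) \<longlonglongrightarrow> g' yb" "(\<lambda>k. G' (x k)) \<longlonglongrightarrow> G' xb"
proof -
  have cont: "isCont h a" if "continuous_on UNIV h"
    for h :: "'s::t2_space \<Rightarrow> 't::topological_space" and a
    using that by (simp add: continuous_on_eq_continuous_at)
  have xy: "(\<lambda>k. (x k, y k)) \<longlonglongrightarrow> (xb, yb)" by (intro tendsto_Pair assms)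
  show "(\<lambda>k. DF (x k, y k)) \<longlonglongrightarrow> DF (xb, yb)" "(\<lambda>k. Df (x k, y k)) \<longlonglongrightarrow> Df (xb, yb)"
    by (rule isCont_tendsto_compose[OF cont[OF DF_continuous] xy],
        rule isCont_tendsto_compose[OF cont[OF Df_continuous] xy])
  show "(\<lambda>k. g (y k)) \<longlonglongrightarrow> g yb" "(\<lambda>k. G (x k)) \<longlonglongrightarrow> G xb"
    by (rule isCont_tendsto_compose[OF has_derivative_continuous[OF g'] assms(2)],
        rule isCont_tendsto_compose[OF has_derivative_continuous[OF G'] assms(1)])
  show "(\<lambda>k. g' (y k)) \<longlonglongrightarrow> g' yb" "(\<lambda>k. G' (x k)) \<longlonglongrightarrow> G' xb"
    by (rule isCont_tendsto_compose[OF cont[OF g'_continuous] assms(2)],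
        rule isCont_tendsto_compose[OF cont[OF G'_continuous] assms(1)])
qed

text \<open>Each equation comes from one sequence with two limits: continuity and the increment
  limits give its left-hand side, the optimality conditions give \<open>0\<close>. Convergence of
  the multipliers is assumed here and arranged separately.\<close>

lemma limit_equations:
  assumes pess: "yb \<in> pess_sol F f {y. g y \<le> 0} xb"
    and lim: "x \<longlonglongrightarrow> xb" "y \<longlonglongrightarrow> yb" "z \<longlonglongrightarrow> yb"
    and \<rho>: "\<And>k. \<rho> k > 0" "filterlim \<rho> at_top sequentially"
    and \<gamma>: "(\<lambda>k. \<rho> k *\<^sub>R (z k - y k)) \<longlonglongrightarrow> \<gamma>"
    and pq: "p \<longlonglongrightarrow> 0" "q \<longlonglongrightarrow> 0"
    and feasible: "\<And>k. G (x k) \<le> 0" "\<And>k. g (y k) \<le> 0" "\<And>k. g (z k) \<le> 0"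
    and v: "(\<lambda>k. fst (DF (x k, y k)) - \<rho> k *\<^sub>R fst (Df (x k, y k)) + \<rho> k *\<^sub>R fst (Df (x k, z k)) + v k) \<longlonglongrightarrow> 0"
    and \<pi>: "\<forall>\<^sub>F k in sequentially. 0 \<le> \<pi> k \<and> \<pi> k \<bullet> G xb = 0 \<and> v k = adjoint (G' (x k)) (\<pi> k)"
    and \<eta>: "\<forall>\<^sub>F k in sequentially. 0 \<le> \<eta> k \<and> \<eta> k \<bullet> g (y k) = 0 \<and> \<eta> k \<bullet> g yb = 0 \<and>
      snd (DF (x k, y k)) - \<rho> k *\<^sub>R snd (Df (x k, y k)) - p k = adjoint (g' (y k)) (\<eta> k)"
    and \<nu>: "\<forall>\<^sub>F k in sequentially. 0 \<le> \<nu> k \<and> \<nu> k \<bullet> g (z k) = 0 \<and> \<nu> k \<bullet> g yb = 0 \<and>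
      - (\<rho> k *\<^sub>R snd (Df (x k, z k))) - q k = adjoint (g' (z k)) (\<nu> k)"
    and limits: "(\<lambda>k. (1 / \<rho> k) *\<^sub>R \<nu> k) \<longlonglongrightarrow> \<mu>" "(\<lambda>k. \<nu> k - \<eta> k) \<longlonglongrightarrow> \<omega>" "\<pi> \<longlonglongrightarrow> \<pi>b"
  shows "C_stationary F f G g xb"
proof -
  note ty = tendsto_data[OF lim(1,2)] and tz = tendsto_data[OF lim(1,3)]
  have inv: "(\<lambda>k. 1 / \<rho> k) \<longlonglongrightarrow> 0"
    using tendsto_inverse_0_at_top[OF \<rho>(2)] by (simp add: inverse_eq_divide)
  have le_0: "h \<le> 0" if "\<And>k. u k \<le> 0" "u \<longlonglongrightarrow> h" for u :: "nat \<Rightarrow> real ^ 'k" and h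
    unfolding less_eq_vec_def
    using LIMSEQ_le_const2[OF tendsto_vec_nth[OF that(2)]] that(1) by (auto simp: less_eq_vec_def)
  have ge_0: "0 \<le> h" if "\<forall>\<^sub>F k in sequentially. 0 \<le> u k" "u \<longlonglongrightarrow> h" for u :: "nat \<Rightarrow> real ^ 'k" and h
    unfolding less_eq_vec_def
  proof
    fix i
    have "\<forall>\<^sub>F k in sequentially. 0 \<le> u k $ i"
      using that(1) by eventually_elim (simp add: less_eq_vec_def)
    then show "0 $ i \<le> h $ i"
      using tendsto_lowerbound[OF tendsto_vec_nth[OF that(2)]] by simp
  qed
  note feas = le_0[OF feasible(1) ty(4)] le_0[OF feasible(2) ty(3)]
  have DDf: "(\<lambda>k. \<rho> k *\<^sub>R (Df (x k, z k) - Df (x k, y k))) \<longlonglongrightarrow> riesz (f'' (xb, yb) (0, \<gamma>))"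
    by (rule Df_increment_limit[OF lim \<gamma>])
  have Dg': "(\<lambda>k. \<rho> k *\<^sub>R (g' (z k) - g' (y k))) \<longlonglongrightarrow> g'' yb \<gamma>"
    by (rule strict_derivative_limit[OF open_UNIV UNIV_I g'' g''_continuous lim(3,2) \<gamma>])
  have Dg: "(\<lambda>k. \<rho> k *\<^sub>R (g (z k) - g (y k))) \<longlonglongrightarrow> g' yb \<gamma>"
    by (rule strict_derivative_limit[OF open_UNIV UNIV_I g' g'_continuous lim(3,2) \<gamma>])
  \<comment> \<open>\<open>\<nu> - \<eta>\<close> converges, so it vanishes after division by
    \<open>\<rho>\<close>.\<close>
  have \<mu>': "(\<lambda>k. (1 / \<rho> k) *\<^sub>R \<eta> k) \<longlonglongrightarrow> \<mu>"
  proof -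
    have "(\<lambda>k. (1 / \<rho> k) *\<^sub>R \<nu> k - (1 / \<rho> k) *\<^sub>R (\<nu> k - \<eta> k)) \<longlonglongrightarrow> \<mu> - 0 *\<^sub>R \<omega>"
      by (intro tendsto_diff tendsto_scaleR limits inv)
    then show ?thesis by (simp add: scaleR_diff_right)
  qed
  show ?thesis
  proof (rule C_stationaryI[OF pess feas])
    show "0 \<le> \<mu>"
      by (rule ge_0[OF _ limits(1)])
        (use \<nu> in eventually_elim, simp add: less_eq_vec_def less_imp_le[OF \<rho>(1)])
    have "(\<lambda>k. ((1 / \<rho> k) *\<^sub>R \<nu> k) \<bullet> g yb) \<longlonglongrightarrow> \<mu> \<bullet> g yb"
      by (intro tendsto_intros limits)
    moreover have "(\<lambda>k. ((1 / \<rho> k) *\<^sub>R \<nu> k) \<bullet> g yb) \<longlonglongrightarrow> 0"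
      by (rule tendsto_eventually) (use \<nu> in eventually_elim, simp)
    ultimately show "\<mu> \<bullet> g yb = 0" by (rule LIMSEQ_unique)
    show "snd (Df (xb, yb)) \<bullet> w + \<mu> \<bullet> g' yb w = 0" for w
    proof (rule LIMSEQ_unique)
      show "(\<lambda>k. snd (Df (x k, z k)) \<bullet> w + ((1 / \<rho> k) *\<^sub>R \<nu> k) \<bullet> g' (z k) w)
          \<longlonglongrightarrow> snd (Df (xb, yb)) \<bullet> w + \<mu> \<bullet> g' yb w"
        by (intro tendsto_intros limits tz)
      have "(\<lambda>k. - ((1 / \<rho> k) * (q k \<bullet> w))) \<longlonglongrightarrow> - (0 * (0 \<bullet> w))"
        by (intro tendsto_minus tendsto_mult inv tendsto_inner pq tendsto_const)
      then show "(\<lambda>k. snd (Df (x k, z k)) \<bullet> w + ((1 / \<rho> k) *\<^sub>R \<nu> k) \<bullet> g' (z k) w) \<longlonglongrightarrow> 0"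
        unfolding mult_zero_left minus_zero
      proof (rule Lim_transform_eventually)
        show "\<forall>\<^sub>F k in sequentially. - ((1 / \<rho> k) * (q k \<bullet> w))
            = snd (Df (x k, z k)) \<bullet> w + ((1 / \<rho> k) *\<^sub>R \<nu> k) \<bullet> g' (z k) w"
          using \<nu>
        proof eventually_elim
          case (elim k)
          then have "(- (\<rho> k *\<^sub>R snd (Df (x k, z k))) - q k) \<bullet> w = \<nu> k \<bullet> g' (z k) w"
            by (simp add: adjoint_blinfun_works)
          then show ?case
            using \<rho>(1)[of k] by (simp add: inner_diff_left field_simps)
        qed
      qed
    qed
    show "fst (DF (xb, yb)) \<bullet> u + f'' (xb, yb) (0, \<gamma>) (u, 0) + \<pi>b \<bullet> G' xb u = 0" for u
    proof (rule LIMSEQ_unique)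
      show "(\<lambda>k. fst (DF (x k, y k)) \<bullet> u + (\<rho> k *\<^sub>R (Df (x k, z k) - Df (x k, y k))) \<bullet> (u, 0) + \<pi> k \<bullet> G' (x k) u)
         \<longlonglongrightarrow> fst (DF (xb, yb)) \<bullet> u + f'' (xb, yb) (0, \<gamma>) (u, 0) + \<pi>b \<bullet> G' xb u"
        unfolding riesz_inner[symmetric] by (intro tendsto_intros ty DDf limits)
      have "(\<lambda>k. (fst (DF (x k, y k)) - \<rho> k *\<^sub>R fst (Df (x k, y k)) + \<rho> k *\<^sub>R fst (Df (x k, z k)) + v k) \<bullet> u) \<longlonglongrightarrow> 0 \<bullet> u"
        by (intro tendsto_inner v tendsto_const)
      then show "(\<lambda>k. fst (DF (x k, y k)) \<bullet> u + (\<rho> k *\<^sub>R (Df (x k, z k) - Df (x k, y k))) \<bullet> (u, 0) + \<pi> k \<bullet> G' (x k) u) \<longlonglongrightarrow> 0"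
        unfolding inner_zero_left
        by (rule Lim_transform_eventually)
          (use \<pi> in eventually_elim, simp add: inner_prod_def inner_diff_left inner_add_left adjoint_blinfun_works algebra_simps)
    qed
    show "snd (DF (xb, yb)) \<bullet> w + f'' (xb, yb) (0, \<gamma>) (0, w) + \<mu> \<bullet> g'' yb \<gamma> w + \<omega> \<bullet> g' yb w = 0" for w
    proof (rule LIMSEQ_unique)
      show "(\<lambda>k. snd (DF (x k, y k)) \<bullet> w + (\<rho> k *\<^sub>R (Df (x k, z k) - Df (x k, y k))) \<bullet> (0, w)
          + ((1 / \<rho> k) *\<^sub>R \<nu> k) \<bullet> (\<rho> k *\<^sub>R (g' (z k) - g' (y k))) w + (\<nu> k - \<eta> k) \<bullet> g' (y k) w)
         \<longlonglongrightarrow> snd (DF (xb, yb)) \<bullet> w + f'' (xb, yb) (0, \<gamma>) (0, w) + \<mu> \<bullet> g'' yb \<gamma> w + \<omega> \<bullet> g' yb w"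
        unfolding riesz_inner[symmetric]
        by (intro tendsto_add tendsto_inner tendsto_const tendsto_snd ty DDf limits
            bounded_linear.tendsto[OF blinfun.bounded_linear_left] Dg')
      have "(\<lambda>k. (p k - q k) \<bullet> w) \<longlonglongrightarrow> (0 - 0) \<bullet> w"
        by (intro tendsto_intros pq)
      then show "(\<lambda>k. snd (DF (x k, y k)) \<bullet> w + (\<rho> k *\<^sub>R (Df (x k, z k) - Df (x k, y k))) \<bullet> (0, w)
          + ((1 / \<rho> k) *\<^sub>R \<nu> k) \<bullet> (\<rho> k *\<^sub>R (g' (z k) - g' (y k))) w + (\<nu> k - \<eta> k) \<bullet> g' (y k) w) \<longlonglongrightarrow> 0"
        unfolding diff_self inner_zero_left
      proof (rule Lim_transform_eventually)
        show "\<forall>\<^sub>F k in sequentially. (p k - q k) \<bullet> w = snd (DF (x k, y k)) \<bullet> w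
          + (\<rho> k *\<^sub>R (Df (x k, z k) - Df (x k, y k))) \<bullet> (0, w)
          + ((1 / \<rho> k) *\<^sub>R \<nu> k) \<bullet> (\<rho> k *\<^sub>R (g' (z k) - g' (y k))) w + (\<nu> k - \<eta> k) \<bullet> g' (y k) w"
          using \<eta> \<nu>
        proof eventually_elim
          case (elim k)
          have "adjoint (g' (y k)) (\<nu> k - \<eta> k) \<bullet> w = - (snd (DF (x k, y k)) + \<rho> k *\<^sub>R (snd (Df (x k, z k)) - snd (Df (x k, y k)))
              + adjoint (blinfun_apply (\<rho> k *\<^sub>R (g' (z k) - g' (y k)))) ((1 / \<rho> k) *\<^sub>R \<nu> k) + q k - p k) \<bullet> w"
            using elim \<rho>(1)[of k] by (subst multiplier_difference) auto
          then show ?case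
            unfolding adjoint_blinfun_works inner_minus_left inner_add_left inner_diff_left
            by (simp add: inner_prod_def)
        qed
      qed
    qed
    show "0 \<le> \<pi>b" by (rule ge_0[OF _ limits(3)]) (use \<pi> in eventually_elim, simp)
    have "(\<lambda>k. \<pi> k \<bullet> G xb) \<longlonglongrightarrow> \<pi>b \<bullet> G xb" by (intro tendsto_intros limits)
    moreover have "(\<lambda>k. \<pi> k \<bullet> G xb) \<longlonglongrightarrow> 0"
      by (rule tendsto_eventually) (use \<pi> in eventually_elim, simp)
    ultimately show "\<pi>b \<bullet> G xb = 0" by (rule LIMSEQ_unique)
    show "\<omega> $ i = 0" if "g yb $ i < 0" for i
    proof (rule LIMSEQ_unique)
      show "(\<lambda>k. (\<nu> k - \<eta> k) $ i) \<longlonglongrightarrow> \<omega> $ i" by (intro tendsto_intros limits)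
      show "(\<lambda>k. (\<nu> k - \<eta> k) $ i) \<longlonglongrightarrow> 0"
      proof (rule tendsto_eventually)
        show "\<forall>\<^sub>F k in sequentially. (\<nu> k - \<eta> k) $ i = 0"
          using \<eta> \<nu>
        proof eventually_elim
          case (elim k)
          then have "\<nu> k $ i * g yb $ i = 0" "\<eta> k $ i * g yb $ i = 0"
            using complementary_component[OF _ feas(2)] by blast+
          then show ?case using that by simp
        qed
      qed
    qed
    \<comment> \<open>A positive limit makes both multipliers eventually positive, so by
      complementarity constraint \<open>i\<close> vanishes at both \<open>y k\<close> and
      \<open>z k\<close>, and its scaled increment is \<open>0\<close>.\<close>
    show "g' yb \<gamma> $ i = 0" if "\<mu> $ i > 0" for i
    proof (rule LIMSEQ_unique)
      show "(\<lambda>k. (\<rho> k *\<^sub>R (g (z k) - g (y k))) $ i) \<longlonglongrightarrow> g' yb \<gamma> $ i" by (intro tendsto_vec_nth Dg)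
      have "\<forall>\<^sub>F k in sequentially. ((1 / \<rho> k) *\<^sub>R \<nu> k) $ i > 0" "\<forall>\<^sub>F k in sequentially. ((1 / \<rho> k) *\<^sub>R \<eta> k) $ i > 0"
        using order_tendstoD(1)[OF tendsto_vec_nth[OF limits(1)] that]
          order_tendstoD(1)[OF tendsto_vec_nth[OF \<mu>'] that] .
      then have "\<forall>\<^sub>F k in sequentially. (\<rho> k *\<^sub>R (g (z k) - g (y k))) $ i = 0"
        using \<eta> \<nu>
      proof eventually_elim
        case (elim k)
        then have "\<nu> k $ i * g (z k) $ i = 0" "\<eta> k $ i * g (y k) $ i = 0"
          using complementary_component feasible by blast+
        moreover have "\<nu> k $ i \<noteq> 0" "\<eta> k $ i \<noteq> 0" using elim by auto
        ultimately show ?case by simp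
      qed
      then show "(\<lambda>k. (\<rho> k *\<^sub>R (g (z k) - g (y k))) $ i) \<longlonglongrightarrow> 0" by (rule tendsto_eventually)
    qed
    show "0 \<le> \<omega> $ i * (g' yb \<gamma> $ i)" for i
    proof (rule tendsto_lowerbound)
      show "(\<lambda>k. (\<nu> k - \<eta> k) $ i * (\<rho> k *\<^sub>R (g (z k) - g (y k))) $ i) \<longlonglongrightarrow> \<omega> $ i * (g' yb \<gamma> $ i)"
        by (intro tendsto_mult tendsto_vec_nth limits Dg)
      show "\<forall>\<^sub>F k in sequentially. 0 \<le> (\<nu> k - \<eta> k) $ i * (\<rho> k *\<^sub>R (g (z k) - g (y k))) $ i"
        using \<eta> \<nu>
      proof eventually_elim
        case (elim k)
        then have 0: "\<nu> k $ i * g (z k) $ i = 0" "\<eta> k $ i * g (y k) $ i = 0"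
          using complementary_component feasible by blast+
        have "0 \<le> \<nu> k $ i" "0 \<le> \<eta> k $ i" "g (y k) $ i \<le> 0" "g (z k) $ i \<le> 0"
          using elim feasible by (auto simp: less_eq_vec_def)
        then have "\<nu> k $ i * g (y k) $ i \<le> 0" "\<eta> k $ i * g (z k) $ i \<le> 0"
          by (auto simp: mult_nonneg_nonpos)
        \<comment> \<open>Products of a multiplier with the constraint at its own point vanish by
          complementarity; the mixed ones are nonpositive and enter with a minus.\<close>
        then have "0 \<le> \<rho> k * (\<nu> k $ i * g (z k) $ i - \<nu> k $ i * g (y k) $ i - \<eta> k $ i * g (z k) $ i + \<eta> k $ i * g (y k) $ i)"
          using \<rho>(1)[of k] 0 by (intro mult_nonneg_nonneg) auto
        then show ?case by (simp add: algebra_simps)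
      qed
    qed simp
  qed
qed

text \<open>The point is boundedness of three multiplier sequences: \<open>\<pi>\<close> through the
  residual in \<open>x\<close>, \<open>\<nu> / \<rho>\<close> through the condition at
  \<open>z\<close> divided by \<open>\<rho>\<close>, and \<open>\<nu> - \<eta>\<close> through the
  difference of the two lower-level conditions.\<close>

lemma C_stationary_limit:
  assumes pess: "yb \<in> pess_sol F f {y. g y \<le> 0} xb"
    and lim: "x \<longlonglongrightarrow> xb" "y \<longlonglongrightarrow> yb" "z \<longlonglongrightarrow> yb"
    and \<rho>: "\<And>k. \<rho> k > 0" "filterlim \<rho> at_top sequentially"
    and \<gamma>: "(\<lambda>k. \<rho> k *\<^sub>R (z k - y k)) \<longlonglongrightarrow> \<gamma>"
    and pq: "p \<longlonglongrightarrow> 0" "q \<longlonglongrightarrow> 0"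
    and feasible: "\<And>k. G (x k) \<le> 0" "\<And>k. g (y k) \<le> 0" "\<And>k. g (z k) \<le> 0"
    and v: "(\<lambda>k. fst (DF (x k, y k)) - \<rho> k *\<^sub>R fst (Df (x k, y k)) + \<rho> k *\<^sub>R fst (Df (x k, z k)) + v k) \<longlonglongrightarrow> 0"
    and cone_x: "\<And>k. v k \<in> normal_cone {x. G x \<le> 0} (x k)"
    and cone_y: "\<And>k. snd (DF (x k, y k)) - \<rho> k *\<^sub>R snd (Df (x k, y k)) - p k \<in> normal_cone {y. g y \<le> 0} (y k)"
    and cone_z: "\<And>k. - (\<rho> k *\<^sub>R snd (Df (x k, z k))) - q k \<in> normal_cone {y. g y \<le> 0} (z k)"
    and MFCQ: "upper_MFCQ G xb" and LICQ: "lower_LICQ g yb"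
  shows "C_stationary F f G g xb"
proof -
  note ty = tendsto_data[OF lim(1,2)] and tz = tendsto_data[OF lim(1,3)]
  have inv: "(\<lambda>k. 1 / \<rho> k) \<longlonglongrightarrow> 0"
    using tendsto_inverse_0_at_top[OF \<rho>(2)] by (simp add: inverse_eq_divide)
  have DDf: "(\<lambda>k. \<rho> k *\<^sub>R (Df (x k, z k) - Df (x k, y k))) \<longlonglongrightarrow> riesz (f'' (xb, yb) (0, \<gamma>))"
    by (rule Df_increment_limit[OF lim \<gamma>])
  have Dg': "(\<lambda>k. \<rho> k *\<^sub>R (g' (z k) - g' (y k))) \<longlonglongrightarrow> g'' yb \<gamma>"
    by (rule strict_derivative_limit[OF open_UNIV UNIV_I g'' g''_continuous lim(3,2) \<gamma>])
  define KX where "KX = {p. 0 \<le> p \<and> p \<bullet> G xb = 0}"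
  \<comment> \<open>A linear subspace instead of a cone of nonnegative vectors, because it has to
    contain \<open>\<nu> k - \<eta> k\<close>; LICQ gives injectivity even there.\<close>
  define KY :: "(real ^ 'p) set" where "KY = {p. \<forall>i. g yb $ i \<noteq> 0 \<longrightarrow> p $ i = 0}"
  have g_yb: "g yb \<le> 0"
    unfolding less_eq_vec_def using LIMSEQ_le_const2[OF tendsto_vec_nth[OF ty(3)]] feasible(2)
    by (auto simp: less_eq_vec_def)
  have "closed {p::real^'q. 0 \<le> p}"
    unfolding less_eq_vec_def by (intro closed_Collect_all closed_Collect_le continuous_intros)
  then have KX: "closed KX" "conic KX"
    unfolding KX_def by (intro closed_Collect_conj closed_Collect_eq continuous_intros)
      (auto simp: conic_def less_eq_vec_def)
  have KY: "closed KY" "conic KY"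
    unfolding KY_def by (intro closed_Collect_all closed_Collect_imp open_Collect_const closed_Collect_eq continuous_intros)
      (auto simp: conic_def)
  have KY_diff: "p - p' \<in> KY" if "p \<in> KY" "p' \<in> KY" for p p'
    using that by (auto simp: KY_def)
  have KY_mult: "p \<in> KY" if "0 \<le> p" "p \<bullet> g yb = 0" for p
    using that complementary_component[OF that(1) g_yb] by (auto simp: KY_def)
  have KX_mult: "p \<in> KX" if "0 \<le> p" "p \<bullet> G xb = 0" for p
    using that by (simp add: KX_def)
  have injX: "p = 0" if "p \<in> KX" "adjoint (G' xb) p = 0" for p
    using MFCQ that unfolding upper_MFCQ_def jacobian_transpose_eq_adjoint[OF G'] KX_def by blast
  have injY: "p = 0" if "p \<in> KY" "adjoint (g' yb) p = 0" for p
    using LICQ_injective[OF g' LICQ] that by (auto simp: KY_def)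
  obtain c where c: "c > 0" "\<forall>\<^sub>F k in sequentially. (\<forall>p\<in>KX. c * norm p \<le> norm (adjoint (G' (x k)) p)) \<and>
      (\<forall>v\<in>normal_cone {x. G x \<le> 0} (x k). \<exists>p\<in>KX. 0 \<le> p \<and> p \<bullet> G (x k) = 0 \<and> p \<bullet> G xb = 0 \<and> v = adjoint (G' (x k)) p)"
    by (rule normal_cone_multipliers_near[OF G' G'_continuous KX KX_mult injX lim(1) feasible(1)])
  obtain cy where cy: "cy > 0" "\<forall>\<^sub>F k in sequentially. (\<forall>p\<in>KY. cy * norm p \<le> norm (adjoint (g' (y k)) p)) \<and>
      (\<forall>v\<in>normal_cone {y. g y \<le> 0} (y k). \<exists>p\<in>KY. 0 \<le> p \<and> p \<bullet> g (y k) = 0 \<and> p \<bullet> g yb = 0 \<and> v = adjoint (g' (y k)) p)"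
    by (rule normal_cone_multipliers_near[OF g' g'_continuous KY KY_mult injY lim(2) feasible(2)])
  obtain cz where cz: "cz > 0" "\<forall>\<^sub>F k in sequentially. (\<forall>p\<in>KY. cz * norm p \<le> norm (adjoint (g' (z k)) p)) \<and>
      (\<forall>v\<in>normal_cone {y. g y \<le> 0} (z k). \<exists>p\<in>KY. 0 \<le> p \<and> p \<bullet> g (z k) = 0 \<and> p \<bullet> g yb = 0 \<and> v = adjoint (g' (z k)) p)"
    by (rule normal_cone_multipliers_near[OF g' g'_continuous KY KY_mult injY lim(3) feasible(3)])
  have "\<forall>\<^sub>F k in sequentially. \<exists>p. p \<in> KX \<and> v k = adjoint (G' (x k)) p"
    using c(2) by eventually_elim (use cone_x in blast)
  then obtain \<pi> where \<pi>: "\<forall>\<^sub>F k in sequentially. \<pi> k \<in> KX \<and> v k = adjoint (G' (x k)) (\<pi> k)"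
    by (rule eventually_choice)
  have "\<forall>\<^sub>F k in sequentially. \<exists>p'. p' \<in> KY \<and> 0 \<le> p' \<and> p' \<bullet> g (y k) = 0 \<and> p' \<bullet> g yb = 0 \<and>
      snd (DF (x k, y k)) - \<rho> k *\<^sub>R snd (Df (x k, y k)) - p k = adjoint (g' (y k)) p'"
    using cy(2) by eventually_elim (use cone_y in blast)
  then obtain \<eta> where \<eta>: "\<forall>\<^sub>F k in sequentially. \<eta> k \<in> KY \<and> 0 \<le> \<eta> k \<and> \<eta> k \<bullet> g (y k) = 0 \<and> \<eta> k \<bullet> g yb = 0 \<and>
      snd (DF (x k, y k)) - \<rho> k *\<^sub>R snd (Df (x k, y k)) - p k = adjoint (g' (y k)) (\<eta> k)"
    by (rule eventually_choice)
  have "\<forall>\<^sub>F k in sequentially. \<exists>p'. p' \<in> KY \<and> 0 \<le> p' \<and> p' \<bullet> g (z k) = 0 \<and> p' \<bullet> g yb = 0 \<and>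
      - (\<rho> k *\<^sub>R snd (Df (x k, z k))) - q k = adjoint (g' (z k)) p'"
    using cz(2) by eventually_elim (use cone_z in blast)
  then obtain \<nu> where \<nu>: "\<forall>\<^sub>F k in sequentially. \<nu> k \<in> KY \<and> 0 \<le> \<nu> k \<and> \<nu> k \<bullet> g (z k) = 0 \<and> \<nu> k \<bullet> g yb = 0 \<and>
      - (\<rho> k *\<^sub>R snd (Df (x k, z k))) - q k = adjoint (g' (z k)) (\<nu> k)"
    by (rule eventually_choice)
  \<comment> \<open>The large factor \<open>\<rho>\<close> occurs in the residual only together with
    an increment of \<open>Df\<close>, and that product converges; hence \<open>v\<close> converges
    as well.\<close>
  have "Bseq \<pi>"
  proof (rule Bseq_of_lower_bound[OF c(1)])
    show "\<forall>\<^sub>F k in sequentially. c * norm (\<pi> k) \<le> norm (v k)"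
      using c(2) \<pi> by eventually_elim auto
    have "(\<lambda>k. (fst (DF (x k, y k)) - \<rho> k *\<^sub>R fst (Df (x k, y k)) + \<rho> k *\<^sub>R fst (Df (x k, z k)) + v k)
        - fst (DF (x k, y k)) - fst (\<rho> k *\<^sub>R (Df (x k, z k) - Df (x k, y k)))) \<longlonglongrightarrow>
        0 - fst (DF (xb, yb)) - fst (riesz (f'' (xb, yb) (0, \<gamma>)))"
      by (intro tendsto_diff tendsto_fst v ty DDf)
    then have "v \<longlonglongrightarrow> 0 - fst (DF (xb, yb)) - fst (riesz (f'' (xb, yb) (0, \<gamma>)))"
      by (simp add: scaleR_diff_right)
    then show "Bseq v" by (intro convergent_imp_Bseq convergentI)
  qed
  have \<theta>: "Bseq (\<lambda>k. (1 / \<rho> k) *\<^sub>R \<nu> k)"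
  proof (rule Bseq_of_lower_bound[OF cz(1)])
    show "\<forall>\<^sub>F k in sequentially. cz * norm ((1 / \<rho> k) *\<^sub>R \<nu> k) \<le> norm (- snd (Df (x k, z k)) - (1 / \<rho> k) *\<^sub>R q k)"
      using cz(2) \<nu>
    proof eventually_elim
      case (elim k)
      then have "cz * norm (\<nu> k) \<le> norm (- (\<rho> k *\<^sub>R snd (Df (x k, z k))) - q k)" by simp
      then have "(1 / \<rho> k) * (cz * norm (\<nu> k)) \<le> (1 / \<rho> k) * norm (- (\<rho> k *\<^sub>R snd (Df (x k, z k))) - q k)"
        using \<rho>(1)[of k] by (intro mult_left_mono) auto
      also have "\<dots> = norm ((1 / \<rho> k) *\<^sub>R (- (\<rho> k *\<^sub>R snd (Df (x k, z k))) - q k))"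
        using \<rho>(1)[of k] by simp
      also have "(1 / \<rho> k) *\<^sub>R (- (\<rho> k *\<^sub>R snd (Df (x k, z k))) - q k) = - snd (Df (x k, z k)) - (1 / \<rho> k) *\<^sub>R q k"
        using \<rho>(1)[of k] by (simp add: scaleR_diff_right)
      finally show ?case using \<rho>(1)[of k] by (simp add: mult.left_commute)
    qed
    have "(\<lambda>k. - snd (Df (x k, z k)) - (1 / \<rho> k) *\<^sub>R q k) \<longlonglongrightarrow> - snd (Df (xb, yb)) - 0 *\<^sub>R 0"
      by (intro tendsto_diff tendsto_minus tendsto_snd tz tendsto_scaleR inv pq)
    then show "Bseq (\<lambda>k. - snd (Df (x k, z k)) - (1 / \<rho> k) *\<^sub>R q k)"
      by (intro convergent_imp_Bseq convergentI)
  qed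
  have \<omega>: "Bseq (\<lambda>k. \<nu> k - \<eta> k)"
  proof (rule Bseq_of_lower_bound[OF cy(1)])
    \<comment> \<open>\<open>E\<close> converges, whereas \<open>R\<close> is merely bounded, as the
      scaled increment of \<open>g'\<close> applied to the bounded sequence
      \<open>\<nu> / \<rho>\<close>.\<close>
    define E where "E k = snd (DF (x k, y k)) + snd (\<rho> k *\<^sub>R (Df (x k, z k) - Df (x k, y k))) + q k - p k" for k
    define R where "R k = adjoint (blinfun_apply (\<rho> k *\<^sub>R (g' (z k) - g' (y k)))) ((1 / \<rho> k) *\<^sub>R \<nu> k)" for k
    show "\<forall>\<^sub>F k in sequentially. cy * norm (\<nu> k - \<eta> k) \<le> norm (E k + R k)"
      using cy(2) \<eta> \<nu>
    proof eventually_elim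
      case (elim k)
      have "adjoint (g' (y k)) (\<nu> k - \<eta> k) = - (snd (DF (x k, y k)) + \<rho> k *\<^sub>R (snd (Df (x k, z k)) - snd (Df (x k, y k)))
              + R k + q k - p k)"
        unfolding R_def using elim \<rho>(1)[of k] by (intro multiplier_difference) auto
      also have "\<dots> = - (E k + R k)" by (simp add: E_def algebra_simps)
      finally have "norm (adjoint (g' (y k)) (\<nu> k - \<eta> k)) = norm (E k + R k)"
        by (simp only: norm_minus_cancel)
      moreover have "cy * norm (\<nu> k - \<eta> k) \<le> norm (adjoint (g' (y k)) (\<nu> k - \<eta> k))"
        using elim KY_diff by blast
      ultimately show ?case by simp
    qed
    have "E \<longlonglongrightarrow> snd (DF (xb, yb)) + snd (riesz (f'' (xb, yb) (0, \<gamma>))) + 0 - 0"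
      unfolding E_def by (intro tendsto_add tendsto_diff tendsto_snd ty DDf pq)
    then have "Bseq E" by (intro convergent_imp_Bseq convergentI)
    then obtain A where A: "\<And>k. norm (E k) \<le> A" unfolding Bseq_def by auto
    have "Bseq (\<lambda>k. \<rho> k *\<^sub>R (g' (z k) - g' (y k)))"
      using Dg' by (intro convergent_imp_Bseq convergentI)
    then obtain B where B: "\<And>k. norm (\<rho> k *\<^sub>R (g' (z k) - g' (y k))) \<le> B" unfolding Bseq_def by auto
    obtain C where C: "\<And>k. norm ((1 / \<rho> k) *\<^sub>R \<nu> k) \<le> C" using \<theta> unfolding Bseq_def by auto
    show "Bseq (\<lambda>k. E k + R k)"
    proof (rule BseqI')
      fix k
      have "norm (R k) \<le> norm (\<rho> k *\<^sub>R (g' (z k) - g' (y k))) * norm ((1 / \<rho> k) *\<^sub>R \<nu> k)"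
        unfolding R_def by (rule norm_adjoint_blinfun_le)
      also have "\<dots> \<le> B * C"
        by (rule mult_mono[OF B C order_trans[OF norm_ge_zero B[of k]] norm_ge_zero])
      finally show "norm (E k + R k) \<le> A + B * C"
        using norm_triangle_ineq[of "E k" "R k"] A[of k] by linarith
    qed
  qed
  \<comment> \<open>Bundled into one vector so that a single subsequence serves all three
    sequences.\<close>
  define u where "u k = ((1 / \<rho> k) *\<^sub>R \<nu> k, \<nu> k - \<eta> k, \<pi> k)" for k
  have "Bseq u" unfolding u_def by (intro Bseq_Pair \<theta> \<omega> \<open>Bseq \<pi>\<close>)
  then have "bounded (range u)" by (simp add: Bseq_eq_bounded)
  then obtain s l where s: "strict_mono s" "(u \<circ> s) \<longlonglongrightarrow> l"
    using bounded_imp_convergent_subsequence by blast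
  obtain \<mu> \<omega> \<pi>b where l: "l = (\<mu>, \<omega>, \<pi>b)" by (cases l) auto
  have s_lim: "(\<lambda>k. (1 / \<rho> (s k)) *\<^sub>R \<nu> (s k)) \<longlonglongrightarrow> \<mu>" "(\<lambda>k. \<nu> (s k) - \<eta> (s k)) \<longlonglongrightarrow> \<omega>" "(\<lambda>k. \<pi> (s k)) \<longlonglongrightarrow> \<pi>b"
    using tendsto_fst[OF s(2)] tendsto_fst[OF tendsto_snd[OF s(2)]] tendsto_snd[OF tendsto_snd[OF s(2)]]
    by (simp_all add: l u_def o_def)
  have fs: "filterlim s sequentially sequentially" using s(1) by (rule filterlim_subseq)
  note ev = eventually_compose_filterlim[OF _ fs]
  show ?thesis
  proof (rule limit_equations[OF pess _ _ _ _ _ _ _ _ _ _ _ _ _ _ _ s_lim])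
    show "(\<lambda>k. x (s k)) \<longlonglongrightarrow> xb" "(\<lambda>k. y (s k)) \<longlonglongrightarrow> yb" "(\<lambda>k. z (s k)) \<longlonglongrightarrow> yb"
      "filterlim (\<lambda>k. \<rho> (s k)) at_top sequentially" "(\<lambda>k. \<rho> (s k) *\<^sub>R (z (s k) - y (s k))) \<longlonglongrightarrow> \<gamma>"
      "(\<lambda>k. p (s k)) \<longlonglongrightarrow> 0" "(\<lambda>k. q (s k)) \<longlonglongrightarrow> 0"
      "(\<lambda>k. fst (DF (x (s k), y (s k))) - \<rho> (s k) *\<^sub>R fst (Df (x (s k), y (s k)))
          + \<rho> (s k) *\<^sub>R fst (Df (x (s k), z (s k))) + v (s k)) \<longlonglongrightarrow> 0"
      using lim \<rho>(2) \<gamma> pq v by (auto intro: filterlim_compose[OF _ fs])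
    show "\<forall>\<^sub>F k in sequentially. 0 \<le> \<pi> (s k) \<and> \<pi> (s k) \<bullet> G xb = 0 \<and> v (s k) = adjoint (G' (x (s k))) (\<pi> (s k))"
      by (rule ev, use \<pi> in eventually_elim) (auto simp: KX_def)
    show "\<forall>\<^sub>F k in sequentially. 0 \<le> \<eta> (s k) \<and> \<eta> (s k) \<bullet> g (y (s k)) = 0 \<and> \<eta> (s k) \<bullet> g yb = 0 \<and>
      snd (DF (x (s k), y (s k))) - \<rho> (s k) *\<^sub>R snd (Df (x (s k), y (s k))) - p (s k) = adjoint (g' (y (s k))) (\<eta> (s k))"
      by (rule ev, use \<eta> in eventually_elim) blast
    show "\<forall>\<^sub>F k in sequentially. 0 \<le> \<nu> (s k) \<and> \<nu> (s k) \<bullet> g (z (s k)) = 0 \<and> \<nu> (s k) \<bullet> g yb = 0 \<and>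
      - (\<rho> (s k) *\<^sub>R snd (Df (x (s k), z (s k)))) - q (s k) = adjoint (g' (z (s k))) (\<nu> (s k))"
      by (rule ev, use \<nu> in eventually_elim) blast
  qed (use \<rho>(1) feasible in auto)
qed

end

section \<open>The accumulation point: lower-level optimality, maximality and stationarity\<close>

theorem theorem4:
  fixes X :: "(real ^ 'n) set" and Y :: "(real ^ 'm) set"
    and F f :: "(real ^ 'n) \<times> (real ^ 'm) \<Rightarrow> real"
    and G :: "real ^ 'n \<Rightarrow> real ^ 'q" and g :: "real ^ 'm \<Rightarrow> real ^ 'p"
    and \<rho> \<sigma> \<delta> :: "nat \<Rightarrow> real"
    and x :: "nat \<Rightarrow> real ^ 'n" and xb :: "real ^ 'n" and yb :: "real ^ 'm"
  assumes X: "X \<noteq> {}" "closed X" "convex X" "X = {x. G x \<le> 0}"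
    and Y: "Y \<noteq> {}" "closed Y" "convex Y" "Y = {y. g y \<le> 0}"
    and G: "C1_on UNIV G" "\<And>i. convex_on UNIV (\<lambda>x. G x $ i)"
    and g: "C2_on UNIV g" "\<And>i. convex_on UNIV (\<lambda>y. g y $ i)"
    and F_smooth: "C1_on UNIV F" "\<exists>L. L-lipschitz_on (X \<times> Y) (\<lambda>w. gradient F (at w))"
    and F_concave: "\<And>x. x \<in> X \<Longrightarrow> concave_on Y (\<lambda>y. F (x, y))"
    and F_coercive:
      "\<And>x. x \<in> X \<Longrightarrow> filterlim (\<lambda>y. F (x, y)) at_bot (inf at_infinity (principal Y))"
    and f_smooth: "C1_on UNIV f" "\<exists>L. L-lipschitz_on (X \<times> Y) (\<lambda>w. gradient f (at w))"
    and f_convex: "\<And>x. x \<in> X \<Longrightarrow> convex_on Y (\<lambda>y. f (x, y))"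
    and S_nonempty: "\<And>x. x \<in> X \<Longrightarrow> lower_sol f Y x \<noteq> {}"
    and S_bounded: "\<And>Dx. Dx \<subseteq> X \<Longrightarrow> bounded Dx \<Longrightarrow>
      \<exists>Dy\<subseteq>Y. bounded Dy \<and> (\<forall>x\<in>Dx. lower_sol f Y x \<inter> Dy \<noteq> {})"
    and params: "\<And>k. \<rho> k > 0" "\<And>k. \<sigma> k > 0" "\<And>k. \<delta> k > 0"
      "filterlim \<rho> at_top sequentially" "\<sigma> \<longlonglongrightarrow> 0" "\<delta> \<longlonglongrightarrow> 0"
      "limsup (\<lambda>k. ereal (\<sigma> k / \<delta> k)) < \<infinity>"
    and x_in: "\<And>k. x k \<in> X"
    and x_lim: "x \<longlonglongrightarrow> xb"
    and eps: "(\<lambda>k. infdist 0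
        ((\<lambda>v. gradient (phi F f Y (\<rho> k) (\<sigma> k) (\<delta> k)) (at (x k) within X) + v)
           ` normal_cone X (x k))) \<longlonglongrightarrow> 0"
    and yb: "\<exists>r. strict_mono r \<and> (\<lambda>k. ystar F f Y (\<rho> (r k)) (\<sigma> (r k)) (\<delta> (r k)) (x (r k))) \<longlonglongrightarrow> yb"
    and isc: "inner_semicontinuous_at X (lower_sol f Y) xb"
    and f_C2: "C2_near (xb, yb) f"
    and MFCQ: "upper_MFCQ G xb"
    and LICQ: "lower_LICQ g yb"
    and error_bound: "uniform_error_bound f X Y xb yb"
  shows "yb \<in> pess_sol F f Y xb \<and> C_stationary F f G g xb"
proof -
  define DF where "DF w = gradient F (at w)" for w
  define Df where "Df w = gradient f (at w)" for w
  note DF = C1_on_gradient[OF F_smooth(1), folded DF_def] and Df = C1_on_gradient[OF f_smooth(1), folded Df_def]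
  have PM: "penalised_minimax X Y F f DF Df (\<rho> k) (\<sigma> k) (\<delta> k)" for k
    by unfold_locales
      (use X Y params F_smooth(2) f_smooth(2) F_concave f_convex DF Df
       in \<open>auto simp: lipschitzian_on_def DF_def[abs_def] Df_def[abs_def]\<close>)
  obtain r where r: "strict_mono r"
    "(\<lambda>k. ystar F f Y (\<rho> (r k)) (\<sigma> (r k)) (\<delta> (r k)) (x (r k))) \<longlonglongrightarrow> yb"
    using yb by blast
  define y where "y k = ystar F f Y (\<rho> (r k)) (\<sigma> (r k)) (\<delta> (r k)) (x (r k))" for k
  define z where "z k = snd (THE w. saddle_point Y Y (psi F f (\<rho> (r k)) (\<sigma> (r k)) (\<delta> (r k)) (x (r k))) w)" for k
  note opt = penalised_minimax.saddle_optimality[OF PM x_in y_def z_def]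
  note yz = opt(1,2) and y_max = opt(3) and z_min = opt(4) and cone_y = opt(5) and cone_z = opt(6) and phi' = opt(7)
  have fr: "filterlim r sequentially sequentially" using r(1) by (rule filterlim_subseq)
  have y_lim: "y \<longlonglongrightarrow> yb" using r(2) unfolding y_def[symmetric] .
  have lim: "(\<lambda>k. x (r k)) \<longlonglongrightarrow> xb" "filterlim (\<lambda>k. \<rho> (r k)) at_top sequentially"
    "(\<lambda>k. \<sigma> (r k)) \<longlonglongrightarrow> 0" "(\<lambda>k. \<delta> (r k)) \<longlonglongrightarrow> 0"
    using filterlim_compose[OF x_lim fr] filterlim_compose[OF params(4) fr] filterlim_compose[OF params(5) fr]
      filterlim_compose[OF params(6) fr] .
  have inv: "(\<lambda>k. 1 / \<rho> (r k)) \<longlonglongrightarrow> 0"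
    using tendsto_inverse_0_at_top[OF lim(2)] by (simp add: inverse_eq_divide)
  have xb: "xb \<in> X" using closed_sequentially[OF X(2) _ x_lim] x_in by blast
  have yb_in: "yb \<in> Y" using closed_sequentially[OF Y(2) _ y_lim] yz(1) by blast
  have S_in: "s \<in> Y" "\<And>t. t \<in> Y \<Longrightarrow> f (a, s) \<le> f (a, t)" if "s \<in> lower_sol f Y a" for s a
    using that by (auto simp: lower_sol_def is_arg_min_def not_less)
  have near: "norm (z k - y k) \<le> norm (s - y k)" if "s \<in> lower_sol f Y (x (r k))" for k s
    by (rule penalised_minimax.saddle_no_farther_than_lower_sol[OF PM yz z_min that])
  have "Bseq y" using y_lim by (intro convergent_imp_Bseq convergentI)
  then obtain My where My: "\<And>k. norm (y k) \<le> My" unfolding Bseq_def by auto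
  \<comment> \<open>A lower-level solution \<open>s\<close> inside \<open>Dy\<close> gives
    \<open>norm (z k) \<le> norm (s - y k) + norm (y k)\<close>, which accounts for
    \<open>M + 2 * My\<close>. The bound makes the regularisation terms vanish before
    \<open>z\<close> is known to converge.\<close>
  have "Bseq z"
  proof -
    have "Bseq x" using x_lim by (intro convergent_imp_Bseq convergentI)
    then obtain Dy where Dy: "bounded Dy" "\<And>k. lower_sol f Y (x k) \<inter> Dy \<noteq> {}"
      using S_bounded[of "range x"] x_in by (auto simp: Bseq_eq_bounded image_subset_iff)
    then obtain M where M: "\<And>s. s \<in> Dy \<Longrightarrow> norm s \<le> M" unfolding bounded_iff by blast
    have "norm (z k) \<le> M + 2 * My" for k
    proof -
      obtain s where s: "s \<in> lower_sol f Y (x (r k))" "norm s \<le> M" using Dy(2)[of "r k"] M by blast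
      show ?thesis
        using near[OF s(1)] s(2) My[of k] norm_triangle_ineq4[of s "y k"] norm_triangle_ineq2[of "z k" "y k"] by linarith
    qed
    then show ?thesis by (rule BseqI')
  qed
  have p_lim: "(\<lambda>k. \<sigma> (r k) *\<^sub>R z k + \<delta> (r k) *\<^sub>R y k) \<longlonglongrightarrow> 0"
    using tendsto_add[OF tendsto_scaleR_zero_Bseq[OF lim(3) \<open>Bseq z\<close>] tendsto_scaleR_zero_Bseq[OF lim(4) \<open>Bseq y\<close>]] by simp
  have q_lim: "(\<lambda>k. \<sigma> (r k) *\<^sub>R (z k - y k)) \<longlonglongrightarrow> 0"
    using tendsto_diff[OF tendsto_scaleR_zero_Bseq[OF lim(3) \<open>Bseq z\<close>] tendsto_scaleR_zero_Bseq[OF lim(3) \<open>Bseq y\<close>]]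
    by (simp add: scaleR_diff_right)
  have cont: "(\<lambda>k. h (x (r k), u k)) \<longlonglongrightarrow> h (xb, ub)" if "continuous_on UNIV h" "u \<longlonglongrightarrow> ub"
    for h :: "(real ^ 'n) \<times> (real ^ 'm) \<Rightarrow> 'c::t2_space" and u ub
    using that lim(1) by (auto simp: continuous_on_eq_continuous_at intro!: isCont_tendsto_compose[of _ h] tendsto_Pair)
  have F_cont: "continuous_on UNIV F"
    using has_derivative_continuous[OF DF(1)] by (simp add: continuous_on_eq_continuous_at)

  \<comment> \<open>The condition at \<open>y k\<close> is divided by \<open>\<rho>\<close>:
    \<open>F\<close> and the regularisation disappear in the limit, and the first-order condition of
    the convex lower-level problem remains.\<close>
  have yb_S: "yb \<in> lower_sol f Y xb"
  proof -
    have "f (xb, yb) \<le> f (xb, s)" if s: "s \<in> Y" for s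
    proof -
      have "(\<lambda>k. ((1 / \<rho> (r k)) *\<^sub>R (snd (DF (x (r k), y k)) - (\<sigma> (r k) *\<^sub>R z k + \<delta> (r k) *\<^sub>R y k)) - snd (Df (x (r k), y k))) \<bullet> (s - y k))
          \<longlonglongrightarrow> (0 *\<^sub>R (snd (DF (xb, yb)) - 0) - snd (Df (xb, yb))) \<bullet> (s - yb)"
        by (intro tendsto_inner tendsto_diff tendsto_scaleR tendsto_snd inv p_lim y_lim tendsto_const
            cont[OF DF(2)] cont[OF Df(2)])
      moreover have "((1 / \<rho> (r k)) *\<^sub>R (snd (DF (x (r k), y k)) - (\<sigma> (r k) *\<^sub>R z k + \<delta> (r k) *\<^sub>R y k)) - snd (Df (x (r k), y k))) \<bullet> (s - y k) \<le> 0" for k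
      proof -
        have "(snd (DF (x (r k), y k)) - \<rho> (r k) *\<^sub>R snd (Df (x (r k), y k)) - (\<sigma> (r k) *\<^sub>R z k + \<delta> (r k) *\<^sub>R y k)) \<bullet> (s - y k) \<le> 0"
          using cone_y[of k] s yz(1) by (auto simp: normal_cone_def)
        then have "(1 / \<rho> (r k)) * ((snd (DF (x (r k), y k)) - \<rho> (r k) *\<^sub>R snd (Df (x (r k), y k)) - (\<sigma> (r k) *\<^sub>R z k + \<delta> (r k) *\<^sub>R y k)) \<bullet> (s - y k)) \<le> 0"
          using params(1)[of "r k"] by (simp add: divide_nonpos_pos)
        also have "(1 / \<rho> (r k)) * ((snd (DF (x (r k), y k)) - \<rho> (r k) *\<^sub>R snd (Df (x (r k), y k)) - (\<sigma> (r k) *\<^sub>R z k + \<delta> (r k) *\<^sub>R y k)) \<bullet> (s - y k))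
            = ((1 / \<rho> (r k)) *\<^sub>R (snd (DF (x (r k), y k)) - \<rho> (r k) *\<^sub>R snd (Df (x (r k), y k)) - (\<sigma> (r k) *\<^sub>R z k + \<delta> (r k) *\<^sub>R y k))) \<bullet> (s - y k)"
          by simp
        also have "(1 / \<rho> (r k)) *\<^sub>R (snd (DF (x (r k), y k)) - \<rho> (r k) *\<^sub>R snd (Df (x (r k), y k)) - (\<sigma> (r k) *\<^sub>R z k + \<delta> (r k) *\<^sub>R y k))
            = (1 / \<rho> (r k)) *\<^sub>R (snd (DF (x (r k), y k)) - (\<sigma> (r k) *\<^sub>R z k + \<delta> (r k) *\<^sub>R y k)) - snd (Df (x (r k), y k))"
          using params(1)[of "r k"] by (simp add: scaleR_diff_right)
        finally show ?thesis .
      qed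
      ultimately have "- (snd (Df (xb, yb)) \<bullet> (s - yb)) \<le> 0"
        using LIMSEQ_le_const2[of _ "(0 *\<^sub>R (snd (DF (xb, yb)) - 0) - snd (Df (xb, yb))) \<bullet> (s - yb)" 0] by auto
      then show ?thesis
        using penalised_minimax.f_tangent[OF PM xb yb_in s] by linarith
    qed
    then show ?thesis using yb_in by (auto simp: lower_sol_def is_arg_min_def not_less)
  qed
  have pess: "yb \<in> pess_sol F f Y xb"
  proof -
    have "F (xb, s) \<le> F (xb, yb)" if s: "s \<in> lower_sol f Y xb" for s
    proof -
      \<comment> \<open>Inner semicontinuity makes every competitor \<open>s\<close> a limit of
        points \<open>t k\<close> that are lower-level optimal for \<open>x (r k)\<close>.\<close>
      obtain t where t: "\<And>k. t k \<in> lower_sol f Y (x (r k))" "t \<longlonglongrightarrow> s"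
        using isc s x_in lim(1) unfolding inner_semicontinuous_at_def by metis
      show ?thesis
      proof (rule LIMSEQ_le)
        show "(\<lambda>k. F (x (r k), t k)) \<longlonglongrightarrow> F (xb, s)" by (rule cont[OF F_cont t(2)])
        have "(\<lambda>k. F (x (r k), y k) + (t k - y k) \<bullet> (\<sigma> (r k) *\<^sub>R z k) + \<delta> (r k) / 2 * ((norm (t k))\<^sup>2 - (norm (y k))\<^sup>2))
            \<longlonglongrightarrow> F (xb, yb) + (s - yb) \<bullet> 0 + 0 / 2 * ((norm s)\<^sup>2 - (norm yb)\<^sup>2)"
          by (intro tendsto_add tendsto_inner tendsto_diff tendsto_mult tendsto_divide tendsto_const tendsto_power tendsto_norm
              cont[OF F_cont] y_lim t(2) lim tendsto_scaleR_zero_Bseq \<open>Bseq z\<close>) auto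
        then show "(\<lambda>k. F (x (r k), y k) + (t k - y k) \<bullet> (\<sigma> (r k) *\<^sub>R z k) + \<delta> (r k) / 2 * ((norm (t k))\<^sup>2 - (norm (y k))\<^sup>2))
            \<longlonglongrightarrow> F (xb, yb)" by simp
        have "F (x (r k), t k) \<le> F (x (r k), y k) + (t k - y k) \<bullet> (\<sigma> (r k) *\<^sub>R z k) + \<delta> (r k) / 2 * ((norm (t k))\<^sup>2 - (norm (y k))\<^sup>2)" for k
        proof -
          \<comment> \<open>Optimality of \<open>t k\<close> for \<open>f\<close> lets the penalty
            be dropped when \<open>t k\<close> is compared with the maximiser \<open>y k\<close>,
            however large \<open>\<rho>\<close> is.\<close>
          have "\<rho> (r k) * f (x (r k), t k) \<le> \<rho> (r k) * f (x (r k), y k)"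
            using S_in(2)[OF t(1) yz(1)] params(1)[of "r k"] by (simp add: mult_left_mono)
          then show ?thesis
            using y_max[OF S_in(1)[OF t(1)[of k]], of k] unfolding psi_def
            by (simp add: inner_diff_left algebra_simps)
        qed
        then show "\<exists>N. \<forall>k\<ge>N. F (x (r k), t k) \<le> F (x (r k), y k) + (t k - y k) \<bullet> (\<sigma> (r k) *\<^sub>R z k)
            + \<delta> (r k) / 2 * ((norm (t k))\<^sup>2 - (norm (y k))\<^sup>2)" by blast
      qed
    qed
    then show ?thesis using yb_S by (auto simp: pess_sol_def is_arg_max_def not_less)
  qed

  have \<gamma>_bounded: "Bseq (\<lambda>k. \<rho> (r k) *\<^sub>R (z k - y k))"
  proof -
    obtain U V \<kappa> where UV: "open U" "xb \<in> U" "open V" "yb \<in> V" "0 < \<kappa>"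
      and bound: "\<And>a b. a \<in> X \<inter> U \<Longrightarrow> b \<in> Y \<inter> V \<Longrightarrow> infdist b (lower_sol f Y a)
        \<le> \<kappa> * infdist 0 ((\<lambda>v. gradient (\<lambda>u. f (a, u)) (at b) + v) ` normal_cone Y b)"
      using error_bound unfolding uniform_error_bound_def by metis
    \<comment> \<open>The part of the condition at \<open>y k\<close> that carries no factor
      \<open>\<rho>\<close>. It stays bounded, so the lower-level residual at \<open>y k\<close> is
      at most \<open>norm (e k) / \<rho> (r k)\<close>.\<close>
    define e where "e k = snd (DF (x (r k), y k)) - (\<sigma> (r k) *\<^sub>R z k + \<delta> (r k) *\<^sub>R y k)" for k
    have "e \<longlonglongrightarrow> snd (DF (xb, yb)) - 0"
      unfolding e_def by (intro tendsto_diff tendsto_snd p_lim cont[OF DF(2)] y_lim)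
    from tendsto_scaleR[OF tendsto_const this] have "Bseq (\<lambda>k. \<kappa> *\<^sub>R e k)"
      by (intro convergent_imp_Bseq convergentI)
    then show ?thesis
    proof (rule Bseq_of_lower_bound[OF zero_less_one, rotated])
      have "\<forall>\<^sub>F k in sequentially. x (r k) \<in> U" "\<forall>\<^sub>F k in sequentially. y k \<in> V"
        using topological_tendstoD[OF lim(1) UV(1,2)] topological_tendstoD[OF y_lim UV(3,4)] .
      then show "\<forall>\<^sub>F k in sequentially. 1 * norm (\<rho> (r k) *\<^sub>R (z k - y k)) \<le> norm (\<kappa> *\<^sub>R e k)"
      proof eventually_elim
        case (elim k)
        \<comment> \<open>Dividing by \<open>\<rho>\<close> stays in the normal cone, and
          \<open>?v\<close> is the normal vector that added to the lower-level gradient leaves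
          exactly \<open>e k\<close> divided by \<open>\<rho> (r k)\<close>.\<close>
        let ?v = "(1 / \<rho> (r k)) *\<^sub>R (e k - \<rho> (r k) *\<^sub>R snd (Df (x (r k), y k)))"
        have "e k - \<rho> (r k) *\<^sub>R snd (Df (x (r k), y k)) \<in> normal_cone Y (y k)"
          using cone_y[of k] by (simp add: e_def algebra_simps)
        then have "?v \<in> normal_cone Y (y k)"
          using params(1)[of "r k"] yz(1) by (auto simp: normal_cone_def divide_nonpos_pos)
        moreover have "gradient (\<lambda>u. f (x (r k), u)) (at (y k)) + ?v = (1 / \<rho> (r k)) *\<^sub>R e k"
          using params(1)[of "r k"] by (simp add: gradient_snd[OF Df(1)] scaleR_diff_right)
        ultimately have "(1 / \<rho> (r k)) *\<^sub>R e k \<in> (\<lambda>v. gradient (\<lambda>u. f (x (r k), u)) (at (y k)) + v) ` normal_cone Y (y k)"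
          by (intro rev_image_eqI) auto
        from infdist_le[OF this, of 0] have "infdist 0 ((\<lambda>v. gradient (\<lambda>u. f (x (r k), u)) (at (y k)) + v) ` normal_cone Y (y k)) \<le> norm ((1 / \<rho> (r k)) *\<^sub>R e k)"
          unfolding dist_0_norm .
        moreover have "norm (z k - y k) \<le> infdist (y k) (lower_sol f Y (x (r k)))"
          using S_nonempty[OF x_in, of "r k"] near[of _ k]
          by (auto simp: infdist_notempty dist_norm norm_minus_commute intro!: cINF_greatest)
        moreover have "infdist (y k) (lower_sol f Y (x (r k)))
            \<le> \<kappa> * infdist 0 ((\<lambda>v. gradient (\<lambda>u. f (x (r k), u)) (at (y k)) + v) ` normal_cone Y (y k))"
          using elim x_in yz(1) by (intro bound) auto
        ultimately have "norm (z k - y k) \<le> \<kappa> * norm ((1 / \<rho> (r k)) *\<^sub>R e k)"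
          using UV(5) by (meson mult_left_mono less_imp_le order_trans)
        also have "\<dots> = (\<kappa> * norm (e k)) / \<rho> (r k)"
          using params(1)[of "r k"] by simp
        finally have "norm (z k - y k) * \<rho> (r k) \<le> \<kappa> * norm (e k)"
          using params(1)[of "r k"] by (simp only: pos_le_divide_eq)
        then show ?case
          using UV(5) params(1)[of "r k"] by (simp add: mult.commute)
      qed
    qed
  qed
  have z_lim: "z \<longlonglongrightarrow> yb"
  proof -
    have "(\<lambda>k. (1 / \<rho> (r k)) *\<^sub>R (\<rho> (r k) *\<^sub>R (z k - y k))) \<longlonglongrightarrow> 0"
      by (rule tendsto_scaleR_zero_Bseq[OF inv \<gamma>_bounded])
    then have "(\<lambda>k. z k - y k) \<longlonglongrightarrow> 0"
      using params(1)[THEN less_imp_neq, THEN not_sym] by simp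
    from tendsto_add[OF this y_lim] show ?thesis by simp
  qed

  \<comment> \<open>The slack \<open>inverse (real (Suc k))\<close> allows a nearly optimal normal
    vector to be picked without showing that the distance is attained. That \<open>0\<close> is
    normal rules out the empty set, for which \<open>infdist\<close> is \<open>0\<close> by
    convention.\<close>
  have "\<exists>v\<in>normal_cone X (x (r k)). norm (fst (DF (x (r k), y k)) - \<rho> (r k) *\<^sub>R fst (Df (x (r k), y k)) + \<rho> (r k) *\<^sub>R fst (Df (x (r k), z k)) + v)
      < infdist 0 ((\<lambda>v. gradient (phi F f Y (\<rho> (r k)) (\<sigma> (r k)) (\<delta> (r k))) (at (x (r k)) within X) + v) ` normal_cone X (x (r k)))
        + inverse (real (Suc k))" (is "\<exists>v\<in>_. norm (?D k + v) < ?d k + _") for k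
  proof -
    have "0 \<in> normal_cone X (x (r k))" using x_in by (simp add: normal_cone_def)
    moreover have "?d k < ?d k + inverse (real (Suc k))" by simp
    ultimately show ?thesis
      unfolding gradient_plus_normal_cone[OF X(3) x_in phi'] by (elim infdist_lessE) auto
  qed
  then obtain v where v: "\<And>k. v k \<in> normal_cone X (x (r k))"
    "\<And>k. norm (fst (DF (x (r k), y k)) - \<rho> (r k) *\<^sub>R fst (Df (x (r k), y k)) + \<rho> (r k) *\<^sub>R fst (Df (x (r k), z k)) + v k)
      < infdist 0 ((\<lambda>v. gradient (phi F f Y (\<rho> (r k)) (\<sigma> (r k)) (\<delta> (r k))) (at (x (r k)) within X) + v) ` normal_cone X (x (r k)))
        + inverse (real (Suc k))"
    by metis
  have v_lim: "(\<lambda>k. fst (DF (x (r k), y k)) - \<rho> (r k) *\<^sub>R fst (Df (x (r k), y k)) + \<rho> (r k) *\<^sub>R fst (Df (x (r k), z k)) + v k) \<longlonglongrightarrow> 0"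
  proof (rule Lim_null_comparison)
    show "(\<lambda>k. infdist 0 ((\<lambda>v. gradient (phi F f Y (\<rho> (r k)) (\<sigma> (r k)) (\<delta> (r k))) (at (x (r k)) within X) + v) ` normal_cone X (x (r k)))
        + inverse (real (Suc k))) \<longlonglongrightarrow> 0"
      using tendsto_add[OF filterlim_compose[OF eps fr] LIMSEQ_inverse_real_of_nat] by simp
  qed (use v(2) less_imp_le in \<open>blast intro: always_eventually\<close>)

  \<comment> \<open>A second subsequence, taken inside \<open>r\<close>, along which
    \<open>\<gamma>\<close> exists; the earlier limits pass to it.\<close>
  obtain s \<gamma> where s: "strict_mono s" "(\<lambda>k. \<rho> (r (s k)) *\<^sub>R (z (s k) - y (s k))) \<longlonglongrightarrow> \<gamma>"
    using bounded_imp_convergent_subsequence[of "\<lambda>k. \<rho> (r k) *\<^sub>R (z k - y k)"] \<gamma>_bounded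
    by (auto simp: Bseq_eq_bounded o_def)
  have fs: "filterlim s sequentially sequentially" using s(1) by (rule filterlim_subseq)
  obtain W f' f'' where f2: "open W" "(xb, yb) \<in> W"
    "\<And>w. w \<in> W \<Longrightarrow> (f has_derivative blinfun_apply (f' w)) (at w)"
    "\<And>w. w \<in> W \<Longrightarrow> (f' has_derivative blinfun_apply (f'' w)) (at w)" "continuous_on W f''"
    using f_C2 unfolding C2_near_def C2_on_def C1_on_def by metis
  obtain g' g'' where g2: "\<And>y. (g has_derivative blinfun_apply (g' y)) (at y)"
    "\<And>y. (g' has_derivative blinfun_apply (g'' y)) (at y)" "continuous_on UNIV g''"
    using g(1) unfolding C2_on_def C1_on_def by (metis UNIV_I)
  obtain G' where G1: "\<And>x. (G has_derivative blinfun_apply (G' x)) (at x)" "continuous_on UNIV G'"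
    using G(1) unfolding C1_on_def by (metis UNIV_I)
  interpret smooth_bilevel F f G g DF Df W f' f'' g' g'' G' xb yb
    by unfold_locales (fact DF Df f2 g2 G1)+
  have "C_stationary F f G g xb"
  \<comment> \<open>The regularisation acts as a vanishing perturbation: \<open>p\<close> is its
    contribution to the condition at \<open>y\<close>, \<open>q\<close> the one at
    \<open>z\<close>.\<close>
  proof (rule C_stationary_limit[where x = "\<lambda>k. x (r (s k))" and y = "\<lambda>k. y (s k)" and z = "\<lambda>k. z (s k)"
        and \<rho> = "\<lambda>k. \<rho> (r (s k))" and p = "\<lambda>k. \<sigma> (r (s k)) *\<^sub>R z (s k) + \<delta> (r (s k)) *\<^sub>R y (s k)"
        and q = "\<lambda>k. \<sigma> (r (s k)) *\<^sub>R (z (s k) - y (s k))" and v = "\<lambda>k. v (s k)"])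
    show "yb \<in> pess_sol F f {y. g y \<le> 0} xb" using pess Y(4) by simp
    show "(\<lambda>k. x (r (s k))) \<longlonglongrightarrow> xb" "(\<lambda>k. y (s k)) \<longlonglongrightarrow> yb" "(\<lambda>k. z (s k)) \<longlonglongrightarrow> yb"
      "filterlim (\<lambda>k. \<rho> (r (s k))) at_top sequentially"
      "(\<lambda>k. \<sigma> (r (s k)) *\<^sub>R z (s k) + \<delta> (r (s k)) *\<^sub>R y (s k)) \<longlonglongrightarrow> 0"
      "(\<lambda>k. \<sigma> (r (s k)) *\<^sub>R (z (s k) - y (s k))) \<longlonglongrightarrow> 0"
      "(\<lambda>k. fst (DF (x (r (s k)), y (s k))) - \<rho> (r (s k)) *\<^sub>R fst (Df (x (r (s k)), y (s k)))
        + \<rho> (r (s k)) *\<^sub>R fst (Df (x (r (s k)), z (s k))) + v (s k)) \<longlonglongrightarrow> 0"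
      using filterlim_compose[OF lim(1) fs] filterlim_compose[OF y_lim fs] filterlim_compose[OF z_lim fs]
        filterlim_compose[OF lim(2) fs] filterlim_compose[OF p_lim fs] filterlim_compose[OF q_lim fs]
        filterlim_compose[OF v_lim fs] .
    show "G (x (r (s k))) \<le> 0" for k using x_in X(4) by blast
    show "g (y (s k)) \<le> 0" "g (z (s k)) \<le> 0" for k using yz Y(4) by blast+
    show "v (s k) \<in> normal_cone {x. G x \<le> 0} (x (r (s k)))" for k using v(1) unfolding X(4) .
    show "snd (DF (x (r (s k)), y (s k))) - \<rho> (r (s k)) *\<^sub>R snd (Df (x (r (s k)), y (s k)))
        - (\<sigma> (r (s k)) *\<^sub>R z (s k) + \<delta> (r (s k)) *\<^sub>R y (s k)) \<in> normal_cone {y. g y \<le> 0} (y (s k))" for k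
      using cone_y unfolding Y(4) .
    show "- (\<rho> (r (s k)) *\<^sub>R snd (Df (x (r (s k)), z (s k)))) - \<sigma> (r (s k)) *\<^sub>R (z (s k) - y (s k))
        \<in> normal_cone {y. g y \<le> 0} (z (s k))" for k
      using cone_z unfolding Y(4) .
  qed (fact params s(2) MFCQ LICQ)+
  with pess show ?thesis by blast
qed

end
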